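(* Let $T\in\,]0,+\infty]$ and let $\boldsymbol u\in H^1_{loc}([0,T[;L^2(I,\mathbb S^{N-1}_+))\cap L^\infty_{loc}([0,T[;BV(I,\mathbb S^{N-1}_+))$. Then $\boldsymbol u$ is a strong solution in $[0,T[$ (with target $\mathcal N=\mathbb S^{N-1}$, in the sense (A) of the context) if and only if $\boldsymbol u$ is a solution in the sense (B) of the context.
   Context: $I\subset\mathbb R$ is a bounded open interval, $\mathbb S^{N-1}\subset\mathbb R^N$ is the unit sphere and $\mathbb S^{N-1}_+=\{(p^1,\dots,p^N)\in\mathbb S^{N-1}:p^k>0,\ k=1,\dots,N\}$. Function spaces with values in $\mathbb S^{N-1}_+$ consist of the functions in the corresponding $\mathbb R^N$-valued space with values in $\mathbb S^{N-1}_+$ a.e. On the sphere, $T_{\boldsymbol p}\mathbb S^{N-1}=\{\boldsymbol v\in\mathbb R^N:\boldsymbol p\cdot\boldsymbol v=0\}$, $\pi_{\boldsymbol p}:\mathbb R^N\to T_{\boldsymbol p}\mathbb S^{N-1}$ is the orthogonal projection, $\mathrm{dist}$ is the geodesic distance, $\log_{\boldsymbol p}$ the inverse of the exponential map; the injectivity radius is $\pi$. **BV functions.** Each $\boldsymbol w\in BV(I,\mathbb R^N)$ is identified with a representative having one-sided (left/right) limits $\boldsymbol w^\mp(x)$ at each $x\in I$, and extended to $\overline I$ by one-sided limits. $J_{\boldsymbol w}=\{\boldsymbol w^-\ne\boldsymbol w^+\}$ is the jump set; $\boldsymbol w^*=\frac12(\boldsymbol w^++\boldsymbol w^-)$. The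 derivative measure decomposes as $\boldsymbol w_x=\boldsymbol w_x^d+\boldsymbol w_x^j$, with $\boldsymbol w_x^j=(\boldsymbol w^+-\boldsymbol w^-)\mathcal H^0$ restricted to $J_{\boldsymbol w}$ and $\boldsymbol w_x^d$ the diffuse part; also $\boldsymbol w_x=\boldsymbol w_x^a\mathcal L^1+\boldsymbol w_x^c+\boldsymbol w_x^j$ with $\boldsymbol w_x^a$ the density of the absolutely continuous part and $\boldsymbol w_x^c$ the Cantor part. $|\boldsymbol w_x|$ is the total variation measure (with respect to the Euclidean norm). On $J_{\boldsymbol w}$, for sphere-valued $\boldsymbol w$ with $\mathrm{dist}(\boldsymbol w^-,\boldsymbol w^+)<\pi$: $\boldsymbol T^-_{\boldsymbol w}=\frac{\log_{\boldsymbol w^-}\boldsymbol w^+}{\mathrm{dist}(\boldsymbol w^-,\boldsymbol w^+)}$, $\boldsymbol T^+_{\boldsymbol w}=-\frac{\log_{\boldsymbol w^+}\boldsymbol w^-}{\mathrm{dist}(\boldsymbol w^-,\boldsymbol w^+)}$. **Weak-* spaces.** For a dual space $X^*$, $L^p_{w^*}(0,T;X^* )$ is the space of weakly-* measurable functions $(0,T)\to X^*$ with $p$-integrable norm (essentially bounded if $p=\infty$); here $L^\infty(I)=L^1(I)^*$, and $BV(I)=X^*$ with $X=\{\varphi+\psi_x:\varphi,\psi\in C_0(I)\}$. The subscript $loc([0,T[)$ means that the property holds on $]0,T'[$ for each $T'<T$. **(A) Strong solution.** $\boldsymbol u$ is a strong solution in $[0,T[$ if $\mathrm{dist}(\boldsymbol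 u^-(t,x),\boldsymbol u^+(t,x))<\pi$ for all $x\in I$ and a.e. $t\in\,]0,T[$, and there exists $\boldsymbol z\in L^\infty_{w^*}(0,T;L^\infty(I,\mathbb R^N))\cap L^2_{w^*,loc}([0,T[;BV(I,\mathbb R^N))$ such that for a.e. $t\in\,]0,T[$: 1. $\boldsymbol u_t(t)=\pi_{\boldsymbol u(t)}\boldsymbol z_x^a(t)$ $\mathcal L^1$-a.e. in $I$; 2. $\pi_{\boldsymbol u(t)}\boldsymbol z_x^c(t)=0$ as measures; 3. $\boldsymbol z^\pm(t)\in T_{\boldsymbol u^\pm(t)}\mathbb S^{N-1}$ in $I$; 4. $|\boldsymbol z(t)|\le1$ in $I$; 5. $\boldsymbol z(t)=\frac{\boldsymbol u_x(t)}{|\boldsymbol u_x(t)|}$ (Radon–Nikodym derivative) $|\boldsymbol u_x^d(t)|$-a.e. in $I$; 6. $J_{\boldsymbol z(t)}\subseteq J_{\boldsymbol u(t)}$; 7. $\boldsymbol z^\pm(t)=\boldsymbol T^\pm_{\boldsymbol u(t)}$ on $J_{\boldsymbol u(t)}$; 8. $\boldsymbol z(t)=0$ on $\partial I$. **(B) Solution in the second sense.** $\boldsymbol u$ is a solution in the sense (B) if there exists $\boldsymbol z\in L^\infty_{w^*}(0,T;L^\infty(I,\mathbb R^N))\cap L^2_{w^*,loc}([0,T[;BV(I,\mathbb R^N))$ such that for a.e. $t\in\,]0,T[$: $|\boldsymbol z|\le1$ in $I$; $\boldsymbol z=0$ on $\partial I$; $$\boldsymbol u_t\,\mathcal L^1=\boldsymbol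 z_x+\frac{\boldsymbol u^*}{|\boldsymbol u^*|}|\boldsymbol u_x|\quad\text{as Radon measures on }I;$$ $$\boldsymbol u_t\wedge\boldsymbol u=(\boldsymbol z\wedge\boldsymbol u)_x\quad\text{in }L^2(I,\mathbb R^N\wedge\mathbb R^N);$$ $$\boldsymbol z\cdot\boldsymbol u=0\quad\text{a.e. on }I.$$ *)

theory Defs
  imports "HOL-Analysis.Analysis"
begin

section \<open>Finite vector measures on a subset of the line\<close>

text \<open>
  An \<open>\<real>\<^sup>N\<close>-valued measure on \<open>I\<close> is a countably additive set function on the Borel subsets of
  \<open>I\<close>; its values on other sets are irrelevant.
\<close>

abbreviation borel_sets :: "real set \<Rightarrow> real set set" where
  "borel_sets I \<equiv> sets (restrict_space borel I)"

definition vector_measure :: "real set \<Rightarrow> (real set \<Rightarrow> 'a::euclidean_space) \<Rightarrow> bool" where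
  "vector_measure I \<mu> \<longleftrightarrow>
     (\<forall>A. range A \<subseteq> borel_sets I \<longrightarrow> disjoint_family A \<longrightarrow> (\<lambda>i::nat. \<mu> (A i)) sums \<mu> (\<Union>i. A i))"

definition total_variation :: "real set \<Rightarrow> (real set \<Rightarrow> 'a::euclidean_space) \<Rightarrow> real measure" where
  "total_variation I \<mu> = measure_of I (borel_sets I)
     (\<lambda>E. SUP A\<in>{A. range A \<subseteq> borel_sets I \<and> disjoint_family A \<and> (\<Union>i. A i) = E}.
            \<Sum>i::nat. ennreal (norm (\<mu> (A i))))"

definition has_vRN_deriv :: "'b measure \<Rightarrow> ('b set \<Rightarrow> 'a::euclidean_space) \<Rightarrow> ('b \<Rightarrow> 'a) \<Rightarrow> bool" where
  "has_vRN_deriv M \<mu> f \<longleftrightarrow>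
     integrable M f \<and> (\<forall>A\<in>sets M. \<mu> A = set_lebesgue_integral M A f)"

definition vRN_deriv :: "'b measure \<Rightarrow> ('b set \<Rightarrow> 'a::euclidean_space) \<Rightarrow> 'b \<Rightarrow> 'a" where
  "vRN_deriv M \<mu> = (SOME f. has_vRN_deriv M \<mu> f)"

text \<open>The density \<open>\<mu>/|\<mu>|\<close>. Integrals against \<open>\<mu>\<close> are integrals of this density against \<open>|\<mu>|\<close>.\<close>

definition polar :: "real set \<Rightarrow> (real set \<Rightarrow> 'a::euclidean_space) \<Rightarrow> real \<Rightarrow> 'a" where
  "polar I \<mu> = vRN_deriv (total_variation I \<mu>) \<mu>"

text \<open>
  The density of the absolutely continuous part in the Lebesgue decomposition of \<open>\<mu>\<close>: the
  remainder \<open>\<mu> - f \<L>\<^sup>1\<close> is concentrated on a null set.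
\<close>

definition has_ac_density ::
    "real set \<Rightarrow> (real set \<Rightarrow> 'a::euclidean_space) \<Rightarrow> (real \<Rightarrow> 'a) \<Rightarrow> bool" where
  "has_ac_density I \<mu> f \<longleftrightarrow> integrable (lebesgue_on I) f \<and>
     (\<exists>S\<in>null_sets lborel. \<forall>A\<in>borel_sets I. A \<inter> S = {} \<longrightarrow>
        \<mu> A = set_lebesgue_integral (lebesgue_on I) A f)"

definition ac_density :: "real set \<Rightarrow> (real set \<Rightarrow> 'a::euclidean_space) \<Rightarrow> real \<Rightarrow> 'a" where
  "ac_density I \<mu> = (SOME f. has_ac_density I \<mu> f)"


section \<open>Functions of bounded variation\<close>

definition C1_c :: "real set \<Rightarrow> (real \<Rightarrow> real) set" where
  "C1_c S = {\<phi>. \<phi> C1_differentiable_on UNIV \<and>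
                (\<exists>K. compact K \<and> K \<subseteq> S \<and> (\<forall>x. x \<notin> K \<longrightarrow> \<phi> x = 0))}"

definition has_deriv_measure ::
    "real set \<Rightarrow> (real \<Rightarrow> 'a::euclidean_space) \<Rightarrow> (real set \<Rightarrow> 'a) \<Rightarrow> bool" where
  "has_deriv_measure I w \<mu> \<longleftrightarrow> vector_measure I \<mu> \<and>
     (\<forall>\<phi>\<in>C1_c I. (LINT x|lebesgue_on I. deriv \<phi> x *\<^sub>R w x)
                 = - (LINT x|total_variation I \<mu>. \<phi> x *\<^sub>R polar I \<mu> x))"

definition BV :: "real set \<Rightarrow> (real \<Rightarrow> 'a::euclidean_space) \<Rightarrow> bool" where
  "BV I w \<longleftrightarrow> integrable (lebesgue_on I) w \<and> (\<exists>\<mu>. has_deriv_measure I w \<mu>)"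

definition Dm :: "real set \<Rightarrow> (real \<Rightarrow> 'a::euclidean_space) \<Rightarrow> real set \<Rightarrow> 'a" where
  "Dm I w = (SOME \<mu>. has_deriv_measure I w \<mu>)"

text \<open>
  \<open>BV I w\<close> depends only on the a.e. class of \<open>w\<close>. Pointwise notions refer to a representative with
  one-sided limits everywhere on the closure of \<open>I\<close> (at an end point, one of the two limits is
  along the trivial filter). The one-sided limits do not depend on its choice, and two choices
  differ at most on a countable set.
\<close>

definition good_rep :: "real set \<Rightarrow> (real \<Rightarrow> 'a::euclidean_space) \<Rightarrow> (real \<Rightarrow> 'a) \<Rightarrow> bool" where
  "good_rep I w v \<longleftrightarrow> (AE x in lebesgue_on I. v x = w x) \<and>
     (\<forall>x\<in>closure I. (\<exists>l. (v \<longlongrightarrow> l) (at x within (I \<inter> {..<x}))) \<and>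
                    (\<exists>l. (v \<longlongrightarrow> l) (at x within (I \<inter> {x<..}))))"

definition rep :: "real set \<Rightarrow> (real \<Rightarrow> 'a::euclidean_space) \<Rightarrow> real \<Rightarrow> 'a" where
  "rep I w = (SOME v. good_rep I w v)"

definition trL :: "real set \<Rightarrow> (real \<Rightarrow> 'a::euclidean_space) \<Rightarrow> real \<Rightarrow> 'a" where
  "trL I w x = Lim (at x within (I \<inter> {..<x})) (rep I w)"

definition trR :: "real set \<Rightarrow> (real \<Rightarrow> 'a::euclidean_space) \<Rightarrow> real \<Rightarrow> 'a" where
  "trR I w x = Lim (at x within (I \<inter> {x<..})) (rep I w)"

definition mid :: "real set \<Rightarrow> (real \<Rightarrow> 'a::euclidean_space) \<Rightarrow> real \<Rightarrow> 'a" where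
  "mid I w x = (1/2) *\<^sub>R (trR I w x + trL I w x)"

definition jump_set :: "real set \<Rightarrow> (real \<Rightarrow> 'a::euclidean_space) \<Rightarrow> real set" where
  "jump_set I w = {x\<in>I. trL I w x \<noteq> trR I w x}"

definition zero_on_boundary :: "real set \<Rightarrow> (real \<Rightarrow> 'a::euclidean_space) \<Rightarrow> bool" where
  "zero_on_boundary I w \<longleftrightarrow> (\<forall>x\<in>frontier I. Lim (at x within I) (rep I w) = 0)"

text \<open>
  At a jump point the bound is required of both one-sided values; for a \<open>BV\<close> function this is the
  same as the bound almost everywhere.
\<close>

definition norm_le_one :: "real set \<Rightarrow> (real \<Rightarrow> 'a::euclidean_space) \<Rightarrow> bool" where
  "norm_le_one I w \<longleftrightarrow> (\<forall>x\<in>I. norm (trL I w x) \<le> 1 \<and> norm (trR I w x) \<le> 1)"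

definition jump_part :: "real set \<Rightarrow> (real \<Rightarrow> 'a::euclidean_space) \<Rightarrow> real set \<Rightarrow> 'a" where
  "jump_part I w A = (LINT x|count_space (A \<inter> jump_set I w). trR I w x - trL I w x)"

definition diffuse_part :: "real set \<Rightarrow> (real \<Rightarrow> 'a::euclidean_space) \<Rightarrow> real set \<Rightarrow> 'a" where
  "diffuse_part I w A = Dm I w A - jump_part I w A"

definition ac_deriv :: "real set \<Rightarrow> (real \<Rightarrow> 'a::euclidean_space) \<Rightarrow> real \<Rightarrow> 'a" where
  "ac_deriv I w = ac_density I (Dm I w)"

definition cantor_part :: "real set \<Rightarrow> (real \<Rightarrow> 'a::euclidean_space) \<Rightarrow> real set \<Rightarrow> 'a" where
  "cantor_part I w A =
     Dm I w A - set_lebesgue_integral (lebesgue_on I) A (ac_deriv I w) - jump_part I w A"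

definition bv_norm :: "real set \<Rightarrow> (real \<Rightarrow> 'a::euclidean_space) \<Rightarrow> real" where
  "bv_norm I w = (LINT x|lebesgue_on I. norm (w x)) + measure (total_variation I (Dm I w)) I"


section \<open>Function spaces in time\<close>

definition time_interval :: "ereal \<Rightarrow> real set" where
  "time_interval T = {t. 0 < t \<and> ereal t < T}"

definition L2 :: "real set \<Rightarrow> (real \<Rightarrow> 'a::euclidean_space) \<Rightarrow> bool" where
  "L2 I f \<longleftrightarrow> f \<in> borel_measurable (lebesgue_on I) \<and>
             integrable (lebesgue_on I) (\<lambda>x. (norm (f x))\<^sup>2)"

definition L2_norm :: "real set \<Rightarrow> (real \<Rightarrow> 'a::euclidean_space) \<Rightarrow> real" where
  "L2_norm I f = sqrt (LINT x|lebesgue_on I. (norm (f x))\<^sup>2)"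

text \<open>
  A map \<open>t \<mapsto> f t\<close> into \<open>L\<^sup>2(I,\<real>\<^sup>N)\<close> is strongly measurable if it is a.e. the \<open>L\<^sup>2\<close>-limit of
  simple functions; \<open>L\<^sup>2(0,T';L\<^sup>2)\<close> is the corresponding Bochner space.
\<close>

definition strongly_measurable_L2 ::
    "real set \<Rightarrow> real set \<Rightarrow> (real \<Rightarrow> real \<Rightarrow> 'a::euclidean_space) \<Rightarrow> bool" where
  "strongly_measurable_L2 J I f \<longleftrightarrow> (AE t in lebesgue_on J. L2 I (f t)) \<and>
     (\<exists>s::nat \<Rightarrow> real \<Rightarrow> real \<Rightarrow> 'a.
        (\<forall>k. simple_function (lebesgue_on J) (s k) \<and> (\<forall>t\<in>J. L2 I (s k t))) \<and>
        (AE t in lebesgue_on J. (\<lambda>k. L2_norm I (\<lambda>x. s k t x - f t x)) \<longlonglongrightarrow> 0))"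

definition L2_loc_L2 :: "real set \<Rightarrow> ereal \<Rightarrow> (real \<Rightarrow> real \<Rightarrow> 'a::euclidean_space) \<Rightarrow> bool" where
  "L2_loc_L2 I T f \<longleftrightarrow> (\<forall>T'>0. ereal T' < T \<longrightarrow>
     strongly_measurable_L2 {0<..<T'} I f \<and>
     integrable (lebesgue_on {0<..<T'}) (\<lambda>t. (L2_norm I (f t))\<^sup>2))"

text \<open>
  \<open>v\<close> is the weak time derivative of \<open>u\<close>. The identity between Bochner integrals
  \<open>\<integral> \<phi>' u dt = - \<integral> \<phi> v dt\<close> in \<open>L\<^sup>2(I,\<real>\<^sup>N)\<close> is written by pairing with an arbitrary
  \<open>\<eta>\<close> in \<open>L\<^sup>2(I,\<real>\<^sup>N)\<close>.
\<close>

definition has_time_deriv ::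
    "real set \<Rightarrow> ereal \<Rightarrow> (real \<Rightarrow> real \<Rightarrow> 'a::euclidean_space) \<Rightarrow> (real \<Rightarrow> real \<Rightarrow> 'a) \<Rightarrow> bool" where
  "has_time_deriv I T u v \<longleftrightarrow> L2_loc_L2 I T u \<and> L2_loc_L2 I T v \<and>
     (\<forall>\<phi>\<in>C1_c (time_interval T). \<forall>\<eta>. L2 I \<eta> \<longrightarrow>
        (LINT t|lebesgue_on (time_interval T). deriv \<phi> t * (LINT x|lebesgue_on I. u t x \<bullet> \<eta> x))
        = - (LINT t|lebesgue_on (time_interval T). \<phi> t * (LINT x|lebesgue_on I. v t x \<bullet> \<eta> x)))"

definition H1_loc_L2 :: "real set \<Rightarrow> ereal \<Rightarrow> (real \<Rightarrow> real \<Rightarrow> 'a::euclidean_space) \<Rightarrow> bool" where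
  "H1_loc_L2 I T u \<longleftrightarrow> (\<exists>v. has_time_deriv I T u v)"

definition time_deriv ::
    "real set \<Rightarrow> ereal \<Rightarrow> (real \<Rightarrow> real \<Rightarrow> 'a::euclidean_space) \<Rightarrow> real \<Rightarrow> real \<Rightarrow> 'a" where
  "time_deriv I T u = (SOME v. has_time_deriv I T u v)"

definition Linf_wstar_Linf :: "real set \<Rightarrow> ereal \<Rightarrow> (real \<Rightarrow> real \<Rightarrow> 'a::euclidean_space) \<Rightarrow> bool" where
  "Linf_wstar_Linf I T z \<longleftrightarrow>
     (\<exists>C. AE t in lebesgue_on (time_interval T).
        z t \<in> borel_measurable (lebesgue_on I) \<and> (AE x in lebesgue_on I. norm (z t x) \<le> C)) \<and>
     (\<forall>\<psi>. integrable (lebesgue_on I) \<psi> \<longrightarrow>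
        (\<lambda>t. LINT x|lebesgue_on I. z t x \<bullet> \<psi> x)
          \<in> borel_measurable (lebesgue_on (time_interval T)))"

definition C_0 :: "real set \<Rightarrow> (real \<Rightarrow> 'a::euclidean_space) set" where
  "C_0 I = {\<phi>. continuous_on (closure I) \<phi> \<and> (\<forall>x\<in>frontier I. \<phi> x = 0)}"

text \<open>Duality between \<open>w\<close> in \<open>BV(I)\<close> and the predual element \<open>\<phi> + \<psi>\<^sub>x\<close>.\<close>

definition bv_pairing ::
    "real set \<Rightarrow> (real \<Rightarrow> 'a::euclidean_space) \<Rightarrow> (real \<Rightarrow> 'a) \<Rightarrow> (real \<Rightarrow> 'a) \<Rightarrow> real" where
  "bv_pairing I w \<phi> \<psi> = (LINT x|lebesgue_on I. w x \<bullet> \<phi> x)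
     - (LINT x|total_variation I (Dm I w). \<psi> x \<bullet> polar I (Dm I w) x)"

definition wstar_measurable_BV ::
    "real set \<Rightarrow> real set \<Rightarrow> (real \<Rightarrow> real \<Rightarrow> 'a::euclidean_space) \<Rightarrow> bool" where
  "wstar_measurable_BV J I w \<longleftrightarrow> (AE t in lebesgue_on J. BV I (w t)) \<and>
     (\<forall>\<phi>\<in>C_0 I. \<forall>\<psi>\<in>C_0 I.
        (\<lambda>t. bv_pairing I (w t) \<phi> \<psi>) \<in> borel_measurable (lebesgue_on J))"

definition L2_wstar_loc_BV :: "real set \<Rightarrow> ereal \<Rightarrow> (real \<Rightarrow> real \<Rightarrow> 'a::euclidean_space) \<Rightarrow> bool" where
  "L2_wstar_loc_BV I T w \<longleftrightarrow> (\<forall>T'>0. ereal T' < T \<longrightarrow>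
     wstar_measurable_BV {0<..<T'} I w \<and>
     integrable (lebesgue_on {0<..<T'}) (\<lambda>t. (bv_norm I (w t))\<^sup>2))"

definition Linf_loc_BV :: "real set \<Rightarrow> ereal \<Rightarrow> (real \<Rightarrow> real \<Rightarrow> 'a::euclidean_space) \<Rightarrow> bool" where
  "Linf_loc_BV I T w \<longleftrightarrow> (\<forall>T'>0. ereal T' < T \<longrightarrow>
     wstar_measurable_BV {0<..<T'} I w \<and>
     (\<exists>C. AE t in lebesgue_on {0<..<T'}. bv_norm I (w t) \<le> C))"

definition takes_values_in ::
    "real set \<Rightarrow> ereal \<Rightarrow> (real \<Rightarrow> real \<Rightarrow> 'a) \<Rightarrow> 'a set \<Rightarrow> bool" where
  "takes_values_in I T u S \<longleftrightarrow>
     (AE t in lebesgue_on (time_interval T). AE x in lebesgue_on I. u t x \<in> S)"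


section \<open>Geometry of the unit sphere\<close>

definition pos_sphere :: "(real ^ 'n) set" where
  "pos_sphere = {p. p \<in> sphere 0 1 \<and> (\<forall>k. p $ k > 0)}"

definition tangent :: "'a::euclidean_space \<Rightarrow> 'a set" where
  "tangent p = {v. p \<bullet> v = 0}"

definition tproj :: "'a::euclidean_space \<Rightarrow> 'a \<Rightarrow> 'a" where
  "tproj p v = v - (p \<bullet> v) *\<^sub>R p"

text \<open>
  The length is a Lebesgue integral with values in \<open>[0,\<infinity>]\<close> because the derivative of a \<open>valid_path\<close>
  may blow up at the exceptional points.
\<close>

definition curve_length :: "(real \<Rightarrow> 'a::euclidean_space) \<Rightarrow> ennreal" where
  "curve_length \<gamma> = (\<integral>\<^sup>+t\<in>{0..1}. ennreal (norm (vector_derivative \<gamma> (at t within {0..1}))) \<partial>lebesgue)"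

text \<open>Geodesic distance on the unit sphere; \<open>\<infinity>\<close> between the two points of \<open>S\<^sup>0\<close>.\<close>

definition geodesic_dist :: "'a::euclidean_space \<Rightarrow> 'a \<Rightarrow> ennreal" where
  "geodesic_dist p q =
     (INF \<gamma>\<in>{\<gamma>. valid_path \<gamma> \<and> path_image \<gamma> \<subseteq> sphere 0 1 \<and>
                 pathstart \<gamma> = p \<and> pathfinish \<gamma> = q}. curve_length \<gamma>)"

text \<open>
  \<open>s \<mapsto> sphere_exp p (s v)\<close> is the great-circle geodesic leaving \<open>p\<close> with velocity \<open>v\<close>. The
  logarithm inverts the exponential on the tangent ball whose radius is the injectivity radius.
\<close>

definition sphere_exp :: "'a::euclidean_space \<Rightarrow> 'a \<Rightarrow> 'a" where
  "sphere_exp p v = cos (norm v) *\<^sub>R p + (sin (norm v) / norm v) *\<^sub>R v"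

definition sphere_log :: "'a::euclidean_space \<Rightarrow> 'a \<Rightarrow> 'a" where
  "sphere_log p = inv_into {v \<in> tangent p. norm v < pi} (sphere_exp p)"

definition Tminus :: "real set \<Rightarrow> (real \<Rightarrow> 'a::euclidean_space) \<Rightarrow> real \<Rightarrow> 'a" where
  "Tminus I w x = (1 / enn2real (geodesic_dist (trL I w x) (trR I w x))) *\<^sub>R
                  sphere_log (trL I w x) (trR I w x)"

definition Tplus :: "real set \<Rightarrow> (real \<Rightarrow> 'a::euclidean_space) \<Rightarrow> real \<Rightarrow> 'a" where
  "Tplus I w x = - ((1 / enn2real (geodesic_dist (trL I w x) (trR I w x))) *\<^sub>R
                    sphere_log (trR I w x) (trL I w x))"

text \<open>\<open>\<real>\<^sup>N \<and> \<real>\<^sup>N\<close> is realised as the space of antisymmetric matrices.\<close>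

definition wedge :: "real ^ 'n \<Rightarrow> real ^ 'n \<Rightarrow> real ^ 'n ^ 'n" where
  "wedge v w = (\<chi> i j. v $ i * w $ j - v $ j * w $ i)"


section \<open>The two notions of solution\<close>

text \<open>\<open>f\<^sub>x = g\<close> in \<open>L\<^sup>2(I)\<close>, in the sense of distributions.\<close>

definition has_weak_deriv_L2 ::
    "real set \<Rightarrow> (real \<Rightarrow> 'a::euclidean_space) \<Rightarrow> (real \<Rightarrow> 'a) \<Rightarrow> bool" where
  "has_weak_deriv_L2 I f g \<longleftrightarrow> integrable (lebesgue_on I) f \<and> L2 I g \<and>
     (\<forall>\<phi>\<in>C1_c I. (LINT x|lebesgue_on I. deriv \<phi> x *\<^sub>R f x)
                 = - (LINT x|lebesgue_on I. \<phi> x *\<^sub>R g x))"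

text \<open>
  In the conditions involving the Cantor part of \<open>z\<close> and the diffuse part of \<open>u\<close>, the functions are
  evaluated through \<open>rep\<close>; these measures do not charge the countable set on which the choice of
  representative matters.
\<close>

definition strong_solution :: "real set \<Rightarrow> ereal \<Rightarrow> (real \<Rightarrow> real \<Rightarrow> 'a::euclidean_space) \<Rightarrow> bool" where
  "strong_solution I T u \<longleftrightarrow>
     (AE t in lebesgue_on (time_interval T).
        \<forall>x\<in>I. geodesic_dist (trL I (u t) x) (trR I (u t) x) < ennreal pi) \<and>
     (\<exists>z. Linf_wstar_Linf I T z \<and> L2_wstar_loc_BV I T z \<and>
        (AE t in lebesgue_on (time_interval T).
           (AE x in lebesgue_on I.
              time_deriv I T u t x = tproj (u t x) (ac_deriv I (z t) x)) \<and>
           (\<forall>A\<in>borel_sets I.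
              set_lebesgue_integral (total_variation I (cantor_part I (z t))) A
                (\<lambda>x. tproj (rep I (u t) x) (polar I (cantor_part I (z t)) x)) = 0) \<and>
           (\<forall>x\<in>I. trL I (z t) x \<in> tangent (trL I (u t) x) \<and>
                  trR I (z t) x \<in> tangent (trR I (u t) x)) \<and>
           norm_le_one I (z t) \<and>
           (AE x in total_variation I (diffuse_part I (u t)).
              rep I (z t) x = vRN_deriv (total_variation I (Dm I (u t))) (Dm I (u t)) x) \<and>
           jump_set I (z t) \<subseteq> jump_set I (u t) \<and>
           (\<forall>x\<in>jump_set I (u t). trL I (z t) x = Tminus I (u t) x \<and>
                                 trR I (z t) x = Tplus I (u t) x) \<and>
           zero_on_boundary I (z t)))"

definition solution_B :: "real set \<Rightarrow> ereal \<Rightarrow> (real \<Rightarrow> real \<Rightarrow> real ^ 'n) \<Rightarrow> bool" where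
  "solution_B I T u \<longleftrightarrow>
     (\<exists>z. Linf_wstar_Linf I T z \<and> L2_wstar_loc_BV I T z \<and>
        (AE t in lebesgue_on (time_interval T).
           norm_le_one I (z t) \<and>
           zero_on_boundary I (z t) \<and>
           (\<forall>A\<in>borel_sets I.
              set_lebesgue_integral (lebesgue_on I) A (time_deriv I T u t) =
              Dm I (z t) A +
              set_lebesgue_integral (total_variation I (Dm I (u t))) A
                (\<lambda>x. (1 / norm (mid I (u t) x)) *\<^sub>R mid I (u t) x)) \<and>
           has_weak_deriv_L2 I (\<lambda>x. wedge (z t x) (u t x))
                               (\<lambda>x. wedge (time_deriv I T u t x) (u t x)) \<and>
           (AE x in lebesgue_on I. z t x \<bullet> u t x = 0)))"

end

theory Submission
  imports Defs "HOL-Real_Asymp.Real_Asymp"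
begin

text \<open>
  For almost every time both notions of solution are conditions on three functions of one real
  variable: \<open>w = u(t)\<close>, a \<open>BV\<close> function with unit values, \<open>z = z(t)\<close>, again \<open>BV\<close>, and
  \<open>v = u\<^sub>t(t)\<close>. The evolution in time contributes only the relation \<open>u \<cdot> v = 0\<close>, which is the
  derivative of \<open>|u|\<^sup>2 = 1\<close> (\<open>time_derivative_orthogonal\<close>). So it is enough to compare the two
  systems of conditions at a fixed time, and one and the same \<open>z\<close> serves both.

  At a fixed time all measures in sight have densities with respect to one finite measure \<open>M\<close> on
  the interval: \<open>w\<^sub>x = \<alpha> M\<close>, \<open>z\<^sub>x = \<beta> M\<close> and \<open>\<L>\<^sup>1 = l M\<close> (\<open>common_density\<close>). Write \<open>p\<close>, \<open>q\<close> for the left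
  and right limits of \<open>w\<close>, and \<open>zl\<close>, \<open>zr\<close> for those of \<open>z\<close>. Equations between measures turn
  into equations that hold \<open>M\<close>-almost everywhere:

    \<^item> the measure equation of (B) is \<open>l v = \<beta> + |\<alpha>| (p + q) / |p + q|\<close>;
    \<^item> conditions 1 and 2 of (A) together say \<open>l v = \<pi>\<^sub>q \<beta>\<close> off the jump set of \<open>z\<close>;
    \<^item> condition 5 of (A) is \<open>|\<alpha>| z = \<alpha>\<close> off the jump set of \<open>w\<close>;
    \<^item> a jump point \<open>x\<close> is an atom of \<open>M\<close>, where \<open>q - p = M{x} \<alpha>\<close> and \<open>zr - zl = M{x} \<beta>\<close>.

  The link between \<open>\<alpha>\<close> and \<open>\<beta>\<close> is the product rule (\<open>primitive_product\<close>): if \<open>z \<cdot> w = 0\<close> almost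
  everywhere, then \<open>zl \<cdot> \<alpha> + \<beta> \<cdot> q = 0\<close>.

  From (A) to (B): away from jumps \<open>z \<cdot> \<alpha> = |\<alpha>|\<close>, so \<open>q \<cdot> \<beta> = - |\<alpha>|\<close>, and \<open>\<pi>\<^sub>q \<beta> = \<beta> + |\<alpha>| q\<close>. At a jump
  the measure equation is an identity between the two tangent vectors of the geodesic from \<open>p\<close>
  to \<open>q\<close> (\<open>geodesic_dir_jump\<close>). The equation for \<open>z \<and> w\<close> follows from the product rule: wedging the
  measure equation with \<open>w\<close> removes its last term, and \<open>z\<close> is parallel to \<open>w\<^sub>x\<close>.

  From (B) to (A): the inner product of the measure equation with \<open>w\<close> gives \<open>z \<cdot> \<alpha> = |\<alpha>|\<close>, because
  \<open>w \<cdot> v = 0\<close>; as \<open>|z| \<le> 1\<close>, this forces \<open>|\<alpha>| z = \<alpha>\<close>. The same argument at a jump gives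
  \<open>zl \<cdot> T\<^sup>- = 1\<close> for the unit tangent vector \<open>T\<^sup>-\<close>, hence \<open>zl = T\<^sup>-\<close>.

  The positivity of the components of \<open>w\<close> keeps \<open>p\<close> and \<open>q\<close> at distance at most \<open>\<pi>/2\<close>.
\<close>

section \<open>The variation of a vector measure\<close>

definition partitions :: "real set \<Rightarrow> real set \<Rightarrow> (nat \<Rightarrow> real set) set" where
  "partitions I E = {A. range A \<subseteq> borel_sets I \<and> disjoint_family A \<and> (\<Union>i. A i) = E}"

text \<open>
  The set function from which \<open>total_variation\<close> is built. It has to be studied before it is known
  to be countably additive, since \<open>measure_of\<close> yields the zero measure otherwise.
\<close>

definition variation :: "real set \<Rightarrow> (real set \<Rightarrow> 'a::euclidean_space) \<Rightarrow> real set \<Rightarrow> ennreal" where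
  "variation I \<mu> E = (SUP A\<in>partitions I E. \<Sum>i. ennreal (norm (\<mu> (A i))))"

lemma total_variation_eq: "total_variation I \<mu> = measure_of I (borel_sets I) (variation I \<mu>)"
  unfolding total_variation_def variation_def partitions_def ..

lemma borel_sets_sigma_algebra: "sigma_algebra I (borel_sets I)"
  by (metis inf_top.right_neutral sets.sigma_algebra_axioms space_borel space_restrict_space)

lemma space_total_variation [simp]: "space (total_variation I \<mu>) = I"
  unfolding total_variation_eq
  by (simp add: space_measure_of_conv)

lemma sets_total_variation [simp]: "sets (total_variation I \<mu>) = borel_sets I"
  unfolding total_variation_eq
  by (rule sigma_algebra.sets_measure_of_eq[OF borel_sets_sigma_algebra])

lemma vector_measure_empty:
  assumes "vector_measure I \<mu>"
  shows "\<mu> {} = 0"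
proof -
  have "(\<lambda>i::nat. \<mu> ((\<lambda>_. {}) i)) sums \<mu> (\<Union>i::nat. {})"
    using assms[unfolded vector_measure_def, rule_format, of "\<lambda>_. {}"]
    by (simp add: disjoint_family_on_def)
  then have "summable (\<lambda>i::nat. \<mu> {})" by (simp add: sums_iff)
  then show ?thesis by (simp add: summable_const_iff)
qed

lemma disjoint_family_binaryset: "A \<inter> B = {} \<Longrightarrow> disjoint_family (binaryset A B)"
  by (auto simp: disjoint_family_on_def binaryset_def)

lemma vector_measure_Un:
  assumes vm: "vector_measure I \<mu>" and "A \<in> borel_sets I" "B \<in> borel_sets I" "A \<inter> B = {}"
  shows "\<mu> (A \<union> B) = \<mu> A + \<mu> B"
proof -
  have "(\<lambda>i. \<mu> (binaryset A B i)) sums \<mu> (\<Union>i. binaryset A B i)"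
  proof -
    have "range (binaryset A B) \<subseteq> borel_sets I"
      using assms by (simp add: range_binaryset_eq)
    then show ?thesis using vm disjoint_family_binaryset[OF assms(4)] unfolding vector_measure_def by blast
  qed
  moreover have "(\<lambda>i. \<mu> (binaryset A B i)) sums (\<mu> A + \<mu> B)"
    by (rule binaryset_sums) (rule vector_measure_empty[OF vm])
  ultimately show ?thesis by (simp add: UN_binaryset_eq sums_unique2)
qed

lemma vector_measure_Diff:
  assumes "vector_measure I \<mu>" "A \<in> borel_sets I" "B \<in> borel_sets I" "B \<subseteq> A"
  shows "\<mu> (A - B) = \<mu> A - \<mu> B"
proof -
  have "\<mu> ((A - B) \<union> B) = \<mu> (A - B) + \<mu> B"
    using assms by (intro vector_measure_Un) auto
  moreover have "(A - B) \<union> B = A" using assms(4) by blast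
  ultimately show ?thesis by simp
qed

lemma vector_measure_UN_lessThan:
  fixes n :: nat
  assumes vm: "vector_measure I \<mu>" and "finite S" "\<And>i. A i \<in> borel_sets I" "disjoint_family A"
  shows "\<mu> (\<Union>i\<in>S. A i) = (\<Sum>i\<in>S. \<mu> (A i))"
  using assms(2)
proof (induction S)
  case empty then show ?case using vector_measure_empty[OF vm] by simp
next
  case (insert x S)
  have "A x \<inter> (\<Union>i\<in>S. A i) = {}"
  proof -
    have "A x \<inter> A i = {}" if "i \<in> S" for i
      using disjoint_family_onD[OF assms(4), of x i] that insert.hyps by auto
    then show ?thesis by blast
  qed
  moreover have "(\<Union>i\<in>S. A i) \<in> borel_sets I" using insert assms(3) by (intro sets.finite_UN) auto
  ultimately show ?case
    using insert vector_measure_Un[OF vm assms(3)[of x], of "\<Union>i\<in>S. A i"] by simp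
qed

lemma binaryset_in_partitions: "E \<in> borel_sets I \<Longrightarrow> binaryset E {} \<in> partitions I E"
  using disjoint_family_binaryset[of E "{}"]
  by (simp add: partitions_def UN_binaryset_eq range_binaryset_eq)

lemma norm_le_variation:
  assumes "vector_measure I \<mu>" "E \<in> borel_sets I"
  shows "ennreal (norm (\<mu> E)) \<le> variation I \<mu> E"
proof -
  have "binaryset E {} \<in> partitions I E"
    using assms(2) by (rule binaryset_in_partitions)
  moreover have "(\<Sum>i. ennreal (norm (\<mu> (binaryset E {} i)))) = ennreal (norm (\<mu> E))"
    by (subst suminf_binaryset_eq) (simp_all add: vector_measure_empty[OF assms(1)])
  ultimately show ?thesis unfolding variation_def by (metis SUP_upper)
qed

lemma partitions_nonempty: "E \<in> borel_sets I \<Longrightarrow> partitions I E \<noteq> {}"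
  using binaryset_in_partitions by blast

text \<open>
  A partition of \<open>E\<close> and a partition of \<open>F\<close> merge into one of \<open>E \<union> F\<close>, enumerated along pairs.
\<close>

lemma variation_superadditive:
  assumes vm: "vector_measure I \<mu>" and E: "E \<in> borel_sets I" and F: "F \<in> borel_sets I"
    and disj: "E \<inter> F = {}"
  shows "variation I \<mu> E + variation I \<mu> F \<le> variation I \<mu> (E \<union> F)"
proof -
  let ?s = "\<lambda>A::nat \<Rightarrow> real set. \<Sum>i. ennreal (norm (\<mu> (A i)))"
  have both: "?s A + ?s B \<le> variation I \<mu> (E \<union> F)" if A: "A \<in> partitions I E" and B: "B \<in> partitions I F" for A B
  proof -
    define C where "C = (\<lambda>(i,j). if i = (0::nat) then A j else if i = 1 then B j else {})"
    have C: "(\<lambda>n. C (prod_decode n)) \<in> partitions I (E \<union> F)"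
      unfolding partitions_def
    proof (intro CollectI conjI)
      show "range (\<lambda>n. C (prod_decode n)) \<subseteq> borel_sets I"
        using A B by (auto simp: partitions_def C_def split: prod.splits)
      have AB: "A i \<inter> A j = {}" "B i \<inter> B j = {}" if "i \<noteq> j" for i j
        using that A B unfolding partitions_def disjoint_family_on_def by simp_all
      have AB': "A i \<inter> B j = {}" "B j \<inter> A i = {}" for i j
      proof -
        have "A i \<subseteq> E" "B j \<subseteq> F" using A B by (auto simp: partitions_def)
        with disj show "A i \<inter> B j = {}" "B j \<inter> A i = {}" by blast+
      qed
      have "C p \<inter> C q = {}" if "p \<noteq> q" for p q
        using that AB AB' by (cases p; cases q) (simp add: C_def)
      then show "disjoint_family (\<lambda>n. C (prod_decode n))"
        by (simp add: disjoint_family_on_def prod_decode_eq)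
      have "(\<Union>n. C (prod_decode n)) = (\<Union>p. C p)"
        using surj_prod_decode by (metis image_image)
      also have "\<dots> = (\<Union>i. A i) \<union> (\<Union>i. B i)"
      proof (intro equalityI subsetI)
        fix x assume "x \<in> (\<Union>i. A i) \<union> (\<Union>i. B i)"
        then obtain j where "x \<in> C (0,j) \<or> x \<in> C (1,j)" by (auto simp: C_def)
        then show "x \<in> (\<Union>p. C p)" by blast
      qed (auto simp: C_def split: prod.splits if_splits)
      finally show "(\<Union>n. C (prod_decode n)) = E \<union> F" using A B by (simp add: partitions_def)
    qed
    define g where "g = (\<lambda>i::nat. if i = 0 then ?s A else if i = 1 then ?s B else 0)"
    have g: "g i = (\<Sum>n. ennreal (norm (\<mu> (C (i, n)))))" for i
    proof -
      consider "i = 0" | "i = 1" | "i > 1" by linarith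
      then show ?thesis
      proof cases
        case 1 then show ?thesis by (simp only: g_def C_def prod.case if_True refl)
      next
        case 2 then show ?thesis by (simp only: g_def C_def prod.case if_True if_False one_neq_zero refl)
      next
        case 3
        then have "C (i, n) = {}" "g i = 0" for n by (simp_all add: C_def g_def)
        then show ?thesis using vector_measure_empty[OF vm] by simp
      qed
    qed
    have "(\<Sum>n. ennreal (norm (\<mu> (C (prod_decode n))))) = suminf g"
      using g by (rule suminf_ennreal_2dimen)
    also have "\<dots> = (\<Sum>i\<in>{0,1}. g i)" by (rule suminf_finite) (auto simp: g_def)
    also have "\<dots> = ?s A + ?s B" by (simp add: g_def)
    finally have "?s A + ?s B = (\<Sum>n. ennreal (norm (\<mu> (C (prod_decode n)))))" by simp
    also have "\<dots> \<le> variation I \<mu> (E \<union> F)" unfolding variation_def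
      using C by (intro SUP_upper2[OF C]) simp
    finally show ?thesis .
  qed
  have "?s A + variation I \<mu> F \<le> variation I \<mu> (E \<union> F)" if "A \<in> partitions I E" for A
    unfolding variation_def[of I \<mu> F] ennreal_SUP_add_right[OF partitions_nonempty[OF F]]
    by (intro SUP_least both that)
  then show ?thesis
    unfolding variation_def[of I \<mu> E] ennreal_SUP_add_left[OF partitions_nonempty[OF E], symmetric]
    by (intro SUP_least)
qed

lemma variation_mono:
  assumes "vector_measure I \<mu>" "E \<in> borel_sets I" "F \<in> borel_sets I" "E \<subseteq> F"
  shows "variation I \<mu> E \<le> variation I \<mu> F"
proof -
  have "variation I \<mu> E \<le> variation I \<mu> E + variation I \<mu> (F - E)" by simp
  also have "\<dots> \<le> variation I \<mu> (E \<union> (F - E))"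
    using assms by (intro variation_superadditive) auto
  finally show ?thesis using assms(4) by (simp add: Un_absorb1)
qed

lemma vector_measure_norm_UN_le:
  assumes vm: "vector_measure I \<mu>" and "range A \<subseteq> borel_sets I" "disjoint_family A"
  shows "ennreal (norm (\<mu> (\<Union>i. A i))) \<le> (\<Sum>i::nat. ennreal (norm (\<mu> (A i))))"
proof (cases "(\<Sum>i::nat. ennreal (norm (\<mu> (A i)))) = top")
  case False
  then have s: "summable (\<lambda>i. norm (\<mu> (A i)))" by (intro summable_suminf_not_top) auto
  have "(\<lambda>i. \<mu> (A i)) sums \<mu> (\<Union>i. A i)" using assms unfolding vector_measure_def by blast
  then have "norm (\<mu> (\<Union>i. A i)) \<le> (\<Sum>i. norm (\<mu> (A i)))"
    using summable_norm[OF s] by (simp add: sums_iff)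
  then show ?thesis
    using s by (simp add: suminf_ennreal2 ennreal_leI)
qed simp

text \<open>
  One inequality is finite superadditivity. For the other, a partition of the union is refined by
  the sets \<open>E i\<close> and the double sum is taken in the other order.
\<close>

lemma variation_countably_additive:
  assumes vm: "vector_measure I \<mu>"
  shows "countably_additive (borel_sets I) (variation I \<mu>)"
proof (rule countably_additiveI)
  fix E :: "nat \<Rightarrow> real set"
  assume E: "range E \<subseteq> borel_sets I" "disjoint_family E" "(\<Union>i. E i) \<in> borel_sets I"
  have E': "E i \<in> borel_sets I" for i using E by auto
  have fin: "(\<Sum>i<n. variation I \<mu> (E i)) \<le> variation I \<mu> (\<Union>i<n. E i)" for n
  proof (induction n)
    case (Suc n)
    have "(\<Sum>i<Suc n. variation I \<mu> (E i)) \<le> variation I \<mu> (\<Union>i<n. E i) + variation I \<mu> (E n)"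
      using Suc by (simp add: add_right_mono)
    also have "\<dots> \<le> variation I \<mu> ((\<Union>i<n. E i) \<union> E n)"
    proof (intro variation_superadditive[OF vm] sets.finite_UN E')
      have "E i \<inter> E n = {}" if "i < n" for i using disjoint_family_onD[OF E(2), of i n] that by simp
      then show "(\<Union>i<n. E i) \<inter> E n = {}" by blast
    qed simp
    also have "(\<Union>i<n. E i) \<union> E n = (\<Union>i<Suc n. E i)" by (simp add: lessThan_Suc Un_commute)
    finally show ?case .
  qed simp
  have le: "(\<Sum>i. variation I \<mu> (E i)) \<le> variation I \<mu> (\<Union>i. E i)"
  proof (rule suminf_le_const[OF summableI])
    fix n
    have "variation I \<mu> (\<Union>i<n. E i) \<le> variation I \<mu> (\<Union>i. E i)"
      by (rule variation_mono[OF vm sets.finite_UN E(3)]) (auto intro: E')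
    with fin show "(\<Sum>i<n. variation I \<mu> (E i)) \<le> variation I \<mu> (\<Union>i. E i)" by (rule order_trans)
  qed
  have ge: "variation I \<mu> (\<Union>i. E i) \<le> (\<Sum>i. variation I \<mu> (E i))"
    unfolding variation_def[of I \<mu> "\<Union>i. E i"]
  proof (rule SUP_least)
    fix A assume A: "A \<in> partitions I (\<Union>i. E i)"
    have A': "A j \<in> borel_sets I" for j using A by (auto simp: partitions_def)
    have Adis: "disjoint_family A" using A by (simp add: partitions_def)
    have UA: "(\<Union>j. A j) = (\<Union>i. E i)" using A by (simp add: partitions_def)
    have "(\<Sum>j. ennreal (norm (\<mu> (A j)))) \<le> (\<Sum>j. \<Sum>i. ennreal (norm (\<mu> (A j \<inter> E i))))"
    proof (rule suminf_le[OF _ summableI summableI])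
      fix j
      have eq: "(\<Union>i. A j \<inter> E i) = A j" using UA by blast
      have dis: "disjoint_family (\<lambda>i. A j \<inter> E i)"
        unfolding disjoint_family_on_def using disjoint_family_onD[OF E(2)] by blast
      have "range (\<lambda>i. A j \<inter> E i) \<subseteq> borel_sets I"
        by (rule image_subsetI, rule sets.Int[OF A' E'])
      from vector_measure_norm_UN_le[OF vm this dis] show "ennreal (norm (\<mu> (A j))) \<le> (\<Sum>i. ennreal (norm (\<mu> (A j \<inter> E i))))"
        unfolding eq .
    qed
    also have "\<dots> = (\<Sum>i. \<Sum>j. ennreal (norm (\<mu> (A j \<inter> E i))))"
    proof -
      have "(\<Sum>j. \<integral>\<^sup>+i. ennreal (norm (\<mu> (A j \<inter> E i))) \<partial>count_space UNIV)
           = (\<integral>\<^sup>+i. (\<Sum>j. ennreal (norm (\<mu> (A j \<inter> E i)))) \<partial>count_space UNIV)"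
        by (rule nn_integral_suminf[symmetric]) auto
      then show ?thesis by (simp add: nn_integral_count_space_nat)
    qed
    also have "\<dots> \<le> (\<Sum>i. variation I \<mu> (E i))"
    proof (rule suminf_le[OF _ summableI summableI])
      fix i
      have "(\<lambda>j. A j \<inter> E i) \<in> partitions I (E i)"
        unfolding partitions_def
      proof (intro CollectI conjI)
        show "disjoint_family (\<lambda>j. A j \<inter> E i)"
          unfolding disjoint_family_on_def using disjoint_family_onD[OF Adis] by blast
        show "(\<Union>j. A j \<inter> E i) = E i" using UA by blast
      qed (use A' E' in auto)
      then show "(\<Sum>j. ennreal (norm (\<mu> (A j \<inter> E i)))) \<le> variation I \<mu> (E i)"
        unfolding variation_def by (rule SUP_upper2) simp
    qed
    finally show "(\<Sum>j. ennreal (norm (\<mu> (A j)))) \<le> (\<Sum>i. variation I \<mu> (E i))" .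
  qed
  show "(\<Sum>i. variation I \<mu> (E i)) = variation I \<mu> (\<Union>i. E i)" using le ge by (rule antisym)
qed

lemma variation_empty: "vector_measure I \<mu> \<Longrightarrow> variation I \<mu> {} = 0"
proof -
  assume vm: "vector_measure I \<mu>"
  have "variation I \<mu> {} \<le> 0" unfolding variation_def
  proof (rule SUP_least)
    fix A assume "A \<in> partitions I {}"
    then have "A = (\<lambda>_. {})" by (auto simp: partitions_def)
    then show "(\<Sum>i. ennreal (norm (\<mu> (A i)))) \<le> 0" by (simp add: vector_measure_empty[OF vm])
  qed
  then show ?thesis by simp
qed

lemma emeasure_total_variation:
  assumes "vector_measure I \<mu>" "E \<in> borel_sets I"
  shows "emeasure (total_variation I \<mu>) E = variation I \<mu> E"
  unfolding total_variation_eq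
  using assms variation_empty[OF assms(1)] variation_countably_additive[OF assms(1)]
  by (intro emeasure_measure_of_sigma borel_sets_sigma_algebra) (auto simp: positive_def)

text \<open>
  Among finitely many vectors with large total norm some have a sum of comparable norm. Thus a
  subset of \<open>E\<close> has a value so large that its complement in \<open>E\<close> has a large value, too; one of the
  two has infinite variation.
\<close>

lemma variation_infinite_split:
  fixes \<mu> :: "real set \<Rightarrow> 'a::euclidean_space"
  assumes vm: "vector_measure I \<mu>" and E: "E \<in> borel_sets I" and inf: "variation I \<mu> E = top"
  obtains B where "B \<in> borel_sets I" "B \<subseteq> E" "variation I \<mu> B = top" "norm (\<mu> (E - B)) > 1"
proof -
  \<comment> \<open>The factor \<open>2 * DIM\<close> is lost when passing from total norm to the norm of a subset sum.\<close>
  define t where "t = 2 * real DIM('a) * (1 + norm (\<mu> E))"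
  have "ennreal t < variation I \<mu> E" using inf by simp
  then obtain A where A: "A \<in> partitions I E" and "ennreal t < (\<Sum>i. ennreal (norm (\<mu> (A i))))"
    unfolding variation_def less_SUP_iff by blast
  then obtain n where n: "ennreal t < (\<Sum>i<n. ennreal (norm (\<mu> (A i))))"
    unfolding suminf_eq_SUP less_SUP_iff by blast
  have A': "A j \<in> borel_sets I" for j using A by (auto simp: partitions_def)
  have Adis: "disjoint_family A" using A by (simp add: partitions_def)
  have t: "t < (\<Sum>i<n. norm (\<mu> (A i)))"
  proof -
    have "t \<ge> 0" by (simp add: t_def)
    then show ?thesis using n by (simp add: ennreal_less_iff)
  qed
  obtain S where S: "S \<subseteq> {..<n}" "norm (\<Sum>i\<in>S. \<mu> (A i)) > 1 + norm (\<mu> E)"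
    using sum_norm_allsubsets_bound[of "{..<n}" "\<lambda>i. \<mu> (A i)" "1 + norm (\<mu> E)"] t
    unfolding t_def by (meson finite_lessThan linorder_not_le)
  define F where "F = (\<Union>i\<in>S. A i)"
  have finS: "finite S" using S(1) finite_subset by blast
  have F: "F \<in> borel_sets I" unfolding F_def using A' finS by blast
  have FE: "F \<subseteq> E" using A by (auto simp: F_def partitions_def)
  have nF: "norm (\<mu> F) > 1 + norm (\<mu> E)"
    using S(2) vector_measure_UN_lessThan[OF vm finS, of A] A' Adis by (simp add: F_def)
  have EF: "\<mu> (E - F) = \<mu> E - \<mu> F" using vector_measure_Diff[OF vm E F FE] .
  have nEF: "norm (\<mu> (E - F)) > 1" unfolding EF using nF norm_triangle_ineq3[of "\<mu> E" "\<mu> F"] by linarith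
  have "variation I \<mu> (F \<union> (E - F)) = variation I \<mu> F + variation I \<mu> (E - F)"
  proof -
    have "emeasure (total_variation I \<mu>) (F \<union> (E - F))
        = emeasure (total_variation I \<mu>) F + emeasure (total_variation I \<mu>) (E - F)"
      using E F by (intro plus_emeasure[symmetric]) auto
    then show ?thesis using E F by (simp add: emeasure_total_variation[OF vm] del: Un_Diff_cancel)
  qed
  moreover have "F \<union> (E - F) = E" using FE by auto
  ultimately have "variation I \<mu> F = top \<or> variation I \<mu> (E - F) = top"
    using inf by (metis ennreal_add_eq_top infinity_ennreal_def)
  then show thesis
  proof
    assume "variation I \<mu> F = top"
    then show thesis using that[OF F FE _ nEF] by blast
  next
    assume "variation I \<mu> (E - F) = top"
    moreover have "E - (E - F) = F" using FE by auto
    moreover have "norm (\<mu> F) > 1" using nF norm_ge_zero[of "\<mu> E"] by linarith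
    ultimately show thesis using that[of "E - F"] E F by force
  qed
qed

text \<open>
  Otherwise iterated splitting produces disjoint sets \<open>A n\<close> with \<open>norm (\<mu> (A n)) > 1\<close>, while the
  values of \<open>\<mu>\<close> on disjoint sets form a convergent series.
\<close>

lemma finite_total_variation:
  fixes \<mu> :: "real set \<Rightarrow> 'a::euclidean_space"
  assumes vm: "vector_measure I \<mu>"
  shows "finite_measure (total_variation I \<mu>)"
proof (rule finite_measureI)
  have I: "I \<in> borel_sets I" using sets.top[of "restrict_space borel I"] by (simp add: space_restrict_space)
  show "emeasure (total_variation I \<mu>) (space (total_variation I \<mu>)) \<noteq> \<infinity>"
  proof
    assume "emeasure (total_variation I \<mu>) (space (total_variation I \<mu>)) = \<infinity>"
    then have top: "variation I \<mu> I = top" by (simp add: emeasure_total_variation[OF vm I])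
    define P where "P = (\<lambda>B. B \<in> borel_sets I \<and> variation I \<mu> B = top)"
    define Q where "Q = (\<lambda>E B. B \<subseteq> E \<and> norm (\<mu> (E - B)) > 1)"
    obtain B where B: "\<And>n. P (B n)" "\<And>n. Q (B n) (B (Suc n))"
    proof -
      have "\<exists>f. \<forall>n. P (f n) \<and> Q (f n) (f (Suc n))"
      proof (rule dependent_nat_choice)
        show "\<exists>B. P B" using I top by (auto simp: P_def)
        fix E n assume "P E"
        then show "\<exists>B. P B \<and> Q E B" unfolding P_def Q_def
          by (metis variation_infinite_split[OF vm])
      qed
      then show thesis using that by blast
    qed
    define A where "A n = B n - B (Suc n)" for n
    have dec: "B n \<subseteq> B m" if "m \<le> n" for m n
      using that by (induction rule: dec_induct) (use B(2) in \<open>auto simp: Q_def\<close>)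
    have "disjoint_family A"
    proof -
      have "A m \<inter> A n = {}" if "m < n" for m n
        using dec[of "Suc m" n] that by (auto simp: A_def)
      then show ?thesis unfolding disjoint_family_on_def by (metis inf_commute linorder_neqE_nat)
    qed
    moreover have "range A \<subseteq> borel_sets I" using B(1) by (auto simp: A_def P_def)
    ultimately have "(\<lambda>n. \<mu> (A n)) sums \<mu> (\<Union>n. A n)" using vm unfolding vector_measure_def by blast
    then have "(\<lambda>n. norm (\<mu> (A n))) \<longlonglongrightarrow> 0"
      using summable_LIMSEQ_zero sums_summable tendsto_norm_zero by blast
    then have "eventually (\<lambda>n. norm (\<mu> (A n)) < 1) sequentially"
      by (rule order_tendstoD) simp
    then obtain n where "norm (\<mu> (A n)) < 1" by (auto simp: eventually_sequentially)
    then show False using B(2)[of n] by (simp add: Q_def A_def)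
  qed
qed

lemma norm_le_total_variation:
  assumes "vector_measure I \<mu>" "E \<in> borel_sets I"
  shows "norm (\<mu> E) \<le> measure (total_variation I \<mu>) E"
proof -
  interpret finite_measure "total_variation I \<mu>" by (rule finite_total_variation[OF assms(1)])
  have "ennreal (norm (\<mu> E)) \<le> emeasure (total_variation I \<mu>) E"
    using norm_le_variation[OF assms] emeasure_total_variation[OF assms] by simp
  then show ?thesis by (simp add: emeasure_eq_measure)
qed

lemma (in finite_measure) ex_real_density:
  assumes "finite_measure N" "absolutely_continuous M N" "sets N = sets M"
  obtains D where "D \<in> borel_measurable M" "\<And>x. 0 \<le> (D x :: real)" "N = density M (\<lambda>x. ennreal (D x))"
proof -
  obtain D where D: "D \<in> borel_measurable M" "AE x in M. RN_deriv M N x = ennreal (D x)" "\<And>x. 0 \<le> D x"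
    using real_RN_deriv[OF assms] by metis
  have "density M (RN_deriv M N) = density M (\<lambda>x. ennreal (D x))"
    using D by (intro density_cong) auto
  then show thesis using that D density_RN_deriv[OF assms(2,3)] by simp
qed

text \<open>
  Adding the dominating measure makes \<open>\<nu>\<close> nonnegative, and the Radon-Nikodym theorem applies.
\<close>

lemma real_density_of_dominated:
  fixes M :: "real measure" and \<nu> :: "real set \<Rightarrow> real"
  assumes fin: "finite_measure M" and sets: "sets M = borel_sets I" and vm: "vector_measure I \<nu>"
    and dom: "\<And>A. A \<in> sets M \<Longrightarrow> \<bar>\<nu> A\<bar> \<le> measure M A"
  shows "\<exists>g. integrable M g \<and> (\<forall>A\<in>sets M. \<nu> A = set_lebesgue_integral M A g)"
proof -
  interpret M: finite_measure M by fact
  \<comment> \<open>By domination the values lie between \<open>0\<close> and \<open>2 M A\<close>.\<close>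
  define \<rho> where "\<rho> A = ennreal (\<nu> A + measure M A)" for A
  define N where "N = measure_of (space M) (sets M) \<rho>"
  have nn: "0 \<le> \<nu> A + measure M A" if "A \<in> sets M" for A using dom[OF that] by linarith
  have "countably_additive (sets M) \<rho>"
  proof (rule countably_additiveI)
    fix A :: "nat \<Rightarrow> real set" assume A: "range A \<subseteq> sets M" "disjoint_family A" "(\<Union>i. A i) \<in> sets M"
    have "(\<lambda>i. \<nu> (A i)) sums \<nu> (\<Union>i. A i)" using vm A sets unfolding vector_measure_def by auto
    moreover have "(\<lambda>i. measure M (A i)) sums measure M (\<Union>i. A i)"
      using M.finite_measure_UNION[OF A(1,2)] .
    ultimately have s: "(\<lambda>i. \<nu> (A i) + measure M (A i)) sums (\<nu> (\<Union>i. A i) + measure M (\<Union>i. A i))"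
      by (rule sums_add)
    have "0 \<le> \<nu> (A i) + measure M (A i)" for i using A nn by auto
    then show "(\<Sum>i. \<rho> (A i)) = \<rho> (\<Union>i. A i)"
      using s unfolding \<rho>_def by (simp add: suminf_ennreal2 sums_iff)
  qed
  moreover have "positive (sets M) \<rho>" using vector_measure_empty[OF vm] by (simp add: positive_def \<rho>_def)
  ultimately have emN: "emeasure N A = \<rho> A" if "A \<in> sets M" for A
    unfolding N_def using that by (intro emeasure_measure_of_sigma sets.sigma_algebra_axioms)
  have setsN: "sets N = sets M" and spaceN: "space N = space M" by (simp_all add: N_def)
  have finN: "finite_measure N"
    by (rule finite_measureI) (simp add: spaceN emN \<rho>_def)
  have ac: "absolutely_continuous M N"
  proof (unfold absolutely_continuous_def, rule subsetI)
    fix A assume "A \<in> null_sets M"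
    then have A: "A \<in> sets M" "measure M A = 0" by (auto simp: null_sets_def measure_def)
    then have "\<nu> A = 0" using dom by force
    then show "A \<in> null_sets N" using A by (simp add: null_sets_def setsN emN \<rho>_def)
  qed
  obtain D where D: "D \<in> borel_measurable M" "\<And>x. 0 \<le> D x" and N: "N = density M (\<lambda>x. ennreal (D x))"
    using M.ex_real_density[OF finN ac setsN] by blast
  have intD: "integrable M D"
  proof (rule integrableI_nonneg)
    have "(\<integral>\<^sup>+x. ennreal (D x) \<partial>M) = emeasure N (space M)"
      unfolding N using D(1) by (subst emeasure_density) (auto intro!: nn_integral_cong)
    also have "\<dots> < \<infinity>" by (simp add: emN \<rho>_def)
    finally show "(\<integral>\<^sup>+x. ennreal (D x) \<partial>M) < \<infinity>" .
  qed (use D in auto)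
  have eq: "\<nu> A + measure M A = set_lebesgue_integral M A D" if A: "A \<in> sets M" for A
  proof -
    have "ennreal (\<nu> A + measure M A) = emeasure N A" by (simp add: emN[OF A] \<rho>_def)
    also have "\<dots> = (\<integral>\<^sup>+x. ennreal (indicator A x *\<^sub>R D x) \<partial>M)"
      unfolding N using D A by (subst emeasure_density) (auto intro!: nn_integral_cong split: split_indicator)
    also have "\<dots> = ennreal (set_lebesgue_integral M A D)" unfolding set_lebesgue_integral_def
      using D A by (intro nn_integral_eq_integral integrable_mult_indicator intD) auto
    finally show ?thesis
      using nn[OF A] D(2) by (simp add: set_lebesgue_integral_def)
  qed
  show ?thesis
  proof (intro exI conjI ballI)
    show "integrable M (\<lambda>x. D x - 1)" using intD by simp
    fix A assume A: "A \<in> sets M"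
    have "set_lebesgue_integral M A (\<lambda>x. D x - 1) = set_lebesgue_integral M A D - set_lebesgue_integral M A (\<lambda>x. 1)"
      using integrable_mult_indicator[OF A intD] integrable_mult_indicator[OF A, of "\<lambda>_. 1::real"]
      by (intro set_integral_diff(2)) (simp_all add: set_integrable_def)
    also have "set_lebesgue_integral M A (\<lambda>x. 1::real) = measure M A"
      using A by (simp add: set_lebesgue_integral_def)
    finally show "\<nu> A = set_lebesgue_integral M A (\<lambda>x. D x - 1)" using eq[OF A] by simp
  qed
qed

lemma vector_measure_bounded_linear:
  assumes "vector_measure I \<mu>" "bounded_linear h"
  shows "vector_measure I (\<lambda>A. h (\<mu> A))"
  using assms bounded_linear.sums[OF assms(2)] unfolding vector_measure_def by blast

lemma ex_has_vRN_deriv: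
  fixes \<mu> :: "real set \<Rightarrow> 'a::euclidean_space"
  assumes vm: "vector_measure I \<mu>"
  shows "\<exists>f. has_vRN_deriv (total_variation I \<mu>) \<mu> f"
proof -
  let ?M = "total_variation I \<mu>"
  have "\<exists>g. integrable ?M g \<and> (\<forall>A\<in>sets ?M. \<mu> A \<bullet> e = set_lebesgue_integral ?M A g)" if e: "e \<in> Basis" for e
  proof (rule real_density_of_dominated[OF finite_total_variation[OF vm] sets_total_variation])
    show "vector_measure I (\<lambda>A. \<mu> A \<bullet> e)"
      by (rule vector_measure_bounded_linear[OF vm bounded_linear_inner_left])
    show "\<bar>\<mu> A \<bullet> e\<bar> \<le> measure ?M A" if "A \<in> sets ?M" for A
      using norm_le_total_variation[OF vm] that Basis_le_norm[OF e, of "\<mu> A"] by fastforce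
  qed
  then obtain g where g: "\<And>e. e \<in> Basis \<Longrightarrow> integrable ?M (g e)"
    "\<And>e A. e \<in> Basis \<Longrightarrow> A \<in> sets ?M \<Longrightarrow> \<mu> A \<bullet> e = set_lebesgue_integral ?M A (g e)"
    by metis
  have "has_vRN_deriv ?M \<mu> (\<lambda>x. \<Sum>e\<in>Basis. g e x *\<^sub>R e)"
    unfolding has_vRN_deriv_def
  proof (intro conjI ballI)
    show "integrable ?M (\<lambda>x. \<Sum>e\<in>Basis. g e x *\<^sub>R e)"
      using g(1) by (intro Bochner_Integration.integrable_sum integrable_scaleR_left) auto
    fix A assume A: "A \<in> sets ?M"
    have int: "integrable ?M (\<lambda>x. indicator A x * g e x)" if "e \<in> Basis" for e
      using integrable_mult_indicator[OF A g(1)[OF that]] by simp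
    have "set_lebesgue_integral ?M A (\<lambda>x. \<Sum>e\<in>Basis. g e x *\<^sub>R e)
        = (LINT x|?M. (\<Sum>e\<in>Basis. (indicator A x * g e x) *\<^sub>R e))"
      by (simp add: set_lebesgue_integral_def scaleR_sum_right)
    also have "\<dots> = (\<Sum>e\<in>Basis. (LINT x|?M. (indicator A x * g e x) *\<^sub>R e))"
      using int by (intro Bochner_Integration.integral_sum integrable_scaleR_left) auto
    also have "\<dots> = (\<Sum>e\<in>Basis. (\<mu> A \<bullet> e) *\<^sub>R e)"
      using int g(2)[OF _ A] by (intro sum.cong) (auto simp: set_lebesgue_integral_def)
    also have "\<dots> = \<mu> A" by (rule euclidean_representation)
    finally show "\<mu> A = set_lebesgue_integral ?M A (\<lambda>x. \<Sum>e\<in>Basis. g e x *\<^sub>R e)" ..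
  qed
  then show ?thesis by blast
qed

lemma has_vRN_deriv_polar:
  "vector_measure I \<mu> \<Longrightarrow> has_vRN_deriv (total_variation I \<mu>) \<mu> (polar I \<mu>)"
  unfolding polar_def vRN_deriv_def using ex_has_vRN_deriv by (rule someI_ex)

section \<open>Measures given by a density\<close>

lemma space_eq_of_sets: "sets M = borel_sets I \<Longrightarrow> space M = I"
  using sets_eq_imp_space_eq[of M "restrict_space borel I"] by (simp add: space_restrict_space)

lemma set_integral_sums:
  fixes g :: "'b \<Rightarrow> 'a::{banach, second_countable_topology}"
  assumes g: "integrable M g" and A: "\<And>i::nat. A i \<in> sets M" "disjoint_family A"
  shows "(\<lambda>i. set_lebesgue_integral M (A i) g) sums set_lebesgue_integral M (\<Union>i. A i) g"
proof -
  have int: "integrable M (\<lambda>x. indicator B x *\<^sub>R g x)" if "B \<in> sets M" for B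
    using integrable_mult_indicator[OF that g] .
  have ind: "(\<Sum>i<n. indicator (A i) x :: real) = indicator (\<Union>i<n. A i) x" for n x
  proof -
    have "disjoint_family_on A {..<n}" using A(2) by (rule disjoint_family_on_mono[rotated]) simp
    then show ?thesis by (simp add: indicator_UN_disjoint)
  qed
  have "(\<lambda>n. LINT x|M. indicator (\<Union>i<n. A i) x *\<^sub>R g x) \<longlonglongrightarrow> (LINT x|M. indicator (\<Union>i. A i) x *\<^sub>R g x)"
  proof (rule integral_dominated_convergence)
    show "AE x in M. (\<lambda>n. indicator (\<Union>i<n. A i) x *\<^sub>R g x) \<longlonglongrightarrow> indicator (\<Union>i. A i) x *\<^sub>R g x"
      using indicator_sums[of A] disjoint_family_onD[OF A(2)]
      by (intro AE_I2 tendsto_scaleR tendsto_const) (simp add: sums_def ind[symmetric])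
    show "AE x in M. norm (indicator (\<Union>i<n. A i) x *\<^sub>R g x) \<le> norm (g x)" for n
      by (auto split: split_indicator)
    show "integrable M (\<lambda>x. norm (g x))" using g by simp
  qed (use A(1) g in auto)
  moreover have "(LINT x|M. indicator (\<Union>i<n. A i) x *\<^sub>R g x) = (\<Sum>i<n. LINT x|M. indicator (A i) x *\<^sub>R g x)" for n
    by (subst Bochner_Integration.integral_sum[symmetric])
       (use int A(1) in \<open>auto simp: ind[symmetric] scaleR_sum_left\<close>)
  ultimately show ?thesis unfolding sums_def set_lebesgue_integral_def by simp
qed

lemma vector_measure_density:
  fixes g :: "real \<Rightarrow> 'a::euclidean_space"
  assumes sets: "sets M = borel_sets I" and g: "integrable M g"
    and \<mu>: "\<And>A. A \<in> borel_sets I \<Longrightarrow> \<mu> A = set_lebesgue_integral M A g"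
  shows "vector_measure I \<mu>"
  unfolding vector_measure_def
proof (intro allI impI)
  fix A :: "nat \<Rightarrow> real set" assume A: "range A \<subseteq> borel_sets I" "disjoint_family A"
  have A': "A i \<in> borel_sets I" for i using A(1) by auto
  have UA: "(\<Union>i. A i) \<in> borel_sets I" using A' by blast
  show "(\<lambda>i. \<mu> (A i)) sums \<mu> (\<Union>i. A i)"
    unfolding \<mu>[OF A'] \<mu>[OF UA] using A' sets by (intro set_integral_sums g A(2)) simp
qed

text \<open>
  The bound from above is the triangle inequality for integrals. For the other bound, let \<open>p\<close> be the
  polar density of \<open>\<mu>\<close> and \<open>D\<close> the density of the total variation. The averages of \<open>p\<close> lie in the unit
  ball, so \<open>|p| \<le> 1\<close> and \<open>|g| = D |p| \<le> D\<close>.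
\<close>

lemma total_variation_density:
  fixes g :: "real \<Rightarrow> 'a::euclidean_space"
  assumes fin: "finite_measure M" and sets: "sets M = borel_sets I" and g: "integrable M g"
    and \<mu>: "\<And>A. A \<in> borel_sets I \<Longrightarrow> \<mu> A = set_lebesgue_integral M A g"
  shows "total_variation I \<mu> = density M (\<lambda>x. ennreal (norm (g x)))" (is "?T = ?N")
proof -
  interpret M: finite_measure M by fact
  have vm: "vector_measure I \<mu>" using vector_measure_density[OF sets g \<mu>] by simp
  interpret T: finite_measure ?T by (rule finite_total_variation[OF vm])
  have [measurable]: "g \<in> borel_measurable M" using g by simp
  have emN: "ennreal (norm (\<mu> A)) \<le> emeasure ?N A" if A: "A \<in> sets M" for A
  proof -
    have "ennreal (norm (\<mu> A)) \<le> (\<integral>\<^sup>+x. ennreal (norm (indicator A x *\<^sub>R g x)) \<partial>M)"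
      using \<mu>[of A] A sets integral_norm_bound_ennreal[OF integrable_mult_indicator[OF A g]]
      by (simp add: set_lebesgue_integral_def)
    also have "\<dots> = emeasure ?N A"
      using A by (subst emeasure_density) (auto intro!: nn_integral_cong split: split_indicator)
    finally show ?thesis .
  qed
  have le: "emeasure ?T E \<le> emeasure ?N E" if E: "E \<in> sets M" for E
  proof -
    have "variation I \<mu> E \<le> emeasure ?N E" unfolding variation_def
    proof (rule SUP_least)
      fix A assume A: "A \<in> partitions I E"
      have A': "range A \<subseteq> sets M" "disjoint_family A" "(\<Union>i. A i) = E" using A sets by (auto simp: partitions_def)
      have "(\<Sum>i. ennreal (norm (\<mu> (A i)))) \<le> (\<Sum>i. emeasure ?N (A i))"
        using emN A'(1) by (intro suminf_le summableI) auto
      also have "\<dots> = emeasure ?N E"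
      proof -
        have "range A \<subseteq> sets ?N" using A'(1) by simp
        from suminf_emeasure[OF this A'(2)] show ?thesis unfolding A'(3) .
      qed
      finally show "(\<Sum>i. ennreal (norm (\<mu> (A i)))) \<le> emeasure ?N E" .
    qed
    then show ?thesis using emeasure_total_variation[OF vm, of E] E sets by simp
  qed
  have setsT: "sets ?T = sets M" using sets by simp
  have ac: "absolutely_continuous M ?T"
    unfolding absolutely_continuous_def
  proof
    fix A assume A: "A \<in> null_sets M"
    then have "emeasure ?N A = 0"
      using absolutely_continuousI_density[of "\<lambda>x. ennreal (norm (g x))" M]
      unfolding absolutely_continuous_def by auto
    then show "A \<in> null_sets ?T" using le[of A] A setsT by (auto simp: null_sets_def)
  qed
  obtain D where D: "D \<in> borel_measurable M" "\<And>x. 0 \<le> D x" and T: "?T = density M (\<lambda>x. ennreal (D x))"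
    using M.ex_real_density[OF T.finite_measure_axioms ac setsT] by blast
  define p where "p = polar I \<mu>"
  have p: "integrable ?T p" "\<And>A. A \<in> sets M \<Longrightarrow> \<mu> A = set_lebesgue_integral ?T A p"
    using has_vRN_deriv_polar[OF vm] sets unfolding has_vRN_deriv_def p_def by auto
  have pm [measurable]: "p \<in> borel_measurable M"
    using borel_measurable_integrable[OF p(1)] setsT measurable_cong_sets by blast
  have "AE x in ?T. p x \<in> cball 0 1"
  proof (rule T.averaging_theorem[OF p(1) closed_cball])
    fix A assume A: "A \<in> sets ?T" "measure ?T A > 0"
    have "norm (\<mu> A) \<le> measure ?T A" using norm_le_total_variation[OF vm] A by simp
    then show "(1 / measure ?T A) *\<^sub>R set_lebesgue_integral ?T A p \<in> cball 0 1"
      using A p(2)[of A] sets by (simp add: divide_simps)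
  qed
  then have p1: "AE x in M. 0 < D x \<longrightarrow> norm (p x) \<le> 1"
    unfolding T using D(1) by (subst (asm) AE_density) (auto simp: less_le)
  have intDp: "integrable M (\<lambda>x. D x *\<^sub>R p x)"
    using p(1) unfolding T using D by (subst (asm) integrable_density) auto
  have "AE x in M. D x *\<^sub>R p x = g x"
  proof (rule M.density_unique_banach[OF intDp g])
    fix A assume A: "A \<in> sets M"
    have "set_lebesgue_integral M A g = set_lebesgue_integral ?T A p" using \<mu>[of A] p(2)[of A] A sets by simp
    also have "\<dots> = set_lebesgue_integral M A (\<lambda>x. D x *\<^sub>R p x)"
      unfolding T set_lebesgue_integral_def using D A
      by (subst integral_density) (auto simp: mult.commute)
    finally show "set_lebesgue_integral M A (\<lambda>x. D x *\<^sub>R p x) = set_lebesgue_integral M A g" ..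
  qed
  with p1 have gD: "AE x in M. norm (g x) \<le> D x"
  proof eventually_elim
    case (elim x)
    have "norm (g x) = D x * norm (p x)" using elim(2) D(2)[of x] by (metis abs_of_nonneg norm_scaleR)
    also have "\<dots> \<le> D x" using elim(1) D(2)[of x] by (cases "D x = 0") (auto simp: mult_left_le)
    finally show ?case .
  qed
  show ?thesis
  proof (rule measure_eqI)
    show "sets ?T = sets ?N" using setsT by simp
    fix E assume "E \<in> sets ?T"
    then have E: "E \<in> sets M" using sets by simp
    have "emeasure ?N E \<le> emeasure ?T E"
      unfolding T using E D gD
      by (subst (1 2) emeasure_density) (auto intro!: nn_integral_mono_AE split: split_indicator)
    with le[OF E] show "emeasure ?T E = emeasure ?N E" by (rule antisym)
  qed
qed

text \<open>
  Off the zeros of \<open>g\<close> the polar density is \<open>g / |g|\<close>; the form without division is the useful one.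
\<close>

lemma polar_density:
  fixes g :: "real \<Rightarrow> 'a::euclidean_space"
  assumes fin: "finite_measure M" and sets: "sets M = borel_sets I" and g: "integrable M g"
    and \<mu>: "\<And>A. A \<in> borel_sets I \<Longrightarrow> \<mu> A = set_lebesgue_integral M A g"
  shows "polar I \<mu> \<in> borel_measurable M" "AE x in M. norm (g x) *\<^sub>R polar I \<mu> x = g x"
proof -
  interpret M: finite_measure M by fact
  define p where "p = polar I \<mu>"
  have vm: "vector_measure I \<mu>" using vector_measure_density[OF sets g \<mu>] by simp
  note T = total_variation_density[OF assms, simplified]
  have p: "integrable (total_variation I \<mu>) p"
    "\<And>A. A \<in> sets M \<Longrightarrow> \<mu> A = set_lebesgue_integral (total_variation I \<mu>) A p"
    using has_vRN_deriv_polar[OF vm] sets unfolding has_vRN_deriv_def p_def by auto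
  show pm: "polar I \<mu> \<in> borel_measurable M"
    using borel_measurable_integrable[OF p(1)] unfolding p_def
    by (simp add: measurable_cong_sets[of "total_variation I \<mu>" M] sets)
  have int: "integrable M (\<lambda>x. norm (g x) *\<^sub>R p x)"
    using p(1) g pm unfolding T p_def by (subst (asm) integrable_density) auto
  have "AE x in M. norm (g x) *\<^sub>R p x = g x"
  proof (rule M.density_unique_banach[OF int g])
    fix A assume A: "A \<in> sets M"
    have "set_lebesgue_integral M A g = set_lebesgue_integral (total_variation I \<mu>) A p"
      using \<mu>[of A] p(2)[of A] A sets by simp
    also have "\<dots> = set_lebesgue_integral M A (\<lambda>x. norm (g x) *\<^sub>R p x)"
      unfolding T set_lebesgue_integral_def p_def using pm g A
      by (subst integral_density) (auto simp: mult.commute)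
    finally show "set_lebesgue_integral M A (\<lambda>x. norm (g x) *\<^sub>R p x) = set_lebesgue_integral M A g" ..
  qed
  then show "AE x in M. norm (g x) *\<^sub>R polar I \<mu> x = g x" by (simp add: p_def)
qed

lemma integral_polar_density:
  fixes g :: "real \<Rightarrow> 'a::euclidean_space" and h :: "'a \<Rightarrow> 'b::euclidean_space"
  assumes fin: "finite_measure M" and sets: "sets M = borel_sets I" and g: "integrable M g"
    and \<mu>: "\<And>A. A \<in> borel_sets I \<Longrightarrow> \<mu> A = set_lebesgue_integral M A g"
    and \<phi>: "\<phi> \<in> borel_measurable M"
  shows "(LINT x|total_variation I \<mu>. \<phi> x *\<^sub>R polar I \<mu> x) = (LINT x|M. \<phi> x *\<^sub>R g x)"
proof -
  note P = polar_density[OF fin sets g \<mu>, simplified]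
  have [measurable]: "g \<in> borel_measurable M" using g by simp
  note P(1)[measurable] \<phi>[measurable]
  have "(LINT x|total_variation I \<mu>. \<phi> x *\<^sub>R polar I \<mu> x)
      = (LINT x|M. norm (g x) *\<^sub>R \<phi> x *\<^sub>R polar I \<mu> x)"
    unfolding total_variation_density[OF fin sets g \<mu>, simplified]
    by (subst integral_density) auto
  also have "\<dots> = (LINT x|M. \<phi> x *\<^sub>R g x)"
  proof (rule integral_cong_AE)
    show "AE x in M. norm (g x) *\<^sub>R \<phi> x *\<^sub>R polar I \<mu> x = \<phi> x *\<^sub>R g x"
      using P(2) by eventually_elim (metis scaleR_left_commute)
  qed measurable
  finally show ?thesis .
qed

section \<open>Borel versions of Lebesgue measurable functions\<close>

lemma finite_measure_lebesgue_on_Ioo: "finite_measure (lebesgue_on {a<..<b :: real})"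
proof (rule finite_measureI)
  have "emeasure lborel {a<..<b} \<noteq> \<infinity>" by (cases "a \<le> b") simp_all
  then show "emeasure (lebesgue_on {a<..<b}) (space (lebesgue_on {a<..<b})) \<noteq> \<infinity>"
    by (simp add: emeasure_restrict_space space_restrict_space)
qed

lemma le_one_plus_square: "x \<le> 1 + x\<^sup>2" for x :: real
proof -
  have "0 \<le> (x - 1)\<^sup>2" by simp
  then have "2 * x \<le> 1 + x\<^sup>2" by (simp add: power2_eq_square algebra_simps)
  moreover have "0 \<le> x\<^sup>2" by simp
  ultimately show ?thesis by linarith
qed

lemma AE_lebesgue_on_iff_lborel:
  assumes "I \<in> sets borel"
  shows "(AE x in lebesgue_on I. P x) \<longleftrightarrow> (AE x in lborel. x \<in> I \<longrightarrow> P x)"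
  using assms by (subst AE_restrict_space_iff) (auto simp: AE_completion_iff)

text \<open>
  Functions like \<open>u\<^sub>t\<close> and the densities chosen by \<open>ac_density\<close> are only Lebesgue measurable, whereas
  the vector measures live on Borel sets. A Borel version mediates between them.
\<close>

lemma lebesgue_on_borel_version:
  fixes f :: "real \<Rightarrow> 'a::euclidean_space"
  assumes I: "I \<in> sets borel" and f: "f \<in> borel_measurable (lebesgue_on I)"
  obtains f' where "f' \<in> borel_measurable borel" "AE x in lebesgue_on I. f x = f' x"
proof -
  have f0: "(\<lambda>x. indicator I x *\<^sub>R f x) \<in> borel_measurable lebesgue"
    using f I by (subst (asm) borel_measurable_restrict_space_iff) auto
  have "\<exists>g\<in>borel_measurable lborel. AE x in lborel. (indicator I x *\<^sub>R f x) \<bullet> e = g x" for e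
    by (rule completion_ex_borel_measurable_real) (use f0 in measurable)
  then obtain g where g: "\<And>e. g e \<in> borel_measurable lborel"
    "\<And>e. AE x in lborel. (indicator I x *\<^sub>R f x) \<bullet> e = g e x" by metis
  have "AE x in lborel. \<forall>e\<in>Basis. (indicator I x *\<^sub>R f x) \<bullet> e = g e x"
    using g(2) by (intro AE_finite_allI) auto
  then have "AE x in lborel. indicator I x *\<^sub>R f x = (\<Sum>e\<in>Basis. g e x *\<^sub>R e)"
  proof eventually_elim
    case (elim x) then show ?case
      using euclidean_representation[of "indicator I x *\<^sub>R f x", symmetric] by simp
  qed
  then have "AE x in lebesgue_on I. f x = (\<Sum>e\<in>Basis. g e x *\<^sub>R e)"
    unfolding AE_lebesgue_on_iff_lborel[OF I] by eventually_elim auto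
  moreover have "(\<lambda>x. \<Sum>e\<in>Basis. g e x *\<^sub>R e) \<in> borel_measurable borel" using g(1) by measurable
  ultimately show ?thesis using that by blast
qed

lemma borel_measurable_lebesgue_on:
  assumes "f \<in> borel_measurable borel"
  shows "f \<in> borel_measurable (lebesgue_on I)"
  using assms by (intro measurable_restrict_space1 measurable_completion) auto

lemma integral_lebesgue_on_borel:
  fixes f :: "real \<Rightarrow> 'a::euclidean_space"
  assumes "I \<in> sets borel" "f \<in> borel_measurable borel"
  shows "(LINT x|lebesgue_on I. f x) = (LINT x|lborel. indicator I x *\<^sub>R f x)"
proof -
  have "(LINT x|lebesgue_on I. f x) = (LINT x|lebesgue. indicator I x *\<^sub>R f x)"
    using assms by (intro integral_restrict_space) auto
  also have "\<dots> = (LINT x|lborel. indicator I x *\<^sub>R f x)"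
    using assms by (intro integral_completion) simp
  finally show ?thesis .
qed

lemma integrable_lebesgue_on_borel:
  fixes f :: "real \<Rightarrow> 'a::euclidean_space"
  assumes "I \<in> sets borel" "f \<in> borel_measurable borel"
  shows "integrable (lebesgue_on I) f \<longleftrightarrow> integrable lborel (\<lambda>x. indicator I x *\<^sub>R f x)"
proof -
  have "integrable (lebesgue_on I) f \<longleftrightarrow> integrable lebesgue (\<lambda>x. indicator I x *\<^sub>R f x)"
    using assms by (intro integrable_restrict_space) auto
  also have "\<dots> \<longleftrightarrow> integrable lborel (\<lambda>x. indicator I x *\<^sub>R f x)"
    using assms by (intro integrable_completion) simp
  finally show ?thesis .
qed

section \<open>A common reference measure\<close>

lemma vector_measure_lebesgue:
  assumes I: "I \<in> sets borel" "emeasure lborel I < \<infinity>"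
  shows "vector_measure I (\<lambda>A. measure lborel A)"
  unfolding vector_measure_def
proof (intro allI impI)
  fix A :: "nat \<Rightarrow> real set" assume A: "range A \<subseteq> borel_sets I" "disjoint_family A"
  have A': "range A \<subseteq> sets lborel" "\<And>i. A i \<subseteq> I"
    using A(1) I sets.sets_into_space[of _ "restrict_space borel I"]
    by (auto simp: sets_restrict_space_iff space_restrict_space image_subset_iff)
  show "(\<lambda>i. measure lborel (A i)) sums measure lborel (\<Union>i. A i)"
  proof (rule measure_UNION[OF A'(1) A(2)])
    have "emeasure lborel (\<Union>i. A i) \<le> emeasure lborel I" using A' I by (intro emeasure_mono) auto
    then show "emeasure lborel (\<Union>i. A i) \<noteq> \<infinity>" using I(2) by (metis linorder_not_le order.strict_trans1 top.extremum_strict infinity_ennreal_def)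
  qed
qed

lemma vector_measure_Pair:
  assumes "vector_measure I \<mu>" "vector_measure I \<nu>"
  shows "vector_measure I (\<lambda>A. (\<mu> A, \<nu> A))"
  unfolding vector_measure_def
proof (intro allI impI)
  fix A :: "nat \<Rightarrow> real set" assume A: "range A \<subseteq> borel_sets I" "disjoint_family A"
  have "(\<lambda>i. \<mu> (A i)) sums \<mu> (\<Union>i. A i)" "(\<lambda>i. \<nu> (A i)) sums \<nu> (\<Union>i. A i)"
    using A assms unfolding vector_measure_def by blast+
  then have "(\<lambda>n. ((\<Sum>i<n. \<mu> (A i)), (\<Sum>i<n. \<nu> (A i)))) \<longlonglongrightarrow> (\<mu> (\<Union>i. A i), \<nu> (\<Union>i. A i))"
    unfolding sums_def by (rule tendsto_Pair)
  moreover have "(\<Sum>i<n. (\<mu> (A i), \<nu> (A i))) = ((\<Sum>i<n. \<mu> (A i)), (\<Sum>i<n. \<nu> (A i)))" for n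
    by (simp add: prod_eq_iff fst_sum snd_sum)
  ultimately show "(\<lambda>i. (\<mu> (A i), \<nu> (A i))) sums (\<mu> (\<Union>i. A i), \<nu> (\<Union>i. A i))"
    unfolding sums_def by simp
qed

text \<open>
  The polar decomposition of the single vector measure \<open>A \<mapsto> (\<mu> A, \<nu> A, \<L>\<^sup>1 A)\<close> yields the three
  densities at once.
\<close>

lemma common_density:
  fixes \<mu> :: "real set \<Rightarrow> 'a::euclidean_space" and \<nu> :: "real set \<Rightarrow> 'b::euclidean_space"
  assumes \<mu>: "vector_measure I \<mu>" and \<nu>: "vector_measure I \<nu>"
    and I: "I \<in> sets borel" "emeasure lborel I < \<infinity>"
  obtains M \<alpha> \<beta> l where "finite_measure M" "sets M = borel_sets I"
    "integrable M \<alpha>" "\<And>A. A \<in> borel_sets I \<Longrightarrow> \<mu> A = set_lebesgue_integral M A \<alpha>"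
    "integrable M \<beta>" "\<And>A. A \<in> borel_sets I \<Longrightarrow> \<nu> A = set_lebesgue_integral M A \<beta>"
    "integrable M l" "\<And>x. 0 \<le> (l x :: real)"
    "\<And>A. A \<in> borel_sets I \<Longrightarrow> measure lborel A = set_lebesgue_integral M A l"
proof -
  define \<kappa> where "\<kappa> A = ((\<mu> A, \<nu> A), measure lborel A)" for A
  have vm: "vector_measure I \<kappa>" unfolding \<kappa>_def
    by (intro vector_measure_Pair \<mu> \<nu> vector_measure_lebesgue I)
  define M where "M = total_variation I \<kappa>"
  define p where "p = polar I \<kappa>"
  have fin: "finite_measure M" unfolding M_def by (rule finite_total_variation[OF vm])
  have sets: "sets M = borel_sets I" by (simp add: M_def)
  have p: "integrable M p" "\<And>A. A \<in> borel_sets I \<Longrightarrow> \<kappa> A = set_lebesgue_integral M A p"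
    using has_vRN_deriv_polar[OF vm] unfolding has_vRN_deriv_def p_def M_def by auto
  have comp: "integrable M (\<lambda>x. h (p x)) \<and> (\<forall>A\<in>borel_sets I. h (\<kappa> A) = set_lebesgue_integral M A (\<lambda>x. h (p x)))"
    if h: "bounded_linear h" for h :: "('a \<times> 'b) \<times> real \<Rightarrow> 'c::euclidean_space"
  proof (intro conjI ballI)
    show "integrable M (\<lambda>x. h (p x))" by (rule integrable_bounded_linear[OF h p(1)])
    fix A assume A: "A \<in> borel_sets I"
    have "h (\<kappa> A) = (LINT x|M. h (indicator A x *\<^sub>R p x))"
      unfolding p(2)[OF A] set_lebesgue_integral_def
      using A sets by (intro integral_bounded_linear[OF h, symmetric] integrable_mult_indicator p) simp
    then show "h (\<kappa> A) = set_lebesgue_integral M A (\<lambda>x. h (p x))"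
      unfolding set_lebesgue_integral_def by (simp add: linear_cmul[OF bounded_linear.linear[OF h]])
  qed
  have 1: "bounded_linear (\<lambda>q::('a \<times> 'b) \<times> real. fst (fst q))"
    and 2: "bounded_linear (\<lambda>q::('a \<times> 'b) \<times> real. snd (fst q))"
    and 3: "bounded_linear (\<lambda>q::('a \<times> 'b) \<times> real. snd q)"
    by (intro bounded_linear_intros)+
  define l where "l = (\<lambda>x. max 0 (snd (p x)))"
  have il: "integrable M (\<lambda>x. snd (p x))"
    "\<And>A. A \<in> borel_sets I \<Longrightarrow> measure lborel A = set_lebesgue_integral M A (\<lambda>x. snd (p x))"
    using comp[OF 3] by (auto simp: \<kappa>_def)
  have "AE x in M. 0 \<le> snd (p x)"
  proof (rule finite_measure.axioms(1)[OF fin, THEN sigma_finite_measure.density_nonneg, OF il(1)])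
    fix A assume "A \<in> sets M"
    then show "0 \<le> set_lebesgue_integral M A (\<lambda>x. snd (p x))"
      using il(2)[of A, symmetric] sets by simp
  qed
  then have leq: "AE x in M. snd (p x) = l x" by eventually_elim (simp add: l_def)
  have l: "integrable M l" unfolding l_def using il(1) by simp
  have "measure lborel A = set_lebesgue_integral M A l" if A: "A \<in> borel_sets I" for A
    unfolding il(2)[OF A] set_lebesgue_integral_def
    using leq A sets il(1) l by (intro integral_cong_AE) auto
  then show thesis
    using that[OF fin sets, of "\<lambda>x. fst (fst (p x))" "\<lambda>x. snd (fst (p x))" l] comp[OF 1] comp[OF 2] l
    by (auto simp: \<kappa>_def l_def)
qed

lemma lebesgue_eq_density:
  assumes I: "I \<in> sets borel" and sets: "sets M = borel_sets I"
    and l: "integrable M l" "\<And>x. 0 \<le> (l x :: real)"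
    and leb: "\<And>A. A \<in> borel_sets I \<Longrightarrow> measure lborel A = set_lebesgue_integral M A l"
    and fin: "emeasure lborel I < \<infinity>"
  shows "restrict_space lborel I = density M (\<lambda>x. ennreal (l x))"
proof (rule measure_eqI)
  show "sets (restrict_space lborel I) = sets (density M (\<lambda>x. ennreal (l x)))"
    using sets by (simp add: sets_restrict_space)
  fix A assume A: "A \<in> sets (restrict_space lborel I)"
  then have A': "A \<in> borel_sets I" "A \<subseteq> I" "A \<in> sets lborel" using I by (auto simp: sets_restrict_space_iff sets_restrict_space)
  have "emeasure lborel A \<le> emeasure lborel I" using A' I by (intro emeasure_mono) auto
  then have "emeasure lborel A \<noteq> \<infinity>" using fin by auto
  then have "emeasure (restrict_space lborel I) A = ennreal (measure lborel A)"
    using A' I by (subst emeasure_restrict_space) (auto simp: emeasure_eq_ennreal_measure)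
  also have "\<dots> = ennreal (LINT x|M. indicator A x *\<^sub>R l x)" using leb[OF A'(1)] by (simp add: set_lebesgue_integral_def)
  also have "\<dots> = (\<integral>\<^sup>+x. ennreal (indicator A x *\<^sub>R l x) \<partial>M)"
    using A' sets l by (intro nn_integral_eq_integral[symmetric] integrable_mult_indicator) auto
  also have "\<dots> = emeasure (density M (\<lambda>x. ennreal (l x))) A"
    using A' sets l(1) by (subst emeasure_density) (auto intro!: nn_integral_cong split: split_indicator)
  finally show "emeasure (restrict_space lborel I) A = emeasure (density M (\<lambda>x. ennreal (l x))) A" .
qed

lemma AE_lebesgue_on_iff_density:
  assumes I: "I \<in> sets borel" and l: "l \<in> borel_measurable M"
    and eq: "restrict_space lborel I = density M (\<lambda>x. ennreal (l x))"
  shows "(AE x in lebesgue_on I. P x) \<longleftrightarrow> (AE x in M. 0 < l x \<longrightarrow> P x)"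
proof -
  have "(AE x in lebesgue_on I. P x) \<longleftrightarrow> (AE x in restrict_space lborel I. P x)"
    using I by (subst AE_restrict_space_iff) (simp_all add: AE_lebesgue_on_iff_lborel)
  also have "\<dots> \<longleftrightarrow> (AE x in M. 0 < l x \<longrightarrow> P x)"
    unfolding eq using l by (subst AE_density) auto
  finally show ?thesis .
qed

lemma integral_lebesgue_on_density:
  fixes f :: "real \<Rightarrow> 'a::euclidean_space"
  assumes I: "I \<in> sets borel" and sets: "sets M = borel_sets I" and l: "l \<in> borel_measurable M" "\<And>x. 0 \<le> l x"
    and eq: "restrict_space lborel I = density M (\<lambda>x. ennreal (l x))"
    and f: "f \<in> borel_measurable borel"
  shows "(LINT x|lebesgue_on I. f x) = (LINT x|M. l x *\<^sub>R f x)"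
    and "integrable (lebesgue_on I) f \<longleftrightarrow> integrable M (\<lambda>x. l x *\<^sub>R f x)"
proof -
  have fM: "f \<in> borel_measurable M"
    using measurable_restrict_space1[OF f, of I]
    by (simp add: measurable_cong_sets[of M "restrict_space borel I"] sets)
  have "(LINT x|lebesgue_on I. f x) = (LINT x|restrict_space lborel I. f x)"
    unfolding integral_lebesgue_on_borel[OF I f] using I by (intro integral_restrict_space[symmetric]) simp
  also have "\<dots> = (LINT x|M. l x *\<^sub>R f x)"
    unfolding eq using l fM by (subst integral_density) auto
  finally show "(LINT x|lebesgue_on I. f x) = (LINT x|M. l x *\<^sub>R f x)" .
  have "integrable (lebesgue_on I) f \<longleftrightarrow> integrable (restrict_space lborel I) f"
    unfolding integrable_lebesgue_on_borel[OF I f] using I by (intro integrable_restrict_space[symmetric]) simp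
  also have "\<dots> \<longleftrightarrow> integrable M (\<lambda>x. l x *\<^sub>R f x)"
    unfolding eq using l fM by (subst integrable_density) auto
  finally show "integrable (lebesgue_on I) f \<longleftrightarrow> integrable M (\<lambda>x. l x *\<^sub>R f x)" .
qed

section \<open>The lemma of du Bois-Reymond\<close>

text \<open>
  The intervals \<open>{a<..x}\<close> generate the Borel sets and are stable under intersection; the whole
  interval is their increasing union.
\<close>

lemma AE_eq_zero_if_atMost_integrals:
  fixes f :: "real \<Rightarrow> 'a::euclidean_space"
  assumes fin: "sigma_finite_measure M" and sets: "sets M = borel_sets {a<..<b}" and f: "integrable M f"
    and zero: "\<And>x. a < x \<Longrightarrow> x < b \<Longrightarrow> set_lebesgue_integral M {a<..x} f = 0"
  shows "AE x in M. f x = 0"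
proof -
  interpret M: sigma_finite_measure M by fact
  have space: "space M = {a<..<b}" using space_eq_of_sets[OF sets] .
  define Q where "Q A = (LINT x|M. indicator A x *\<^sub>R f x)" for A
  have borelM: "A \<inter> {a<..<b} \<in> sets M" if "A \<in> sets borel" for A
    using that by (auto simp: sets sets_restrict_space)
  have indM: "(\<lambda>x. indicator A x :: real) \<in> borel_measurable M" if A: "A \<in> sets borel" for A
  proof -
    have "(\<lambda>x. indicator (A \<inter> {a<..<b}) x :: real) \<in> borel_measurable M" using borelM[OF A] by simp
    then show ?thesis by (rule measurable_cong[THEN iffD1, rotated]) (simp add: space indicator_def)
  qed
  have intA: "integrable M (\<lambda>x. indicator A x *\<^sub>R f x)" if A: "A \<in> sets borel" for A
    by (rule Bochner_Integration.integrable_bound[OF f])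
       (use indM[OF A] f in \<open>auto split: split_indicator\<close>)
  have lim: "Q {..<x} = 0" if "a < x" "x \<le> b" for x
  proof -
    define X where "X n = x - (x - a) / (real n + 2)" for n :: nat
    have X: "a < X n" "X n < x" for n
    proof -
      have "(x - a) / (real n + 2) < x - a" using that by (simp add: divide_less_eq)
      then show "a < X n" by (simp add: X_def)
      show "X n < x" using that by (simp add: X_def)
    qed
    have Xlim: "X \<longlonglongrightarrow> x"
    proof -
      have "X \<longlonglongrightarrow> x - 0" unfolding X_def by (intro tendsto_diff tendsto_const) real_asymp
      then show ?thesis by simp
    qed
    have "(\<lambda>n. LINT y|M. indicator {..X n} y *\<^sub>R f y) \<longlonglongrightarrow> (LINT y|M. indicator {..<x} y *\<^sub>R f y)"
    proof (rule integral_dominated_convergence)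
      show "AE y in M. (\<lambda>n. indicator {..X n} y *\<^sub>R f y) \<longlonglongrightarrow> indicator {..<x} y *\<^sub>R f y"
      proof (rule AE_I2)
        fix y
        have "eventually (\<lambda>n. indicator {..X n} y = (indicator {..<x} y :: real)) sequentially"
        proof (cases "y < x")
          case True
          then have "eventually (\<lambda>n. y < X n) sequentially" using Xlim by (rule order_tendstoD(1)[rotated])
          then show ?thesis by eventually_elim (use True in simp)
        next
          case False
          then have "\<not> y \<le> X n" for n using X(2)[of n] by simp
          with False show ?thesis by simp
        qed
        then have "eventually (\<lambda>n. indicator {..X n} y *\<^sub>R f y = indicator {..<x} y *\<^sub>R f y) sequentially"
          by eventually_elim simp
        then show "(\<lambda>n. indicator {..X n} y *\<^sub>R f y) \<longlonglongrightarrow> indicator {..<x} y *\<^sub>R f y"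
          by (rule tendsto_eventually)
      qed
      show "AE y in M. norm (indicator {..X n} y *\<^sub>R f y) \<le> norm (f y)" for n by (auto split: split_indicator)
      show "integrable M (\<lambda>y. norm (f y))" using f by simp
      show "(\<lambda>y. indicator {..X n} y *\<^sub>R f y) \<in> borel_measurable M" for n using intA[of "{..X n}"] by simp
      show "(\<lambda>y. indicator {..<x} y *\<^sub>R f y) \<in> borel_measurable M" using intA[of "{..<x}"] by simp
    qed
    moreover have "(LINT y|M. indicator {..X n} y *\<^sub>R f y) = 0" for n
    proof -
      have "(LINT y|M. indicator {..X n} y *\<^sub>R f y) = set_lebesgue_integral M {a<..X n} f"
        unfolding set_lebesgue_integral_def
        by (intro Bochner_Integration.integral_cong refl) (auto simp: space split: split_indicator)
      then show ?thesis using zero[of "X n"] X[of n] that by simp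
    qed
    ultimately show ?thesis by (simp add: Q_def LIMSEQ_const_iff)
  qed
  have QU: "Q UNIV = 0"
  proof (cases "a < b")
    case True
    have "Q UNIV = Q {..<b}" unfolding Q_def
      by (intro Bochner_Integration.integral_cong refl) (auto simp: space split: split_indicator)
    then show ?thesis using lim[OF True] by simp
  next
    case False
    then have "space M = {}" by (simp add: space)
    then show ?thesis by (simp add: Q_def Bochner_Integration.integral_empty)
  qed
  have Qall: "Q A = 0" if "A \<in> sets borel" for A
  proof -
    have "Int_stable (range (\<lambda>x::real. {..x}))" by (auto simp: Int_stable_def)
    moreover have "range (\<lambda>x::real. {..x}) \<subseteq> Pow UNIV" by simp
    moreover have "A \<in> sigma_sets UNIV (range (\<lambda>x::real. {..x}))"
      using that unfolding borel_eq_atMost by simp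
    ultimately show ?thesis
    proof (induction rule: sigma_sets_induct_disjoint)
      case (basic A)
      then obtain x where A: "A = {..x}" by auto
      consider "x \<le> a" | "a < x" "x < b" | "b \<le> x" by linarith
      then show ?case
      proof cases
        case 1
        have "Q A = (LINT x|M. 0)" unfolding Q_def A
          by (intro Bochner_Integration.integral_cong refl) (use 1 in \<open>auto simp: space split: split_indicator\<close>)
        then show ?thesis by simp
      next
        case 2
        have "Q A = set_lebesgue_integral M {a<..x} f" unfolding Q_def A set_lebesgue_integral_def
          by (intro Bochner_Integration.integral_cong refl) (auto simp: space split: split_indicator)
        then show ?thesis using zero 2 by simp
      next
        case 3
        have "Q A = Q UNIV" unfolding Q_def A
          by (intro Bochner_Integration.integral_cong refl) (use 3 in \<open>auto simp: space split: split_indicator\<close>)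
        then show ?thesis using QU by simp
      qed
    next
      case empty then show ?case by (simp add: Q_def)
    next
      case (compl A)
      have A: "A \<in> sets borel" using compl(1) unfolding borel_eq_atMost by simp
      have "Q (UNIV - A) = (LINT x|M. indicator UNIV x *\<^sub>R f x - indicator A x *\<^sub>R f x)" unfolding Q_def
        by (intro Bochner_Integration.integral_cong refl) (auto split: split_indicator)
      also have "\<dots> = Q UNIV - Q A" unfolding Q_def
        using intA[OF A] intA[of UNIV] by (intro Bochner_Integration.integral_diff) auto
      finally show ?case using compl QU by simp
    next
      case (union A)
      have A: "A i \<in> sets borel" for i using union(2) unfolding borel_eq_atMost by auto
      have conv: "Q B = set_lebesgue_integral M (B \<inter> {a<..<b}) f" for B
        unfolding Q_def set_lebesgue_integral_def
        by (intro Bochner_Integration.integral_cong refl) (auto simp: space split: split_indicator)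
      have "disjoint_family (\<lambda>i. A i \<inter> {a<..<b})"
        unfolding disjoint_family_on_def using disjoint_family_onD[OF union(1)] by blast
      from set_integral_sums[OF f _ this, OF borelM[OF A]]
      have "(\<lambda>i. Q (A i)) sums Q (\<Union>i. A i)" unfolding conv by simp
      moreover have "Q (A i) = 0" for i using union(3) by simp
      ultimately show ?case using sums_unique2[OF _ sums_zero] by auto
    qed
  qed
  show ?thesis
  proof (rule M.density_zero[OF f])
    fix A assume "A \<in> sets M"
    then have "A \<in> sets borel" by (auto simp: sets sets_restrict_space)
    then show "set_lebesgue_integral M A f = 0" using Qall[of A] by (simp add: Q_def set_lebesgue_integral_def)
  qed
qed

lemma C1_c_margin:
  assumes "\<phi> \<in> C1_c {a<..<b}" and ab: "a < b"
  obtains c d where "a < c" "c < d" "d < b" "\<And>x. x \<le> c \<Longrightarrow> \<phi> x = 0" "\<And>x. d \<le> x \<Longrightarrow> \<phi> x = 0"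
    "\<And>x. (\<phi> has_real_derivative deriv \<phi> x) (at x)" "continuous_on UNIV (deriv \<phi>)"
    "\<And>x. x < c \<Longrightarrow> deriv \<phi> x = 0" "\<And>x. d < x \<Longrightarrow> deriv \<phi> x = 0"
proof -
  obtain D K where D: "\<And>x. (\<phi> has_vector_derivative D x) (at x)" "continuous_on UNIV D"
    and K: "compact K" "K \<subseteq> {a<..<b}" "\<And>x. x \<notin> K \<Longrightarrow> \<phi> x = 0"
    using assms unfolding C1_c_def C1_differentiable_on_def by auto
  have D': "(\<phi> has_real_derivative D x) (at x)" for x
    using D(1) by (simp add: has_real_derivative_iff_has_vector_derivative)
  then have Dd: "deriv \<phi> = D" by (auto simp: fun_eq_iff DERIV_imp_deriv)
  obtain p q where pq: "a < p" "p < q" "q < b" "K \<subseteq> {p<..<q}"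
  proof (cases "K = {}")
    case True
    show thesis by (rule that[of "(3*a+b)/4" "(a+3*b)/4"]) (use ab True in auto)
  next
    case False
    obtain s t where s: "s \<in> K" "\<And>x. x \<in> K \<Longrightarrow> s \<le> x" and t: "t \<in> K" "\<And>x. x \<in> K \<Longrightarrow> x \<le> t"
      using compact_attains_inf[OF K(1) False] compact_attains_sup[OF K(1) False] by metis
    have st: "a < s" "s \<le> t" "t < b" using s t K(2) by auto
    show thesis
    proof (rule that[of "(a+s)/2" "(t+b)/2"])
      show "K \<subseteq> {(a+s)/2<..<(t+b)/2}"
      proof
        fix x assume "x \<in> K"
        then show "x \<in> {(a+s)/2<..<(t+b)/2}" using s(2)[of x] t(2)[of x] st by simp
      qed
      show "a < (a+s)/2" "(a+s)/2 < (t+b)/2" "(t+b)/2 < b" using st by simp_all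
    qed
  qed
  have z: "\<phi> x = 0" if "x \<le> p \<or> q \<le> x" for x using K(3)[of x] pq(4) that by force
  have zd: "deriv \<phi> x = 0" if "x < p \<or> q < x" for x
  proof -
    have "eventually (\<lambda>y. \<phi> y = 0) (nhds x)"
    proof (cases "x < p")
      case True
      then have "eventually (\<lambda>y. y < p) (nhds x)" by (intro eventually_nhds_in_open[of "{..<p}", simplified]) auto
      then show ?thesis by eventually_elim (use z in auto)
    next
      case False
      then have "q < x" using that by simp
      then have "eventually (\<lambda>y. q < y) (nhds x)" by (intro eventually_nhds_in_open[of "{q<..}", simplified]) auto
      then show ?thesis by eventually_elim (use z in auto)
    qed
    then have "deriv \<phi> x = deriv (\<lambda>_. 0) x" by (intro deriv_cong_ev) auto
    then show ?thesis by simp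
  qed
  show thesis using that[of p q] pq z zd D' D(2) unfolding Dd by auto
qed

lemma C1_c_deriv:
  assumes "\<phi> \<in> C1_c {a<..<b}" "a < b"
  shows "(\<phi> has_real_derivative deriv \<phi> x) (at x)" "continuous_on UNIV (deriv \<phi>)"
    "\<exists>B. \<forall>x. \<bar>deriv \<phi> x\<bar> \<le> B"
proof -
  obtain p q where pq: "a < p" "p < q" "q < b" "\<And>x. x \<le> p \<Longrightarrow> \<phi> x = 0" "\<And>x. q \<le> x \<Longrightarrow> \<phi> x = 0"
    "\<And>x. (\<phi> has_real_derivative deriv \<phi> x) (at x)" "continuous_on UNIV (deriv \<phi>)"
    "\<And>x. x < p \<Longrightarrow> deriv \<phi> x = 0" "\<And>x. q < x \<Longrightarrow> deriv \<phi> x = 0"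
    using C1_c_margin[OF assms] by blast
  show "(\<phi> has_real_derivative deriv \<phi> x) (at x)" "continuous_on UNIV (deriv \<phi>)" by (rule pq)+
  have "compact (deriv \<phi> ` {p..q})"
    by (rule compact_continuous_image[OF continuous_on_subset[OF pq(7)]]) auto
  from compact_imp_bounded[OF this] obtain B where B: "\<forall>y\<in>deriv \<phi> ` {p..q}. norm y \<le> B"
    unfolding bounded_iff by (rule exE)
  have "\<bar>deriv \<phi> x\<bar> \<le> max 0 B" for x
  proof -
    consider "x < p" | "q < x" | "x \<in> {p..q}" by fastforce
    then show ?thesis using pq(8,9)[of x] B by cases (auto simp: le_max_iff_disj)
  qed
  then show "\<exists>B. \<forall>x. \<bar>deriv \<phi> x\<bar> \<le> B" by blast
qed

lemma C1_c_antiderivative: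
  fixes \<psi> :: "real \<Rightarrow> real"
  assumes cont: "continuous_on UNIV \<psi>" and cd: "a < c" "c \<le> d" "d < b"
    and supp: "\<And>x. x < c \<Longrightarrow> \<psi> x = 0" "\<And>x. d < x \<Longrightarrow> \<psi> x = 0"
    and zero: "integral {c..d} \<psi> = 0"
  obtains \<phi> where "\<phi> \<in> C1_c {a<..<b}" "deriv \<phi> = \<psi>"
proof -
  define \<phi> where "\<phi> x = integral {a..x} \<psi>" for x
  have int: "\<psi> integrable_on {p..q}" for p q
    by (rule integrable_continuous_interval[OF continuous_on_subset[OF cont]]) simp
  have left: "\<phi> x = 0" if "x \<le> c" for x
  proof -
    have "\<phi> x = integral {a..x} (\<lambda>_. 0::real)" unfolding \<phi>_def
    proof (rule integral_spike[of "{c}"])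
      show "\<And>y. y \<in> {a..x} - {c} \<Longrightarrow> 0 = \<psi> y" using supp(1) that by force
    qed auto
    then show ?thesis by simp
  qed
  have right: "\<phi> x = 0" if "d \<le> x" for x
  proof -
    have "integral {d..x} \<psi> = integral {d..x} (\<lambda>_. 0::real)"
    proof (rule integral_spike[of "{d}"])
      show "\<And>y. y \<in> {d..x} - {d} \<Longrightarrow> 0 = \<psi> y" using supp(2) that by force
    qed auto
    moreover have "\<phi> x = \<phi> c + (integral {c..d} \<psi> + integral {d..x} \<psi>)"
      unfolding \<phi>_def using that cd int
      by (simp add: Henstock_Kurzweil_Integration.integral_combine)
    ultimately show ?thesis using left[of c] zero by simp
  qed
  have der: "(\<phi> has_real_derivative \<psi> x) (at x)" for x
  proof (cases "x < c")
    case True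
    have "((\<lambda>_. 0::real) has_real_derivative \<psi> x) (at x)" using supp(1)[OF True] by simp
    then show ?thesis
    proof (rule has_field_derivative_transform_within_open[of _ _ _ "{..<c}"])
      show "\<And>y. y \<in> {..<c} \<Longrightarrow> 0 = \<phi> y" using left by simp
    qed (use True in auto)
  next
    case False
    then have x: "a < x" using cd by simp
    have "((\<lambda>x. integral {a..x} \<psi>) has_real_derivative \<psi> x) (at x within {a..x+1})"
      by (rule integral_has_real_derivative[OF continuous_on_subset[OF cont]]) (use x in auto)
    moreover have "at x within {a..x+1} = at x"
      by (rule at_within_interior) (use x in \<open>simp add: interior_atLeastAtMost_real\<close>)
    ultimately show ?thesis unfolding \<phi>_def by simp
  qed
  have "\<phi> \<in> C1_c {a<..<b}" unfolding C1_c_def C1_differentiable_on_def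
  proof (intro CollectI conjI exI)
    show "\<forall>x\<in>UNIV. (\<phi> has_vector_derivative \<psi> x) (at x)"
      using der by (simp add: has_real_derivative_iff_has_vector_derivative)
    show "compact {c..d}" "{c..d} \<subseteq> {a<..<b}" using cd by auto
    show "\<forall>x. x \<notin> {c..d} \<longrightarrow> \<phi> x = 0" using left right by auto
  qed (rule cont)
  moreover have "deriv \<phi> = \<psi>" using der by (auto simp: fun_eq_iff DERIV_imp_deriv)
  ultimately show thesis by (rule that)
qed

text \<open>
  Let \<open>k\<close> be a fixed bump function. A continuous \<open>\<psi>\<close> with compact support becomes the derivative of a
  test function once the multiple of \<open>k\<close> with the same integral is subtracted. With \<open>c\<close> the mean of
  \<open>h\<close> weighted by \<open>k\<close>, this makes \<open>h - c\<close> orthogonal to all such \<open>\<psi>\<close>, and by approximation to the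
  indicators of \<open>{a<..x}\<close>.
\<close>

lemma du_bois_reymond:
  fixes h :: "real \<Rightarrow> 'a::euclidean_space"
  assumes ab: "a < b" and h: "integrable (lebesgue_on {a<..<b}) h"
    and test: "\<And>\<phi>. \<phi> \<in> C1_c {a<..<b} \<Longrightarrow> (LINT x|lebesgue_on {a<..<b}. deriv \<phi> x *\<^sub>R h x) = 0"
  shows "\<exists>c. AE x in lebesgue_on {a<..<b}. h x = c"
proof -
  let ?L = "lebesgue_on {a<..<b}"
  interpret L: finite_measure ?L by (rule finite_measure_lebesgue_on_Ioo)
  have bnd: "integrable ?L (\<lambda>x. \<psi> x *\<^sub>R g x)" if "continuous_on UNIV \<psi>" "\<And>x. \<bar>\<psi> x\<bar> \<le> B" "integrable ?L g"
    for \<psi> :: "real \<Rightarrow> real" and B and g :: "real \<Rightarrow> 'b::euclidean_space"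
  proof (rule Bochner_Integration.integrable_bound[of _ "\<lambda>x. B *\<^sub>R g x"])
    have "\<psi> \<in> borel_measurable ?L" using that(1)
      by (intro borel_measurable_lebesgue_on borel_measurable_continuous_onI)
    then show "(\<lambda>x. \<psi> x *\<^sub>R g x) \<in> borel_measurable ?L" using that(3) by measurable
    show "AE x in ?L. norm (\<psi> x *\<^sub>R g x) \<le> norm (B *\<^sub>R g x)"
      using that(2) by (intro AE_I2) (simp, metis abs_le_D1 abs_of_nonneg abs_ge_zero mult_right_mono norm_ge_zero order_trans)
  qed (use that in auto)
  have HK: "(LINT x|?L. \<psi> x) = integral {c..d} \<psi>"
    if "continuous_on UNIV \<psi>" "a < c" "c \<le> d" "d < b" "\<And>x. x < c \<Longrightarrow> \<psi> x = 0" "\<And>x. d < x \<Longrightarrow> \<psi> x = 0"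
    for \<psi> :: "real \<Rightarrow> real" and c d
  proof -
    have m: "\<psi> \<in> borel_measurable borel" using that(1) by (rule borel_measurable_continuous_onI)
    have "(LINT x|?L. \<psi> x) = (LINT x|lborel. indicator {a<..<b} x *\<^sub>R \<psi> x)"
      by (rule integral_lebesgue_on_borel[OF _ m]) simp
    also have "\<dots> = (LINT x|lborel. indicator {c..d} x *\<^sub>R \<psi> x)"
    proof (intro Bochner_Integration.integral_cong refl)
      fix x show "indicator {a<..<b} x *\<^sub>R \<psi> x = indicator {c..d} x *\<^sub>R \<psi> x"
        using that(2-4) that(5,6)[of x] by (cases "x < c"; cases "d < x") (auto split: split_indicator)
    qed
    also have "\<dots> = integral {c..d} \<psi>"
    proof -
      have "set_integrable lborel {c..d} \<psi>" unfolding set_integrable_def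
        using borel_integrable_compact[of "{c..d}" \<psi>] continuous_on_subset[OF that(1)] by auto
      from set_borel_integral_eq_integral(2)[OF this] show ?thesis by (simp add: set_lebesgue_integral_def)
    qed
    finally show ?thesis .
  qed
  have mean0: "(LINT x|?L. \<psi> x *\<^sub>R h x) = 0"
    if "continuous_on UNIV \<psi>" "a < c" "c \<le> d" "d < b" "\<And>x. x < c \<Longrightarrow> \<psi> x = 0" "\<And>x. d < x \<Longrightarrow> \<psi> x = 0"
      "(LINT x|?L. \<psi> x) = 0" for \<psi> c d
  proof -
    have "integral {c..d} \<psi> = 0" using HK[OF that(1-6)] that(7) by simp
    from C1_c_antiderivative[OF that(1-6) this] obtain \<phi> where "\<phi> \<in> C1_c {a<..<b}" "deriv \<phi> = \<psi>" .
    then show ?thesis using test by metis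
  qed
  define m r where "m = (a+b)/2" and "r = (b-a)/4"
  have r: "0 < r" "a < m - r" "m + r < b" using ab by (auto simp: m_def r_def field_simps)
  define k where "k x = max 0 (r - \<bar>x - m\<bar>)" for x
  have k: "continuous_on UNIV k" "\<And>x. x < m - r \<Longrightarrow> k x = 0" "\<And>x. m + r < x \<Longrightarrow> k x = 0" "\<And>x. \<bar>k x\<bar> \<le> r"
    unfolding k_def using r by (auto intro!: continuous_intros)
  have one: "integrable ?L (\<lambda>_. 1::real)" by simp
  have intk: "integrable ?L k" using bnd[OF k(1,4) one] by simp
  have kpos: "(LINT x|?L. k x) \<noteq> 0"
  proof
    assume "(LINT x|?L. k x) = 0"
    then have "AE x in ?L. k x = 0"
      using intk by (subst (asm) integral_nonneg_eq_0_iff_AE) (auto simp: k_def)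
    then have "AE x in lborel. x \<in> {a<..<b} \<longrightarrow> k x = 0" by (simp add: AE_lebesgue_on_iff_lborel)
    then have "AE x in lborel. x \<notin> {m - r<..<m + r}"
      by eventually_elim (use r in \<open>auto simp: k_def\<close>)
    then have "emeasure lborel {m - r<..<m + r} = 0"
      by (subst (asm) AE_iff_measurable[of "{m - r<..<m + r}"]) auto
    then show False using r(1) by simp
  qed
  define c where "c = (1 / (LINT x|?L. k x)) *\<^sub>R (LINT x|?L. k x *\<^sub>R h x)"
  have test2: "(LINT x|?L. \<psi> x *\<^sub>R (h x - c)) = 0"
    if \<psi>: "continuous_on UNIV \<psi>" "a < p" "p \<le> q" "q < b" "\<And>x. x < p \<Longrightarrow> \<psi> x = 0" "\<And>x. q < x \<Longrightarrow> \<psi> x = 0" "\<And>x. \<bar>\<psi> x\<bar> \<le> B"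
    for \<psi> p q B
  proof -
    define t where "t = (LINT x|?L. \<psi> x) / (LINT x|?L. k x)"
    have int\<psi>: "integrable ?L \<psi>" using bnd[OF \<psi>(1,7) one] by simp
    have int\<psi>h: "integrable ?L (\<lambda>x. \<psi> x *\<^sub>R h x)" using bnd[OF \<psi>(1,7) h] by simp
    have intkh: "integrable ?L (\<lambda>x. k x *\<^sub>R h x)" using bnd[OF k(1,4) h] by simp
    have "(LINT x|?L. (\<psi> x - t * k x) *\<^sub>R h x) = 0"
    proof (rule mean0[of _ "min p (m - r)" "max q (m + r)"])
      show "continuous_on UNIV (\<lambda>x. \<psi> x - t * k x)" by (intro continuous_intros \<psi> k)
      show "(LINT x|?L. \<psi> x - t * k x) = 0" using int\<psi> intk kpos by (simp add: t_def)
    qed (use \<psi> k r in auto)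
    then have "(LINT x|?L. \<psi> x *\<^sub>R h x) = t *\<^sub>R (LINT x|?L. k x *\<^sub>R h x)"
      using int\<psi>h intkh by (simp add: scaleR_diff_left flip: scaleR_scaleR)
    also have "\<dots> = (LINT x|?L. \<psi> x) *\<^sub>R c" by (simp add: t_def c_def)
    finally show ?thesis using int\<psi>h int\<psi> by (simp add: scaleR_diff_right)
  qed
  define f where "f x = h x - c" for x
  have f: "integrable ?L f" unfolding f_def using h by simp
  obtain f' where f'm: "f' \<in> borel_measurable borel" and ff': "AE x in ?L. f x = f' x"
    using lebesgue_on_borel_version[OF borel_open[OF open_greaterThanLessThan] borel_measurable_integrable[OF f]]
    by blast
  let ?R = "restrict_space lborel {a<..<b}"
  have f'L: "integrable ?L f'"
    by (rule integrable_cong_AE_imp[OF f borel_measurable_lebesgue_on[OF f'm]]) (use ff' in \<open>auto elim: eventually_mono\<close>)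
  have conv: "(LINT x|?L. g x) = (LINT x|?R. g x)" if "g \<in> borel_measurable borel" for g :: "real \<Rightarrow> 'a"
    by (subst integral_lebesgue_on_borel[OF _ that], simp, subst integral_restrict_space) simp_all
  have f'R: "integrable ?R f'"
  proof -
    have "integrable lborel (\<lambda>x. indicator {a<..<b} x *\<^sub>R f' x)"
      using f'L integrable_lebesgue_on_borel[OF _ f'm, of "{a<..<b}"] by simp
    then show ?thesis by (subst integrable_restrict_space) simp_all
  qed
  have "AE x in ?R. f' x = 0"
  proof (rule AE_eq_zero_if_atMost_integrals[OF _ _ f'R])
    have "finite_measure ?R"
      by (rule finite_measureI) (use ab in \<open>simp add: emeasure_restrict_space space_restrict_space\<close>)
    then show "sigma_finite_measure ?R" by (simp add: finite_measure_def)
    show "sets ?R = borel_sets {a<..<b}" by (simp add: sets_restrict_space)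
    fix x assume x: "a < x" "x < b"
    define \<psi> where "\<psi> n y = max 0 (min 1 (min ((real n + 1) * (y - a) - 1) (1 - (real n + 1) * (y - x))))" for n :: nat and y
    have lim: "(\<lambda>n. \<psi> n y *\<^sub>R f y) \<longlonglongrightarrow> indicator {a<..x} y *\<^sub>R f y" if y: "y \<in> {a<..<b}" for y
    proof -
      have "eventually (\<lambda>n. \<psi> n y = indicator {a<..x} y) sequentially"
      proof -
        have 1: "eventually (\<lambda>n. (real n + 1) * (y - a) > 2) sequentially"
          using y by real_asymp
        show ?thesis
        proof (cases "y \<le> x")
          case True
          then have "(real n + 1) * (y - x) \<le> 0" for n by (simp add: mult_nonneg_nonpos)
          then have 2: "1 - (real n + 1) * (y - x) \<ge> 1" for n by simp
          from 1 show ?thesis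
          proof eventually_elim
            case (elim n)
            then show ?case using True y 2[of n] by (auto simp: \<psi>_def min_def max_def)
          qed
        next
          case False
          then have "eventually (\<lambda>n. (real n + 1) * (y - x) > 2) sequentially" by real_asymp
          then show ?thesis
            by eventually_elim (use False in \<open>auto simp: \<psi>_def min_def max_def\<close>)
        qed
      qed
      then have "eventually (\<lambda>n. \<psi> n y *\<^sub>R f y = indicator {a<..x} y *\<^sub>R f y) sequentially"
        by eventually_elim simp
      then show ?thesis by (rule tendsto_eventually)
    qed
    have \<psi>b: "\<bar>\<psi> n y\<bar> \<le> 1" for n y by (auto simp: \<psi>_def)
    have \<psi>c: "continuous_on UNIV (\<psi> n)" for n unfolding \<psi>_def by (intro continuous_intros)
    have xm: "(\<lambda>y. indicator {a<..x} y *\<^sub>R f y) \<in> borel_measurable ?L"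
    proof -
      have "(\<lambda>y. indicator {a<..x} y :: real) \<in> borel_measurable ?L" by (intro borel_measurable_lebesgue_on) simp
      then show ?thesis using f by measurable
    qed
    have "(\<lambda>n. LINT y|?L. \<psi> n y *\<^sub>R f y) \<longlonglongrightarrow> (LINT y|?L. indicator {a<..x} y *\<^sub>R f y)"
    proof (rule integral_dominated_convergence)
      show "AE y in ?L. (\<lambda>n. \<psi> n y *\<^sub>R f y) \<longlonglongrightarrow> indicator {a<..x} y *\<^sub>R f y"
        using lim by (intro AE_I2) (simp add: space_restrict_space)
      show "AE y in ?L. norm (\<psi> n y *\<^sub>R f y) \<le> norm (f y)" for n
        using \<psi>b by (intro AE_I2) (simp add: mult_left_le_one_le)
      show "(\<lambda>y. \<psi> n y *\<^sub>R f y) \<in> borel_measurable ?L" for n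
        using bnd[OF \<psi>c \<psi>b f] by simp
    qed (use f xm in auto)
    moreover have "eventually (\<lambda>n. (LINT y|?L. \<psi> n y *\<^sub>R f y) = 0) sequentially"
    proof -
      have "eventually (\<lambda>n. x + 1 / (real n + 1) < b) sequentially"
        "eventually (\<lambda>n. a + 1 / (real n + 1) < x) sequentially" using x by real_asymp+
      then show ?thesis
      proof eventually_elim
        case (elim n)
        show ?case unfolding f_def
        proof (rule test2[OF \<psi>c _ _ elim(1) _ _ \<psi>b])
          show "a < a + 1 / (real n + 1)" by simp
          show "a + 1 / (real n + 1) \<le> x + 1 / (real n + 1)" using x by simp
          show "\<psi> n y = 0" if "y < a + 1 / (real n + 1)" for y
            using that by (simp add: \<psi>_def field_simps)
          show "\<psi> n y = 0" if "x + 1 / (real n + 1) < y" for y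
            using that by (simp add: \<psi>_def field_simps)
        qed
      qed
    qed
    ultimately have "(LINT y|?L. indicator {a<..x} y *\<^sub>R f y) = 0"
      by (rule LIMSEQ_unique[OF _ tendsto_eventually])
    moreover have "(LINT y|?L. indicator {a<..x} y *\<^sub>R f y) = (LINT y|?L. indicator {a<..x} y *\<^sub>R f' y)"
    proof (rule integral_cong_AE[OF xm])
      show "(\<lambda>y. indicator {a<..x} y *\<^sub>R f' y) \<in> borel_measurable ?L"
        by (rule borel_measurable_lebesgue_on) (use f'm in simp)
      show "AE y in ?L. indicator {a<..x} y *\<^sub>R f y = indicator {a<..x} y *\<^sub>R f' y"
        using ff' by eventually_elim simp
    qed
    moreover have "\<dots> = (LINT y|?R. indicator {a<..x} y *\<^sub>R f' y)" by (rule conv) (use f'm in simp)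
    ultimately show "set_lebesgue_integral ?R {a<..x} f' = 0" by (simp add: set_lebesgue_integral_def)
  qed
  then have "AE x in ?L. f' x = 0"
    by (subst (asm) AE_restrict_space_iff) (simp_all add: AE_lebesgue_on_iff_lborel)
  with ff' have "AE x in ?L. h x = c" by eventually_elim (simp add: f_def)
  then show ?thesis ..
qed

section \<open>Primitives and the product rule\<close>

lemma integrable_pair_mult:
  fixes p :: "'a \<Rightarrow> real" and q :: "'b \<Rightarrow> real"
  assumes "sigma_finite_measure M" "sigma_finite_measure N" "integrable M p" "integrable N q"
  shows "integrable (M \<Otimes>\<^sub>M N) (\<lambda>(x, y). p x * q y)"
proof -
  interpret M: sigma_finite_measure M by fact
  interpret N: sigma_finite_measure N by fact
  interpret P: pair_sigma_finite M N ..
  have [measurable]: "p \<in> borel_measurable M" "q \<in> borel_measurable N" using assms by auto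
  show ?thesis
  proof (rule P.Fubini_integrable)
    show "(\<lambda>(x, y). p x * q y) \<in> borel_measurable (M \<Otimes>\<^sub>M N)" by measurable
    have "(\<lambda>x. LINT y|N. norm (case (x, y) of (x, y) \<Rightarrow> p x * q y)) = (\<lambda>x. \<bar>p x\<bar> * (LINT y|N. \<bar>q y\<bar>))"
      by (simp add: abs_mult)
    then show "integrable M (\<lambda>x. LINT y|N. norm (case (x, y) of (x, y) \<Rightarrow> p x * q y))"
      using assms(3) by simp
    show "AE x in M. integrable N (\<lambda>y. case (x, y) of (x, y) \<Rightarrow> p x * q y)"
      using assms(4) by simp
  qed
qed

lemma measurable_ident_borel_sets:
  "sets M = borel_sets I \<Longrightarrow> (\<lambda>x. x) \<in> measurable M borel"
  by (simp add: measurable_cong_sets[of M "restrict_space borel I"] measurable_restrict_space1)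

lemma borel_measurable_on_borel_sets:
  fixes f :: "real \<Rightarrow> 'a::topological_space"
  assumes "sets M = borel_sets I" "f \<in> borel_measurable borel"
  shows "f \<in> borel_measurable M"
  using measurable_compose[OF measurable_ident_borel_sets[OF assms(1)] assms(2)] by simp

lemma set_integral_atMost_eq:
  fixes g :: "real \<Rightarrow> 'a::euclidean_space"
  assumes "sets M = borel_sets {a<..<b}"
  shows "set_lebesgue_integral M {a<..x} g = (LINT y|M. indicator {..x} y *\<^sub>R g y)"
    and "set_lebesgue_integral M {a<..<x} g = (LINT y|M. indicator {..<x} y *\<^sub>R g y)"
  unfolding set_lebesgue_integral_def
  by (auto intro!: Bochner_Integration.integral_cong simp: space_eq_of_sets[OF assms] split: split_indicator)

lemma borel_measurable_primitive:
  fixes g :: "real \<Rightarrow> 'a::euclidean_space"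
  assumes fin: "sigma_finite_measure M" and sets: "sets M = borel_sets {a<..<b}" and g: "integrable M g"
  shows "(\<lambda>x. set_lebesgue_integral M {a<..x} g) \<in> borel_measurable borel"
    and "(\<lambda>x. set_lebesgue_integral M {a<..<x} g) \<in> borel_measurable borel"
proof -
  interpret sigma_finite_measure M by fact
  have [measurable]: "(\<lambda>x. x) \<in> measurable M borel" "g \<in> borel_measurable M"
    using measurable_ident_borel_sets[OF sets] g by auto
  have "(\<lambda>x. LINT y|M. (if y \<le> x then g y else 0)) \<in> borel_measurable borel" by measurable
  moreover have "(\<lambda>x. LINT y|M. (if y < x then g y else 0)) \<in> borel_measurable borel" by measurable
  ultimately show "(\<lambda>x. set_lebesgue_integral M {a<..x} g) \<in> borel_measurable borel"
    "(\<lambda>x. set_lebesgue_integral M {a<..<x} g) \<in> borel_measurable borel"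
    unfolding set_integral_atMost_eq[OF sets]
    by (simp_all add: indicator_def of_bool_def if_distrib[of "\<lambda>t. t *\<^sub>R _"] cong: if_cong)
qed

lemma norm_primitive_le:
  fixes g :: "real \<Rightarrow> 'a::euclidean_space"
  assumes g: "integrable M g"
  shows "norm (set_lebesgue_integral M A g) \<le> (LINT x|M. norm (g x))"
proof (cases "integrable M (\<lambda>x. indicator A x *\<^sub>R g x)")
  case True
  have "norm (set_lebesgue_integral M A g) \<le> (LINT x|M. norm (indicator A x *\<^sub>R g x))"
    unfolding set_lebesgue_integral_def by (rule integral_norm_bound)
  also have "\<dots> \<le> (LINT x|M. norm (g x))"
  proof (rule integral_mono[OF integrable_norm[OF True] integrable_norm[OF g]])
    show "norm (indicator A x *\<^sub>R g x) \<le> norm (g x)" for x by (simp split: split_indicator)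
  qed
  finally show ?thesis .
next
  case False
  then show ?thesis by (simp add: set_lebesgue_integral_def not_integrable_integral_eq)
qed

text \<open>
  Primitives of measures have the expected distributional derivative: after an exchange of the
  integrals, \<open>\<phi>'\<close> is integrated over \<open>{y..b}\<close>, which gives \<open>- \<phi> y\<close>.
\<close>

lemma integral_test_deriv_primitive:
  fixes g :: "real \<Rightarrow> 'a::euclidean_space"
  assumes ab: "a < b" and fin: "sigma_finite_measure M" and sets: "sets M = borel_sets {a<..<b}"
    and g: "integrable M g" and \<phi>: "\<phi> \<in> C1_c {a<..<b}"
  shows "integrable (lebesgue_on {a<..<b}) (\<lambda>x. deriv \<phi> x *\<^sub>R (c + set_lebesgue_integral M {a<..x} g))"
    and "(LINT x|lebesgue_on {a<..<b}. deriv \<phi> x *\<^sub>R (c + set_lebesgue_integral M {a<..x} g))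
       = - (LINT y|M. \<phi> y *\<^sub>R g y)"
proof -
  interpret M: sigma_finite_measure M by fact
  interpret P: pair_sigma_finite lborel M ..
  have space: "space M = {a<..<b}" using space_eq_of_sets[OF sets] .
  obtain p q where pq: "a < p" "p < q" "q < b" "\<And>x. x \<le> p \<Longrightarrow> \<phi> x = 0" "\<And>x. q \<le> x \<Longrightarrow> \<phi> x = 0"
    "\<And>x. (\<phi> has_real_derivative deriv \<phi> x) (at x)" "continuous_on UNIV (deriv \<phi>)"
    "\<And>x. x < p \<Longrightarrow> deriv \<phi> x = 0" "\<And>x. q < x \<Longrightarrow> deriv \<phi> x = 0"
    using C1_c_margin[OF \<phi> ab] by blast
  have dm [measurable]: "deriv \<phi> \<in> borel_measurable borel" using pq(7) by (rule borel_measurable_continuous_onI)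
  have [measurable]: "(\<lambda>x. x) \<in> measurable M borel" "g \<in> borel_measurable M"
    using measurable_ident_borel_sets[OF sets] g by auto
  define d where "d x = indicator {a..b} x * deriv \<phi> x" for x
  have [measurable]: "d \<in> borel_measurable borel" unfolding d_def by measurable
  have id: "integrable lborel d" unfolding d_def
    using borel_integrable_compact[of "{a..b}" "deriv \<phi>"] continuous_on_subset[OF pq(7)] by auto
  have Ioo_eq: "indicator {a<..<b} x * deriv \<phi> x = d x" for x
    using pq(1,3,8,9) by (cases "x = a"; cases "x = b") (auto simp: d_def split: split_indicator)
  define F where "F x = set_lebesgue_integral M {a<..x} g" for x
  have Fm [measurable]: "F \<in> borel_measurable borel"
    unfolding F_def using borel_measurable_primitive[OF fin sets g] by simp
  \<comment> \<open>The integrand of the double integral; \<open>d\<close> is \<open>\<phi>'\<close> cut off to the closed interval.\<close>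
  define G where "G x y = (if y \<le> x then d x *\<^sub>R g y else 0)" for x y
  have Gm: "case_prod G \<in> borel_measurable (lborel \<Otimes>\<^sub>M M)" unfolding G_def by measurable
  have Gi: "integrable (lborel \<Otimes>\<^sub>M M) (case_prod G)"
  proof (rule Bochner_Integration.integrable_bound[OF integrable_pair_mult[OF _ fin id[THEN integrable_abs] integrable_norm[OF g]] Gm])
    show "AE x in lborel \<Otimes>\<^sub>M M. norm (case x of (x, y) \<Rightarrow> G x y) \<le> norm (case x of (x, y) \<Rightarrow> \<bar>d x\<bar> * norm (g y))"
      by (intro AE_I2) (auto simp: G_def)
  qed (rule lborel.sigma_finite_measure_axioms)
  have inner: "(LINT y|M. G x y) = d x *\<^sub>R F x" for x
  proof -
    have "(LINT y|M. G x y) = (LINT y|M. d x *\<^sub>R (indicator {..x} y *\<^sub>R g y))"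
      by (intro Bochner_Integration.integral_cong refl) (auto simp: G_def split: split_indicator)
    also have "\<dots> = d x *\<^sub>R F x" unfolding F_def set_integral_atMost_eq[OF sets]
      by (simp only: integral_scaleR_right)
    finally show ?thesis .
  qed
  have idF: "integrable lborel (\<lambda>x. d x *\<^sub>R F x)"
    using P.integrable_fst[OF Gi] by (simp add: inner)
  have pt: "indicator {a<..<b} x *\<^sub>R (deriv \<phi> x *\<^sub>R (c + F x)) = d x *\<^sub>R c + d x *\<^sub>R F x" for x
    using Ioo_eq[of x] by (simp add: scaleR_add_right)
  have FTC: "(LINT x|lborel. deriv \<phi> x * indicator {y..b} x) = - \<phi> y" if "y \<le> b" for y
    using integral_FTC_Icc_real[of y b \<phi> "deriv \<phi>"] that pq by (simp add: continuous_on_eq_continuous_at)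
  have dint: "(LINT x|lborel. d x) = 0"
    using FTC[of a] ab pq(4)[of a] pq(1) by (simp add: d_def mult.commute)
  have inner2: "(LINT x|lborel. G x y) = - (\<phi> y *\<^sub>R g y)" if "y \<in> space M" for y
  proof -
    have y: "a < y" "y < b" using that by (auto simp: space)
    have "(LINT x|lborel. G x y) = (LINT x|lborel. (deriv \<phi> x * indicator {y..b} x) *\<^sub>R g y)"
      by (intro Bochner_Integration.integral_cong refl) (use y in \<open>auto simp: G_def d_def split: split_indicator\<close>)
    also have "\<dots> = (LINT x|lborel. deriv \<phi> x * indicator {y..b} x) *\<^sub>R g y"
    proof (rule integral_scaleR_left)
      have "integrable lborel (\<lambda>x. indicator {y..b} x *\<^sub>R deriv \<phi> x)"
        using borel_integrable_compact[of "{y..b}" "deriv \<phi>"] continuous_on_subset[OF pq(7)] by auto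
      then show "integrable lborel (\<lambda>x. deriv \<phi> x * indicator {y..b} x)" by (simp add: mult.commute)
    qed
    finally show ?thesis using FTC y by simp
  qed
  have m: "(\<lambda>x. deriv \<phi> x *\<^sub>R (c + F x)) \<in> borel_measurable borel" by measurable
  show "integrable (lebesgue_on {a<..<b}) (\<lambda>x. deriv \<phi> x *\<^sub>R (c + set_lebesgue_integral M {a<..x} g))"
    unfolding F_def[symmetric] using idF id
    by (subst integrable_lebesgue_on_borel[OF _ m]) (simp_all only: pt, auto)
  have "(LINT x|lebesgue_on {a<..<b}. deriv \<phi> x *\<^sub>R (c + F x)) = (LINT x|lborel. d x *\<^sub>R c + d x *\<^sub>R F x)"
    by (subst integral_lebesgue_on_borel[OF _ m]) (simp_all only: pt, auto)
  also have "\<dots> = (LINT x|lborel. d x *\<^sub>R c) + (LINT x|lborel. d x *\<^sub>R F x)"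
    using idF id by (intro Bochner_Integration.integral_add) auto
  also have "(LINT x|lborel. d x *\<^sub>R c) = 0" using id dint by simp
  also have "(LINT x|lborel. d x *\<^sub>R F x) = (LINT x|lborel. LINT y|M. G x y)" by (simp add: inner)
  also have "\<dots> = (LINT y|M. LINT x|lborel. G x y)" using P.Fubini_integral[OF Gi] by simp
  also have "\<dots> = (LINT y|M. - (\<phi> y *\<^sub>R g y))"
    by (intro Bochner_Integration.integral_cong refl inner2)
  finally show "(LINT x|lebesgue_on {a<..<b}. deriv \<phi> x *\<^sub>R (c + set_lebesgue_integral M {a<..x} g))
       = - (LINT y|M. \<phi> y *\<^sub>R g y)" by (simp add: F_def)
qed

text \<open>
  The product rule for functions of bounded variation. \<open>B (Z x) (W x)\<close> is a double integral over
  the square \<open>{a<..x} \<times> {a<..x}\<close>. The triangle above the diagonal, without the diagonal, gives the left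
  limit \<open>Zl\<close>; the other one contains the diagonal and gives the value \<open>W\<close>, which is the right limit.
\<close>

lemma primitive_product:
  fixes B :: "'a::euclidean_space \<Rightarrow> 'b::euclidean_space \<Rightarrow> 'c::euclidean_space"
    and cz :: "'a" and cw :: "'b"
  assumes B: "bounded_bilinear B" and fin: "sigma_finite_measure M" and sets: "sets M = borel_sets {a<..<b}"
    and \<beta>: "integrable M \<beta>" and \<alpha>: "integrable M \<alpha>"
  defines "Z \<equiv> \<lambda>x. cz + set_lebesgue_integral M {a<..x} \<beta>"
    and "Zl \<equiv> \<lambda>x. cz + set_lebesgue_integral M {a<..<x} \<beta>"
    and "W \<equiv> \<lambda>x. cw + set_lebesgue_integral M {a<..x} \<alpha>"
  shows "integrable M (\<lambda>t. B (Zl t) (\<alpha> t) + B (\<beta> t) (W t))"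
    and "B (Z x) (W x) = B cz cw + set_lebesgue_integral M {a<..x} (\<lambda>t. B (Zl t) (\<alpha> t) + B (\<beta> t) (W t))"
proof -
  interpret B: bounded_bilinear B by fact
  interpret M: sigma_finite_measure M by fact
  interpret P: pair_sigma_finite M M ..
  obtain K where K: "0 < K" "\<And>u v. norm (B u v) \<le> norm u * norm v * K" using B.pos_bounded by blast
  have [measurable]: "(\<lambda>x. x) \<in> measurable M borel" "\<beta> \<in> borel_measurable M" "\<alpha> \<in> borel_measurable M"
    using measurable_ident_borel_sets[OF sets] \<alpha> \<beta> by auto
  have Bm: "(\<lambda>x. B (f x) (g x)) \<in> borel_measurable N"
    if "f \<in> borel_measurable N" "g \<in> borel_measurable N" for f g and N :: "'x measure"
    by (rule borel_measurable_continuous_Pair[OF that])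
       (rule B.continuous_on[OF continuous_on_fst[OF continuous_on_id] continuous_on_snd[OF continuous_on_id]])
  have Zlm: "Zl \<in> borel_measurable M" and Wm: "W \<in> borel_measurable M"
    unfolding Zl_def W_def
    using borel_measurable_primitive[OF fin sets \<beta>] borel_measurable_primitive[OF fin sets \<alpha>]
    by (auto intro!: borel_measurable_on_borel_sets[OF sets])
  define CZ where "CZ = norm cz + (LINT x|M. norm (\<beta> x))"
  define CW where "CW = norm cw + (LINT x|M. norm (\<alpha> x))"
  have Zlb: "norm (Zl t) \<le> CZ" and Wb: "norm (W t) \<le> CW" for t
    unfolding Zl_def W_def CZ_def CW_def
    using norm_primitive_le[OF \<beta>] norm_primitive_le[OF \<alpha>] by (meson add_left_mono norm_triangle_le)+
  have i1: "integrable M (\<lambda>t. B (Zl t) (\<alpha> t))"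
  proof (rule Bochner_Integration.integrable_bound[of _ "\<lambda>t. CZ * norm (\<alpha> t) * K"])
    show "AE t in M. norm (B (Zl t) (\<alpha> t)) \<le> norm (CZ * norm (\<alpha> t) * K)"
    proof (rule AE_I2)
      fix t
      have "norm (B (Zl t) (\<alpha> t)) \<le> norm (Zl t) * norm (\<alpha> t) * K" by (rule K)
      also have "\<dots> \<le> CZ * norm (\<alpha> t) * K" using Zlb K(1) by (intro mult_right_mono) auto
      finally show "norm (B (Zl t) (\<alpha> t)) \<le> norm (CZ * norm (\<alpha> t) * K)" by simp
    qed
  qed (use \<alpha> Zlm in \<open>auto intro!: Bm\<close>)
  have i2: "integrable M (\<lambda>t. B (\<beta> t) (W t))"
  proof (rule Bochner_Integration.integrable_bound[of _ "\<lambda>t. norm (\<beta> t) * CW * K"])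
    show "AE t in M. norm (B (\<beta> t) (W t)) \<le> norm (norm (\<beta> t) * CW * K)"
    proof (rule AE_I2)
      fix t
      have "norm (B (\<beta> t) (W t)) \<le> norm (\<beta> t) * norm (W t) * K" by (rule K)
      also have "\<dots> \<le> norm (\<beta> t) * CW * K" using Wb K(1) by (intro mult_right_mono mult_left_mono) auto
      finally show "norm (B (\<beta> t) (W t)) \<le> norm (norm (\<beta> t) * CW * K)" by simp
    qed
  qed (use \<beta> Wm in \<open>auto intro!: Bm\<close>)
  show "integrable M (\<lambda>t. B (Zl t) (\<alpha> t) + B (\<beta> t) (W t))" using i1 i2 by simp
  have i\<beta>: "integrable M (\<lambda>t. indicator {..x} t *\<^sub>R \<beta> t)" for x
    by (rule Bochner_Integration.integrable_bound[OF \<beta>]) (auto split: split_indicator)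
  have i\<beta>': "integrable M (\<lambda>t. indicator {..<x} t *\<^sub>R \<beta> t)" for x
    by (rule Bochner_Integration.integrable_bound[OF \<beta>]) (auto split: split_indicator)
  have i\<alpha>: "integrable M (\<lambda>t. indicator {..x} t *\<^sub>R \<alpha> t)" for x
    by (rule Bochner_Integration.integrable_bound[OF \<alpha>]) (auto split: split_indicator)
  define Z0 where "Z0 x = (LINT t|M. indicator {..x} t *\<^sub>R \<beta> t)" for x
  define Zl0 where "Zl0 x = (LINT t|M. indicator {..<x} t *\<^sub>R \<beta> t)" for x
  define W0 where "W0 x = (LINT t|M. indicator {..x} t *\<^sub>R \<alpha> t)" for x
  define \<beta>' \<alpha>' where "\<beta>' t = indicator {..x} t *\<^sub>R \<beta> t" and "\<alpha>' t = indicator {..x} t *\<^sub>R \<alpha> t" for t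
  have ib: "integrable M \<beta>'" and ia: "integrable M \<alpha>'" unfolding \<beta>'_def \<alpha>'_def by (rule i\<beta> i\<alpha>)+
  have [measurable]: "\<beta>' \<in> borel_measurable M" "\<alpha>' \<in> borel_measurable M" using ib ia by auto
  define G1 where "G1 s t = (if s < t then B (\<beta>' s) (\<alpha>' t) else 0)" for s t
  define G2 where "G2 s t = (if t \<le> s then B (\<beta>' s) (\<alpha>' t) else 0)" for s t
  have Gm: "(\<lambda>(s,t). B (\<beta>' s) (\<alpha>' t)) \<in> borel_measurable (M \<Otimes>\<^sub>M M)"
    using Bm[of "\<lambda>(s,t). \<beta>' s" "M \<Otimes>\<^sub>M M" "\<lambda>(s,t). \<alpha>' t"] by (simp add: case_prod_unfold)
  have dom: "integrable (M \<Otimes>\<^sub>M M) (\<lambda>(s,t). norm (\<beta>' s) * (norm (\<alpha>' t) * K))"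
    by (rule integrable_pair_mult[OF fin fin]) (use ib ia in auto)
  have le: "norm (B (\<beta>' s) (\<alpha>' t)) \<le> norm (norm (\<beta>' s) * (norm (\<alpha>' t) * K))" for s t
    using K(2)[of "\<beta>' s" "\<alpha>' t"] K(1) by (simp add: mult.assoc)
  have G1i: "integrable (M \<Otimes>\<^sub>M M) (case_prod G1)"
  proof (rule Bochner_Integration.integrable_bound[OF dom])
    have "(\<lambda>p. if fst p < snd p then (\<lambda>(s,t). B (\<beta>' s) (\<alpha>' t)) p else 0) \<in> borel_measurable (M \<Otimes>\<^sub>M M)"
      using Gm by measurable
    then show "case_prod G1 \<in> borel_measurable (M \<Otimes>\<^sub>M M)"
      unfolding G1_def case_prod_unfold .
    show "AE p in M \<Otimes>\<^sub>M M. norm (case p of (s, t) \<Rightarrow> G1 s t) \<le> norm (case p of (s, t) \<Rightarrow> norm (\<beta>' s) * (norm (\<alpha>' t) * K))"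
      using le by (intro AE_I2) (auto simp: G1_def)
  qed
  have G2i: "integrable (M \<Otimes>\<^sub>M M) (case_prod G2)"
  proof (rule Bochner_Integration.integrable_bound[OF dom])
    have "(\<lambda>p. if snd p \<le> fst p then (\<lambda>(s,t). B (\<beta>' s) (\<alpha>' t)) p else 0) \<in> borel_measurable (M \<Otimes>\<^sub>M M)"
      using Gm by measurable
    then show "case_prod G2 \<in> borel_measurable (M \<Otimes>\<^sub>M M)"
      unfolding G2_def case_prod_unfold .
    show "AE p in M \<Otimes>\<^sub>M M. norm (case p of (s, t) \<Rightarrow> G2 s t) \<le> norm (case p of (s, t) \<Rightarrow> norm (\<beta>' s) * (norm (\<alpha>' t) * K))"
      using le by (intro AE_I2) (auto simp: G2_def)
  qed
  have B0: "B (Z0 x) (W0 x) = (LINT s|M. LINT t|M. B (\<beta>' s) (\<alpha>' t))"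
  proof -
    have "B (Z0 x) (W0 x) = (LINT s|M. B (\<beta>' s) (W0 x))"
      unfolding Z0_def \<beta>'_def[symmetric] by (rule integral_bounded_linear[OF B.bounded_linear_left ib, symmetric])
    also have "\<dots> = (LINT s|M. LINT t|M. B (\<beta>' s) (\<alpha>' t))"
      unfolding W0_def \<alpha>'_def[symmetric]
      by (intro Bochner_Integration.integral_cong refl integral_bounded_linear[OF B.bounded_linear_right ia, symmetric])
    finally show ?thesis .
  qed
  have split: "B (\<beta>' s) (\<alpha>' t) = G1 s t + G2 s t" for s t by (auto simp: G1_def G2_def)
  have in1: "(LINT s|M. G1 s t) = indicator {..x} t *\<^sub>R B (Zl0 t) (\<alpha> t)" for t
  proof -
    have "(LINT s|M. G1 s t) = (LINT s|M. B (indicator {..<t} s *\<^sub>R \<beta> s) (\<alpha>' t))"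
      by (intro Bochner_Integration.integral_cong refl)
         (auto simp: G1_def \<beta>'_def \<alpha>'_def B.zero_left B.zero_right split: split_indicator)
    also have "\<dots> = B (Zl0 t) (\<alpha>' t)" unfolding Zl0_def
      by (rule integral_bounded_linear[OF B.bounded_linear_left i\<beta>'])
    finally show ?thesis by (simp add: \<alpha>'_def B.scaleR_right)
  qed
  have in2: "(LINT t|M. G2 s t) = indicator {..x} s *\<^sub>R B (\<beta> s) (W0 s)" for s
  proof -
    have "(LINT t|M. G2 s t) = (LINT t|M. B (\<beta>' s) (indicator {..s} t *\<^sub>R \<alpha> t))"
      by (intro Bochner_Integration.integral_cong refl)
         (auto simp: G2_def \<beta>'_def \<alpha>'_def B.zero_left B.zero_right split: split_indicator)
    also have "\<dots> = B (\<beta>' s) (W0 s)" unfolding W0_def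
      by (rule integral_bounded_linear[OF B.bounded_linear_right i\<alpha>])
    finally show ?thesis by (simp add: \<beta>'_def B.scaleR_left)
  qed
  have "AE s in M. integrable M (\<lambda>t. G1 s t)" "AE s in M. integrable M (\<lambda>t. G2 s t)"
    using P.AE_integrable_fst[OF G1i] P.AE_integrable_fst[OF G2i] by auto
  then have "AE s in M. (LINT t|M. G1 s t + G2 s t) = (LINT t|M. G1 s t) + (LINT t|M. G2 s t)"
    by eventually_elim simp
  then have "(LINT s|M. LINT t|M. G1 s t + G2 s t) = (LINT s|M. (LINT t|M. G1 s t) + (LINT t|M. G2 s t))"
  proof (intro integral_cong_AE)
    have "integrable (M \<Otimes>\<^sub>M M) (case_prod (\<lambda>s t. G1 s t + G2 s t))"
      using Bochner_Integration.integrable_add[OF G1i G2i] by (simp add: case_prod_unfold)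
    from borel_measurable_integrable[OF P.integrable_fst[OF this]]
    show "(\<lambda>s. LINT t|M. G1 s t + G2 s t) \<in> borel_measurable M" .
    show "(\<lambda>s. (LINT t|M. G1 s t) + (LINT t|M. G2 s t)) \<in> borel_measurable M"
      using P.integrable_fst[OF G1i] P.integrable_fst[OF G2i] by simp
  qed
  also have "\<dots> = (LINT s|M. LINT t|M. G1 s t) + (LINT s|M. LINT t|M. G2 s t)"
    by (rule Bochner_Integration.integral_add) (use P.integrable_fst[OF G1i] P.integrable_fst[OF G2i] in auto)
  also have "(LINT s|M. LINT t|M. G1 s t) = (LINT t|M. LINT s|M. G1 s t)" using P.Fubini_integral[OF G1i] by simp
  finally have core: "B (Z0 x) (W0 x) = (LINT t|M. indicator {..x} t *\<^sub>R B (Zl0 t) (\<alpha> t))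
      + (LINT s|M. indicator {..x} s *\<^sub>R B (\<beta> s) (W0 s))"
    unfolding B0 split in1 in2 .
  have e1: "(LINT t|M. indicator {..x} t *\<^sub>R B cz (\<alpha> t)) = B cz (W0 x)"
    unfolding W0_def by (subst integral_bounded_linear[OF B.bounded_linear_right i\<alpha>, symmetric]) (simp add: B.scaleR_right)
  have e2: "(LINT t|M. indicator {..x} t *\<^sub>R B (\<beta> t) cw) = B (Z0 x) cw"
    unfolding Z0_def by (subst integral_bounded_linear[OF B.bounded_linear_left i\<beta>, symmetric]) (simp add: B.scaleR_left)
  have Zs: "Z x = cz + Z0 x" "\<And>t. Zl t = cz + Zl0 t" "\<And>t. W t = cw + W0 t" for x
    unfolding Z_def Zl_def W_def Z0_def Zl0_def W0_def set_integral_atMost_eq[OF sets] by auto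
  have ind: "integrable M (\<lambda>t. indicator {..x} t *\<^sub>R f t)" if "integrable M f" for f :: "real \<Rightarrow> 'c"
    by (rule Bochner_Integration.integrable_bound[OF that]) (use that in \<open>auto split: split_indicator\<close>)
  have j1: "integrable M (\<lambda>t. B cz (\<alpha> t))" and j2: "integrable M (\<lambda>t. B (\<beta> t) cw)"
    using integrable_bounded_linear[OF B.bounded_linear_right \<alpha>] integrable_bounded_linear[OF B.bounded_linear_left \<beta>] by auto
  have "(\<lambda>t. B (Zl0 t) (\<alpha> t)) = (\<lambda>t. B (Zl t) (\<alpha> t) - B cz (\<alpha> t))"
    by (simp add: Zs B.add_left)
  with i1 j1 have j3: "integrable M (\<lambda>t. B (Zl0 t) (\<alpha> t))" by simp
  have "(\<lambda>t. B (\<beta> t) (W0 t)) = (\<lambda>t. B (\<beta> t) (W t) - B (\<beta> t) cw)"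
    by (simp add: Zs B.add_right)
  with i2 j2 have j4: "integrable M (\<lambda>t. B (\<beta> t) (W0 t))" by simp
  have "set_lebesgue_integral M {a<..x} (\<lambda>t. B (Zl t) (\<alpha> t) + B (\<beta> t) (W t))
      = (LINT t|M. (indicator {..x} t *\<^sub>R B cz (\<alpha> t) + indicator {..x} t *\<^sub>R B (Zl0 t) (\<alpha> t))
          + (indicator {..x} t *\<^sub>R B (\<beta> t) cw + indicator {..x} t *\<^sub>R B (\<beta> t) (W0 t)))"
    unfolding set_integral_atMost_eq[OF sets] Zs
    by (intro Bochner_Integration.integral_cong refl) (simp add: B.add_left B.add_right scaleR_add_right)
  also have "\<dots> = (B cz (W0 x) + (LINT t|M. indicator {..x} t *\<^sub>R B (Zl0 t) (\<alpha> t)))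
      + (B (Z0 x) cw + (LINT t|M. indicator {..x} t *\<^sub>R B (\<beta> t) (W0 t)))"
    using ind[OF j1] ind[OF j2] ind[OF j3] ind[OF j4] e1 e2 by simp
  finally show "B (Z x) (W x) = B cz cw + set_lebesgue_integral M {a<..x} (\<lambda>t. B (Zl t) (\<alpha> t) + B (\<beta> t) (W t))"
    using core by (simp add: Zs B.add_left B.add_right)
qed

section \<open>Functions of bounded variation of one variable\<close>

text \<open>
  A finite reference measure \<open>M\<close> on an interval with respect to which Lebesgue measure has the
  density \<open>l\<close>.
\<close>

locale interval_measure =
  fixes a b :: real and M :: "real measure" and l :: "real \<Rightarrow> real"
  assumes ab: "a < b" and fin: "finite_measure M" and sets: "sets M = borel_sets {a<..<b}"
    and l: "integrable M l" "\<And>x. 0 \<le> l x"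
    and leb: "restrict_space lborel {a<..<b} = density M (\<lambda>x. ennreal (l x))"
begin

abbreviation "I \<equiv> {a<..<b}"

sublocale finite_measure M by (rule fin)

lemma space_M: "space M = I" by (rule space_eq_of_sets[OF sets])

lemma sigma_finite_M: "sigma_finite_measure M" ..

lemma singleton_sets: "x \<in> I \<Longrightarrow> {x} \<in> sets M"
  by (auto simp: sets sets_restrict_space)

lemma borel_Int_sets: "A \<in> sets borel \<Longrightarrow> A \<inter> I \<in> sets M"
  by (auto simp: sets sets_restrict_space)

lemma AE_lebesgue_iff: "(AE x in lebesgue_on I. P x) \<longleftrightarrow> (AE x in M. 0 < l x \<longrightarrow> P x)"
  by (rule AE_lebesgue_on_iff_density[OF _ _ leb]) (use l in auto)

lemma density_zero_on_null_set: "A \<in> null_sets lborel \<Longrightarrow> AE x in M. x \<in> A \<longrightarrow> l x = 0"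
proof -
  assume A: "A \<in> null_sets lborel"
  then have "AE x in lborel. x \<in> I \<longrightarrow> x \<notin> A" using AE_not_in[OF A] by auto
  then have "AE x in lebesgue_on I. x \<notin> A" by (simp add: AE_lebesgue_on_iff_lborel)
  then have "AE x in M. 0 < l x \<longrightarrow> x \<notin> A" by (simp add: AE_lebesgue_iff)
  then show ?thesis by eventually_elim (metis l(2) less_eq_real_def)
qed

lemma AE_atom:
  assumes "AE x in M. P x" "x \<in> I" "measure M {x} \<noteq> 0"
  shows "P x"
proof (rule ccontr)
  assume n: "\<not> P x"
  obtain N where N: "{x \<in> space M. \<not> P x} \<subseteq> N" "N \<in> sets M" "emeasure M N = 0"
    using assms(1) by (auto elim: AE_E)
  have "{x} \<subseteq> N" using N n assms(2) by (auto simp: space_M)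
  then have "emeasure M {x} \<le> emeasure M N" using N by (intro emeasure_mono) auto
  then show False using N assms(3) measure_nonneg[of M "{x}"] by (simp add: emeasure_eq_measure)
qed

lemma set_integral_singleton:
  fixes f :: "real \<Rightarrow> 'b::euclidean_space"
  assumes "x \<in> I"
  shows "set_lebesgue_integral M {x} f = measure M {x} *\<^sub>R f x"
proof -
  have "set_lebesgue_integral M {x} f = (LINT y|M. indicator {x} y *\<^sub>R f x)"
    unfolding set_lebesgue_integral_def by (intro Bochner_Integration.integral_cong refl) (auto split: split_indicator)
  also have "\<dots> = (LINT y|M. indicator {x} y) *\<^sub>R f x"
    by (rule integral_scaleR_left) (use singleton_sets[OF assms] in \<open>simp add: emeasure_eq_measure\<close>)
  also have "\<dots> = measure M {x} *\<^sub>R f x" using singleton_sets[OF assms] assms by (simp add: space_M)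
  finally show ?thesis .
qed

lemma atom_density_zero: "x \<in> I \<Longrightarrow> measure M {x} * l x = 0"
proof -
  assume x: "x \<in> I"
  have "AE y in M. y \<in> {x} \<longrightarrow> l y = 0" by (rule density_zero_on_null_set) (simp add: null_sets_def)
  from AE_atom[OF this x] show ?thesis by auto
qed

text \<open>
  In this form the defining integral of \<open>jump_part\<close> becomes an integral against \<open>M\<close>.
\<close>

lemma set_integral_countable:
  fixes f :: "real \<Rightarrow> 'b::euclidean_space"
  assumes X: "countable X" "X \<subseteq> I" and f: "integrable M f"
  shows "set_lebesgue_integral M X f = (LINT x|count_space X. measure M {x} *\<^sub>R f x)"
proof -
  have sub: "Y \<in> sets M" if "Y \<subseteq> X" for Y
  proof -
    have "countable Y" using that X(1) countable_subset by blast
    then have "(\<Union>y\<in>Y. {y}) \<in> sets M" using that X(2) singleton_sets by (intro sets.countable_UN') auto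
    then show ?thesis by simp
  qed
  have eq: "restrict_space M X = density (count_space X) (\<lambda>x. ennreal (measure M {x}))"
  proof (rule measure_eqI_countable[OF _ _ X(1)])
    show "sets (restrict_space M X) = Pow X"
    proof (intro equalityI subsetI)
      fix Y assume "Y \<in> Pow X"
      then have "Y = X \<inter> Y" "Y \<in> sets M" using sub by auto
      then show "Y \<in> sets (restrict_space M X)" unfolding sets_restrict_space by blast
    qed (auto simp: sets_restrict_space)
    fix x assume "x \<in> X"
    then show "emeasure (restrict_space M X) {x} = emeasure (density (count_space X) (\<lambda>x. ennreal (measure M {x}))) {x}"
      using sub by (subst emeasure_restrict_space)
         (auto simp: emeasure_density nn_integral_count_space_indicator nn_integral_count_space_finite emeasure_eq_measure
           nn_integral_indicator_singleton')
  qed simp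
  have "set_lebesgue_integral M X f = (LINT x|restrict_space M X. f x)"
    unfolding set_lebesgue_integral_def using sub[of X] X(2) by (subst integral_restrict_space) (auto simp: space_M Int_absorb2)
  also have "\<dots> = (LINT x|count_space X. measure M {x} *\<^sub>R f x)"
    unfolding eq by (subst integral_density) auto
  finally show ?thesis .
qed

text \<open>
  Two representatives of a \<open>BV\<close> function may differ on a countable set; only the atoms of \<open>M\<close> in
  it matter.
\<close>

lemma AE_countable:
  assumes "countable C" "C \<subseteq> I" "\<And>x. x \<in> C \<Longrightarrow> measure M {x} \<noteq> 0 \<Longrightarrow> P x"
  shows "AE x in M. x \<in> C \<longrightarrow> P x"
proof -
  have "AE x in M. \<forall>c\<in>C. x = c \<longrightarrow> P x"
    unfolding AE_ball_countable[OF assms(1)]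
  proof
    fix c assume c: "c \<in> C"
    show "AE x in M. x = c \<longrightarrow> P x"
    proof (cases "measure M {c} = 0")
      case True
      have "AE x in M. x \<notin> {c}"
        by (rule AE_not_in) (use True c assms(2) singleton_sets in \<open>auto simp: null_sets_def emeasure_eq_measure\<close>)
      then show ?thesis by eventually_elim auto
    next
      case False
      then show ?thesis using assms(3)[OF c] by (intro AE_I2) auto
    qed
  qed
  then show ?thesis by eventually_elim auto
qed

lemma integrable_indicator_scaleR:
  fixes f :: "real \<Rightarrow> 'b::euclidean_space"
  assumes "S \<in> sets borel" "integrable M f"
  shows "integrable M (\<lambda>x. indicator S x *\<^sub>R f x)"
proof (rule Bochner_Integration.integrable_bound[OF assms(2)])
  have "(\<lambda>x. indicator S x :: real) \<in> borel_measurable M"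
    by (rule borel_measurable_on_borel_sets[OF sets]) (use assms in simp)
  then show "(\<lambda>x. indicator S x *\<^sub>R f x) \<in> borel_measurable M" using assms(2) by measurable
qed (auto split: split_indicator)

lemma measurable_M_iff:
  "(f \<in> borel_measurable M) = (f \<in> borel_measurable (restrict_space borel I))" for f :: "real \<Rightarrow> 'b::topological_space"
  by (simp add: measurable_cong_sets[of M "restrict_space borel I"] sets)

lemma borel_sets_subset_borel: "A \<in> borel_sets I \<Longrightarrow> A \<in> sets borel"
  by (auto simp: sets_restrict_space)

lemma set_integral_lebesgue:
  fixes f :: "real \<Rightarrow> 'b::euclidean_space"
  assumes f: "f \<in> borel_measurable borel" and A: "A \<in> borel_sets I"
  shows "set_lebesgue_integral (lebesgue_on I) A f = set_lebesgue_integral M A (\<lambda>x. l x *\<^sub>R f x)"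
proof -
  have "(\<lambda>x. indicator A x *\<^sub>R f x) \<in> borel_measurable borel" using f borel_sets_subset_borel[OF A] by measurable
  from integral_lebesgue_on_density(1)[OF _ sets borel_measurable_integrable[OF l(1)] l(2) leb this]
  show ?thesis unfolding set_lebesgue_integral_def by (simp add: mult.commute)
qed

lemma integrable_lebesgue_iff:
  fixes f :: "real \<Rightarrow> 'b::euclidean_space"
  assumes f: "f \<in> borel_measurable borel"
  shows "integrable (lebesgue_on I) f \<longleftrightarrow> integrable M (\<lambda>x. l x *\<^sub>R f x)"
  by (rule integral_lebesgue_on_density(2)[OF _ sets borel_measurable_integrable[OF l(1)] l(2) leb f]) simp

lemma primitive_tendsto:
  fixes g :: "real \<Rightarrow> 'b::euclidean_space"
  assumes g: "integrable M g"
  shows "((\<lambda>x. set_lebesgue_integral M {a<..x} g) \<longlongrightarrow> set_lebesgue_integral M {a<..<x} g) (at x within (S \<inter> {..<x}))"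
    and "((\<lambda>x. set_lebesgue_integral M {a<..x} g) \<longlongrightarrow> set_lebesgue_integral M {a<..x} g) (at x within (S \<inter> {x<..}))"
proof -
  have m: "(\<lambda>x. x) \<in> measurable M borel" by (rule measurable_ident_borel_sets[OF sets])
  have lim: "(\<lambda>n. set_lebesgue_integral M {a<..X n} g) \<longlonglongrightarrow> (LINT y|M. indicator T y *\<^sub>R g y)"
    if T: "T \<in> sets borel" and ev: "\<And>y. eventually (\<lambda>n. y \<le> X n \<longleftrightarrow> y \<in> T) sequentially" for X :: "nat \<Rightarrow> real" and T
    unfolding set_integral_atMost_eq[OF sets]
  proof (rule integral_dominated_convergence)
    show "AE y in M. (\<lambda>n. indicator {..X n} y *\<^sub>R g y) \<longlonglongrightarrow> indicator T y *\<^sub>R g y"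
    proof (rule AE_I2)
      fix y
      have "eventually (\<lambda>n. indicator {..X n} y *\<^sub>R g y = indicator T y *\<^sub>R g y) sequentially"
        using ev[of y] by eventually_elim (simp add: indicator_def)
      then show "(\<lambda>n. indicator {..X n} y *\<^sub>R g y) \<longlonglongrightarrow> indicator T y *\<^sub>R g y" by (rule tendsto_eventually)
    qed
    show "AE y in M. norm (indicator {..X n} y *\<^sub>R g y) \<le> norm (g y)" for n by (auto split: split_indicator)
    show "integrable M (\<lambda>y. norm (g y))" using g by simp
    have ind: "(\<lambda>y. indicator A y :: real) \<in> borel_measurable M" if "A \<in> sets borel" for A
      by (rule borel_measurable_on_borel_sets[OF sets]) (use that in simp)
    show "(\<lambda>y. indicator {..X n} y *\<^sub>R g y) \<in> borel_measurable M" for n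
      by (rule borel_measurable_scaleR[OF ind]) (use g in auto)
    show "(\<lambda>y. indicator T y *\<^sub>R g y) \<in> borel_measurable M"
      by (rule borel_measurable_scaleR[OF ind[OF T]]) (use g in auto)
  qed
  show "((\<lambda>x. set_lebesgue_integral M {a<..x} g) \<longlongrightarrow> set_lebesgue_integral M {a<..<x} g) (at x within (S \<inter> {..<x}))"
    unfolding tendsto_at_iff_sequentially
  proof (intro allI impI)
    fix X assume X: "\<forall>i. X i \<in> S \<inter> {..<x} - {x}" "X \<longlonglongrightarrow> x"
    have "(\<lambda>n. set_lebesgue_integral M {a<..X n} g) \<longlonglongrightarrow> (LINT y|M. indicator {..<x} y *\<^sub>R g y)"
    proof (rule lim)
      fix y
      show "eventually (\<lambda>n. y \<le> X n \<longleftrightarrow> y \<in> {..<x}) sequentially"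
      proof (cases "y < x")
        case True
        from order_tendstoD(1)[OF X(2) this] show ?thesis by eventually_elim (use True in auto)
      next
        case False
        have "\<not> y \<le> X n" for n using X(1) False by (auto simp: not_le intro: less_le_trans)
        then show ?thesis using False by simp
      qed
    qed simp
    then show "((\<lambda>x. set_lebesgue_integral M {a<..x} g) \<circ> X) \<longlonglongrightarrow> set_lebesgue_integral M {a<..<x} g"
      by (simp add: set_integral_atMost_eq[OF sets] comp_def)
  qed
  show "((\<lambda>x. set_lebesgue_integral M {a<..x} g) \<longlongrightarrow> set_lebesgue_integral M {a<..x} g) (at x within (S \<inter> {x<..}))"
    unfolding tendsto_at_iff_sequentially
  proof (intro allI impI)
    fix X assume X: "\<forall>i. X i \<in> S \<inter> {x<..} - {x}" "X \<longlonglongrightarrow> x"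
    have "(\<lambda>n. set_lebesgue_integral M {a<..X n} g) \<longlonglongrightarrow> (LINT y|M. indicator {..x} y *\<^sub>R g y)"
    proof (rule lim)
      fix y
      show "eventually (\<lambda>n. y \<le> X n \<longleftrightarrow> y \<in> {..x}) sequentially"
      proof (cases "x < y")
        case True
        from order_tendstoD(2)[OF X(2) this] show ?thesis by eventually_elim (use True in auto)
      next
        case False
        have "y \<le> X n" for n using X(1) False by (auto simp: not_less intro: order_trans less_imp_le)
        then show ?thesis using False by simp
      qed
    qed simp
    then show "((\<lambda>x. set_lebesgue_integral M {a<..x} g) \<circ> X) \<longlonglongrightarrow> set_lebesgue_integral M {a<..x} g"
      by (simp add: set_integral_atMost_eq[OF sets] comp_def)
  qed
qed

end

lemma AE_lebesgue_on_ex: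
  fixes a b :: real
  assumes "AE x in lebesgue_on {a<..<b}. P x" "a \<le> p" "p < q" "q \<le> b"
  shows "\<exists>x. p < x \<and> x < q \<and> P x"
proof (rule ccontr)
  assume "\<not> ?thesis"
  then have n: "\<not> P x" if "p < x" "x < q" for x using that by blast
  have "AE x in lborel. x \<in> {a<..<b} \<longrightarrow> P x"
    by (rule AE_lebesgue_on_iff_lborel[THEN iffD1, OF _ assms(1)]) simp
  then have "AE x in lborel. x \<notin> {p<..<q}" by eventually_elim (use n assms in auto)
  then have "emeasure lborel {p<..<q} = 0"
    by (subst (asm) AE_iff_measurable[of "{p<..<q}"]) auto
  then show False using assms by simp
qed

text \<open>
  A closed constraint that holds almost everywhere passes to one-sided limits, because every
  one-sided neighbourhood has positive length.
\<close>

lemma AE_limit_left: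
  fixes f :: "real \<Rightarrow> 'a::real_normed_vector"
  assumes "AE x in lebesgue_on {a<..<b}. f x \<in> C" "closed C" "a < x" "x \<le> b"
    and lim: "(f \<longlongrightarrow> v) (at x within ({a<..<b} \<inter> {..<x}))"
  shows "v \<in> C"
proof (rule ccontr)
  assume "v \<notin> C"
  then have "eventually (\<lambda>y. f y \<in> - C) (at x within ({a<..<b} \<inter> {..<x}))"
    using topological_tendstoD[OF lim, of "-C"] assms(2) by auto
  then obtain d where d: "d > 0" "\<And>y. y \<in> {a<..<b} \<inter> {..<x} \<Longrightarrow> y \<noteq> x \<Longrightarrow> dist y x < d \<Longrightarrow> f y \<notin> C"
    unfolding eventually_at by auto
  obtain y where "max a (x - d) < y" "y < x" "f y \<in> C"
    using AE_lebesgue_on_ex[OF assms(1), of "max a (x - d)" x] assms(3,4) d(1) by auto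
  then show False using d(2)[of y] assms(4) by (auto simp: dist_real_def)
qed

lemma AE_limit_right:
  fixes f :: "real \<Rightarrow> 'a::real_normed_vector"
  assumes "AE x in lebesgue_on {a<..<b}. f x \<in> C" "closed C" "a \<le> x" "x < b"
    and lim: "(f \<longlongrightarrow> v) (at x within ({a<..<b} \<inter> {x<..}))"
  shows "v \<in> C"
proof (rule ccontr)
  assume "v \<notin> C"
  then have "eventually (\<lambda>y. f y \<in> - C) (at x within ({a<..<b} \<inter> {x<..}))"
    using topological_tendstoD[OF lim, of "-C"] assms(2) by auto
  then obtain d where d: "d > 0" "\<And>y. y \<in> {a<..<b} \<inter> {x<..} \<Longrightarrow> y \<noteq> x \<Longrightarrow> dist y x < d \<Longrightarrow> f y \<notin> C"
    unfolding eventually_at by auto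
  obtain y where "x < y" "y < min b (x + d)" "f y \<in> C"
    using AE_lebesgue_on_ex[OF assms(1), of x "min b (x + d)"] assms(3,4) d(1) by auto
  then show False using d(2)[of y] assms(3) by (auto simp: dist_real_def)
qed

text \<open>
  For \<open>\<epsilon> > 0\<close> the points with \<open>|f| > \<epsilon>\<close> cannot accumulate in \<open>{a..b}\<close>, so there are finitely many.
  The limits at the end points are needed for this.
\<close>

lemma countable_nonzero_if_limits_zero:
  fixes f :: "real \<Rightarrow> 'a::real_normed_vector"
  assumes lim: "\<And>x. x \<in> {a..b} \<Longrightarrow> (f \<longlongrightarrow> 0) (at x within ({a<..<b} \<inter> {..<x}))"
    "\<And>x. x \<in> {a..b} \<Longrightarrow> (f \<longlongrightarrow> 0) (at x within ({a<..<b} \<inter> {x<..}))"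
  shows "countable {x \<in> {a<..<b}. f x \<noteq> 0}"
proof -
  have fin: "finite {x \<in> {a<..<b}. norm (f x) > 1 / (real n + 1)}" (is "finite ?E") for n :: nat
  proof (rule ccontr)
    assume "infinite ?E"
    moreover have "?E \<subseteq> {a..b}" by auto
    ultimately obtain x where x: "x \<in> {a..b}" "x islimpt ?E"
      using compact_Icc[of a b] unfolding compact_eq_Bolzano_Weierstrass by blast
    have "(f \<longlongrightarrow> 0) (at x within (({a<..<b} \<inter> {..<x}) \<union> ({a<..<b} \<inter> {x<..})))"
      unfolding at_within_union using lim[OF x(1)] by (rule filterlim_sup)
    then have "eventually (\<lambda>y. norm (f y) < 1 / (real n + 1)) (at x within (({a<..<b} \<inter> {..<x}) \<union> ({a<..<b} \<inter> {x<..})))"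
      using tendsto_norm_zero by (intro order_tendstoD(2)) (auto intro: tendsto_norm_zero)
    then obtain d where d: "d > 0"
      "\<And>y. y \<in> ({a<..<b} \<inter> {..<x}) \<union> ({a<..<b} \<inter> {x<..}) \<Longrightarrow> y \<noteq> x \<Longrightarrow> dist y x < d \<Longrightarrow> norm (f y) < 1 / (real n + 1)"
      unfolding eventually_at by auto
    obtain y where "y \<in> ?E" "y \<noteq> x" "dist y x < d" using x(2) d(1) unfolding islimpt_approachable by blast
    then show False using d(2)[of y] by force
  qed
  have "{x \<in> {a<..<b}. f x \<noteq> 0} = (\<Union>n. {x \<in> {a<..<b}. norm (f x) > 1 / (real n + 1)})"
  proof (intro equalityI subsetI)
    fix x assume x: "x \<in> {x \<in> {a<..<b}. f x \<noteq> 0}"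
    then obtain n where "inverse (real (Suc n)) < norm (f x)" using reals_Archimedean[of "norm (f x)"] by auto
    then show "x \<in> (\<Union>n. {x \<in> {a<..<b}. norm (f x) > 1 / (real n + 1)})"
      using x by (auto simp: inverse_eq_divide add.commute)
  next
    fix x assume "x \<in> (\<Union>n. {x \<in> {a<..<b}. norm (f x) > 1 / (real n + 1)})"
    then obtain n :: nat where "a < x" "x < b" "norm (f x) > 1 / (real n + 1)" by auto
    moreover have "1 / (real n + 1) > 0" by simp
    ultimately show "x \<in> {x \<in> {a<..<b}. f x \<noteq> 0}" by auto
  qed
  then show ?thesis using fin by (simp add: uncountable_infinite countable_finite)
qed

text \<open>
  A \<open>BV\<close> function \<open>w\<close> whose derivative measure has the density \<open>\<alpha>\<close>. Such a function is, up to a null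
  set, a constant plus the primitive of \<open>\<alpha> M\<close>; the right-continuous representative \<open>right_trace\<close> and
  its left limits \<open>left_trace\<close> are given by explicit integrals.
\<close>

locale bv_density = interval_measure +
  fixes w :: "real \<Rightarrow> 'a::euclidean_space" and \<alpha> :: "real \<Rightarrow> 'a"
  assumes bv: "BV {a<..<b} w" and \<alpha>: "integrable M \<alpha>"
    and Dm: "\<And>A. A \<in> borel_sets {a<..<b} \<Longrightarrow> Dm {a<..<b} w A = set_lebesgue_integral M A \<alpha>"
begin

lemma has_deriv_measure_Dm: "has_deriv_measure I w (Dm I w)"
  unfolding Dm_def using bv unfolding BV_def by (metis someI_ex)

lemma representation: "\<exists>c. AE x in lebesgue_on I. w x = c + set_lebesgue_integral M {a<..x} \<alpha>"
proof -
  let ?F = "\<lambda>x. 0 + set_lebesgue_integral M {a<..x} \<alpha>"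
  have Fm: "?F \<in> borel_measurable borel" using borel_measurable_primitive[OF sigma_finite_M sets \<alpha>] by simp
  interpret L: finite_measure "lebesgue_on I" by (rule finite_measure_lebesgue_on_Ioo)
  have Fi: "integrable (lebesgue_on I) ?F"
  proof (rule L.integrable_const_bound)
    show "AE x in lebesgue_on I. norm (?F x) \<le> (LINT x|M. norm (\<alpha> x))"
      using norm_primitive_le[OF \<alpha>] by simp
  qed (rule borel_measurable_lebesgue_on[OF Fm])
  have wi: "integrable (lebesgue_on I) w" using bv by (simp add: BV_def)
  have "\<exists>c. AE x in lebesgue_on I. w x - ?F x = c"
  proof (rule du_bois_reymond[OF ab])
    show "integrable (lebesgue_on I) (\<lambda>x. w x - ?F x)" using wi Fi by simp
    fix \<phi> assume \<phi>: "\<phi> \<in> C1_c I"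
    note D\<phi> = C1_c_deriv[OF \<phi> ab]
    obtain B where B: "\<And>x. \<bar>deriv \<phi> x\<bar> \<le> B" using D\<phi>(3) by blast
    have iw: "integrable (lebesgue_on I) (\<lambda>x. deriv \<phi> x *\<^sub>R w x)"
    proof (rule Bochner_Integration.integrable_bound[of _ "\<lambda>x. B *\<^sub>R w x"])
      have "deriv \<phi> \<in> borel_measurable (lebesgue_on I)"
        by (intro borel_measurable_lebesgue_on borel_measurable_continuous_onI D\<phi>(2))
      then show "(\<lambda>x. deriv \<phi> x *\<^sub>R w x) \<in> borel_measurable (lebesgue_on I)" using wi by measurable
      show "AE x in lebesgue_on I. norm (deriv \<phi> x *\<^sub>R w x) \<le> norm (B *\<^sub>R w x)"
      proof (rule AE_I2)
        fix x show "norm (deriv \<phi> x *\<^sub>R w x) \<le> norm (B *\<^sub>R w x)"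
          using mult_right_mono[OF order_trans[OF B[of x] abs_ge_self] norm_ge_zero[of "w x"]] by simp
      qed
    qed (use wi in auto)
    have \<phi>m: "\<phi> \<in> borel_measurable M"
    proof (rule borel_measurable_on_borel_sets[OF sets])
      have "continuous_on UNIV \<phi>" by (rule DERIV_continuous_on) (rule D\<phi>(1))
      then show "\<phi> \<in> borel_measurable borel" by (rule borel_measurable_continuous_onI)
    qed
    note T = integral_test_deriv_primitive[OF ab sigma_finite_M sets \<alpha> \<phi>, of 0]
    have "(LINT x|lebesgue_on I. deriv \<phi> x *\<^sub>R w x)
        = - (LINT x|total_variation I (Dm I w). \<phi> x *\<^sub>R polar I (Dm I w) x)"
      using has_deriv_measure_Dm \<phi> unfolding has_deriv_measure_def by blast
    also have "(LINT x|total_variation I (Dm I w). \<phi> x *\<^sub>R polar I (Dm I w) x) = (LINT x|M. \<phi> x *\<^sub>R \<alpha> x)"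
      by (rule integral_polar_density[OF fin sets \<alpha> Dm \<phi>m])
    finally show "(LINT x|lebesgue_on I. deriv \<phi> x *\<^sub>R (w x - ?F x)) = 0"
      using iw T by (simp add: scaleR_diff_right)
  qed
  then obtain c where "AE x in lebesgue_on I. w x - ?F x = c" ..
  then have "AE x in lebesgue_on I. w x = c + set_lebesgue_integral M {a<..x} \<alpha>"
    by eventually_elim (simp add: algebra_simps)
  then show ?thesis ..
qed

definition "base_value = (SOME c. AE x in lebesgue_on I. w x = c + set_lebesgue_integral M {a<..x} \<alpha>)"
definition "right_trace x = base_value + set_lebesgue_integral M {a<..x} \<alpha>"
definition "left_trace x = base_value + set_lebesgue_integral M {a<..<x} \<alpha>"

lemma eq_right_trace: "AE x in lebesgue_on I. w x = right_trace x"
  unfolding right_trace_def base_value_def by (rule someI_ex[OF representation])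

lemma right_trace_measurable: "right_trace \<in> borel_measurable borel" and left_trace_measurable: "left_trace \<in> borel_measurable borel"
  unfolding right_trace_def[abs_def] left_trace_def[abs_def]
  using borel_measurable_primitive[OF sigma_finite_M sets \<alpha>] by auto

lemma right_trace_tendsto:
  "(right_trace \<longlongrightarrow> left_trace x) (at x within (S \<inter> {..<x}))" "(right_trace \<longlongrightarrow> right_trace x) (at x within (S \<inter> {x<..}))"
  unfolding right_trace_def[abs_def] left_trace_def by (intro tendsto_add tendsto_const primitive_tendsto[OF \<alpha>])+

lemma good_rep_right_trace: "good_rep I w right_trace"
  unfolding good_rep_def
proof (intro conjI ballI)
  show "AE x in lebesgue_on I. right_trace x = w x" using eq_right_trace by eventually_elim simp
qed (use right_trace_tendsto in blast)+

lemma good_rep_rep: "good_rep I w (rep I w)"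
  unfolding rep_def by (rule someI[of "good_rep I w", OF good_rep_right_trace])

lemma rep_eq_ae: "AE x in lebesgue_on I. rep I w x - right_trace x \<in> {0}"
proof -
  have "AE x in lebesgue_on I. rep I w x = w x" using good_rep_rep by (simp add: good_rep_def)
  with eq_right_trace show ?thesis by eventually_elim simp
qed

lemma closure_I: "closure I = {a..b}" using ab by (simp add: closure_greaterThanLessThan)

lemma rep_tendsto_left:
  assumes "x \<in> {a<..b}"
  shows "(rep I w \<longlongrightarrow> left_trace x) (at x within (I \<inter> {..<x}))"
proof -
  obtain v where v: "(rep I w \<longlongrightarrow> v) (at x within (I \<inter> {..<x}))"
    using good_rep_rep assms unfolding good_rep_def closure_I by force
  have "v - left_trace x \<in> {0}"
    by (rule AE_limit_left[OF rep_eq_ae _ _ _ tendsto_diff[OF v right_trace_tendsto(1)]]) (use assms in auto)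
  then show ?thesis using v by simp
qed

lemma rep_tendsto_right:
  assumes "x \<in> {a..<b}"
  shows "(rep I w \<longlongrightarrow> right_trace x) (at x within (I \<inter> {x<..}))"
proof -
  obtain v where v: "(rep I w \<longlongrightarrow> v) (at x within (I \<inter> {x<..}))"
    using good_rep_rep assms unfolding good_rep_def closure_I by force
  have "v - right_trace x \<in> {0}"
    by (rule AE_limit_right[OF rep_eq_ae _ _ _ tendsto_diff[OF v right_trace_tendsto(2)]]) (use assms in auto)
  then show ?thesis using v by simp
qed

lemma at_left_nontrivial: "x \<in> {a<..b} \<Longrightarrow> at x within (I \<inter> {..<x}) \<noteq> bot"
proof -
  assume x: "x \<in> {a<..b}"
  have "x islimpt {a<..<x}" using x by (simp add: islimpt_greaterThanLessThan2)
  moreover have "I \<inter> {..<x} = {a<..<x}" using x by auto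
  ultimately show ?thesis by (simp add: trivial_limit_within)
qed

lemma at_right_nontrivial: "x \<in> {a..<b} \<Longrightarrow> at x within (I \<inter> {x<..}) \<noteq> bot"
proof -
  assume x: "x \<in> {a..<b}"
  have "x islimpt {x<..<b}" using x by (simp add: islimpt_greaterThanLessThan1)
  moreover have "I \<inter> {x<..} = {x<..<b}" using x by auto
  ultimately show ?thesis by (simp add: trivial_limit_within)
qed

lemma trL_eq: "x \<in> I \<Longrightarrow> trL I w x = left_trace x"
  unfolding trL_def by (rule tendsto_Lim[OF at_left_nontrivial rep_tendsto_left]) auto

lemma trR_eq: "x \<in> I \<Longrightarrow> trR I w x = right_trace x"
  unfolding trR_def by (rule tendsto_Lim[OF at_right_nontrivial rep_tendsto_right]) auto

text \<open>
  The representative chosen by \<open>rep\<close> has the same one-sided limits as \<open>right_trace\<close> at every point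
  of the closed interval.
\<close>

lemma countable_rep_neq: "countable {x \<in> I. rep I w x \<noteq> right_trace x}"
proof -
  have "((\<lambda>x. rep I w x - right_trace x) \<longlongrightarrow> 0) (at x within (I \<inter> {..<x}))" if x: "x \<in> {a..b}" for x
  proof (cases "x = a")
    case True
    then have "I \<inter> {..<x} = {}" by auto
    then show ?thesis by simp
  next
    case False
    then show ?thesis using tendsto_diff[OF rep_tendsto_left[of x] right_trace_tendsto(1)[of x I]] x by simp
  qed
  moreover have "((\<lambda>x. rep I w x - right_trace x) \<longlongrightarrow> 0) (at x within (I \<inter> {x<..}))" if x: "x \<in> {a..b}" for x
  proof (cases "x = b")
    case True
    then have "I \<inter> {x<..} = {}" by auto
    then show ?thesis by simp
  next
    case False
    then show ?thesis using tendsto_diff[OF rep_tendsto_right[of x] right_trace_tendsto(2)[of x I]] x by simp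
  qed
  ultimately have "countable {x \<in> {a<..<b}. rep I w x - right_trace x \<noteq> 0}" by (rule countable_nonzero_if_limits_zero)
  then show ?thesis by simp
qed

lemma traces_in_closed:
  assumes "AE x in lebesgue_on I. w x \<in> C" "closed C" "x \<in> I"
  shows "left_trace x \<in> C" "right_trace x \<in> C"
proof -
  have "AE x in lebesgue_on I. right_trace x \<in> C" using assms(1) eq_right_trace by eventually_elim simp
  then show "left_trace x \<in> C" "right_trace x \<in> C"
    using AE_limit_left[OF _ assms(2) _ _ right_trace_tendsto(1), of a b x]
      AE_limit_right[OF _ assms(2) _ _ right_trace_tendsto(2), of a b x] assms(3) by auto
qed

lemma jump: "x \<in> I \<Longrightarrow> right_trace x - left_trace x = measure M {x} *\<^sub>R \<alpha> x"
proof -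
  assume x: "x \<in> I"
  have int: "set_integrable M A \<alpha>" if "A \<in> sets M" for A
    unfolding set_integrable_def by (rule integrable_mult_indicator[OF that \<alpha>])
  have "{..<x} \<inter> I = {a<..<x}" using x by auto
  with borel_Int_sets[of "{..<x}"] have A: "{a<..<x} \<in> sets M" by simp
  have "{a<..x} = {a<..<x} \<union> {x}" using x by auto
  moreover have "set_lebesgue_integral M ({a<..<x} \<union> {x}) \<alpha> = set_lebesgue_integral M {a<..<x} \<alpha> + set_lebesgue_integral M {x} \<alpha>"
    by (rule set_integral_Un[OF _ int[OF A] int[OF singleton_sets[OF x]]]) simp
  ultimately show ?thesis using set_integral_singleton[OF x, of \<alpha>] by (simp add: right_trace_def left_trace_def)
qed

lemma jump_set_eq: "jump_set I w = {x \<in> I. measure M {x} *\<^sub>R \<alpha> x \<noteq> 0}"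
proof -
  have "trL I w x \<noteq> trR I w x \<longleftrightarrow> measure M {x} *\<^sub>R \<alpha> x \<noteq> 0" if "x \<in> I" for x
    unfolding trL_eq[OF that] trR_eq[OF that] jump[OF that, symmetric] by auto
  then show ?thesis unfolding jump_set_def by blast
qed

lemma countable_jump_set: "countable (jump_set I w)"
  by (rule countable_subset[OF _ countable_support]) (auto simp: jump_set_eq)

lemma jump_set_borel: "jump_set I w \<in> sets borel"
  by (rule sets.countable[OF _ countable_jump_set]) simp

lemma jump_set_sub: "jump_set I w \<subseteq> I" by (auto simp: jump_set_def)

lemma jump_part_eq:
  assumes A: "A \<in> borel_sets I"
  shows "jump_part I w A = set_lebesgue_integral M A (\<lambda>x. indicator (jump_set I w) x *\<^sub>R \<alpha> x)"
proof -
  let ?X = "A \<inter> jump_set I w"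
  have X: "countable ?X" "?X \<subseteq> I" using countable_jump_set jump_set_sub by auto
  have "jump_part I w A = (LINT x|count_space ?X. measure M {x} *\<^sub>R \<alpha> x)"
    unfolding jump_part_def
  proof (intro Bochner_Integration.integral_cong refl)
    fix x assume "x \<in> space (count_space ?X)"
    then have "x \<in> I" using X(2) by auto
    then show "trR I w x - trL I w x = measure M {x} *\<^sub>R \<alpha> x" by (simp add: trL_eq trR_eq jump)
  qed
  also have "\<dots> = set_lebesgue_integral M ?X \<alpha>" by (rule set_integral_countable[OF X \<alpha>, symmetric])
  also have "\<dots> = set_lebesgue_integral M A (\<lambda>x. indicator (jump_set I w) x *\<^sub>R \<alpha> x)"
    unfolding set_lebesgue_integral_def by (simp add: indicator_inter_arith)
  finally show ?thesis .
qed

lemma total_variation_Dm: "total_variation I (Dm I w) = density M (\<lambda>x. ennreal (norm (\<alpha> x)))"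
  by (rule total_variation_density[OF fin sets \<alpha> Dm])

lemma polar_Dm:
  "polar I (Dm I w) \<in> borel_measurable M" "AE x in M. norm (\<alpha> x) *\<^sub>R polar I (Dm I w) x = \<alpha> x"
  using polar_density[OF fin sets \<alpha> Dm] by auto

text \<open>
  Removing the jumps from the derivative means restricting its density to the complement of the
  jump set.
\<close>

lemma AE_diffuse_iff:
  "(AE x in total_variation I (diffuse_part I w). P x) \<longleftrightarrow>
   (AE x in M. x \<notin> jump_set I w \<longrightarrow> \<alpha> x \<noteq> 0 \<longrightarrow> P x)"
proof -
  let ?g = "\<lambda>x. indicator (- jump_set I w) x *\<^sub>R \<alpha> x"
  have g: "integrable M ?g" using integrable_indicator_scaleR[OF _ \<alpha>] jump_set_borel by auto
  have "total_variation I (diffuse_part I w) = density M (\<lambda>x. ennreal (norm (?g x)))"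
  proof (rule total_variation_density[OF fin sets g])
    fix A assume A: "A \<in> borel_sets I"
    have "diffuse_part I w A = set_lebesgue_integral M A \<alpha> - set_lebesgue_integral M A (\<lambda>x. indicator (jump_set I w) x *\<^sub>R \<alpha> x)"
      using Dm[OF A] jump_part_eq[OF A] by (simp add: diffuse_part_def)
    also have "\<dots> = set_lebesgue_integral M A (\<lambda>x. \<alpha> x - indicator (jump_set I w) x *\<^sub>R \<alpha> x)"
    proof (rule set_integral_diff(2)[symmetric]; unfold set_integrable_def)
      show "integrable M (\<lambda>x. indicator A x *\<^sub>R \<alpha> x)"
        using A sets by (intro integrable_mult_indicator \<alpha>) simp
      show "integrable M (\<lambda>x. indicator A x *\<^sub>R indicator (jump_set I w) x *\<^sub>R \<alpha> x)"
        using A sets by (intro integrable_mult_indicator integrable_indicator_scaleR[OF jump_set_borel \<alpha>]) simp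
    qed
    also have "(\<lambda>x. \<alpha> x - indicator (jump_set I w) x *\<^sub>R \<alpha> x) = ?g"
      by (auto simp: fun_eq_iff split: split_indicator)
    finally show "diffuse_part I w A = set_lebesgue_integral M A ?g" .
  qed
  note eq = this
  have m: "(\<lambda>x. ennreal (norm (?g x))) \<in> borel_measurable M" using g by measurable
  have "(AE x in total_variation I (diffuse_part I w). P x) \<longleftrightarrow> (AE x in M. 0 < ennreal (norm (?g x)) \<longrightarrow> P x)"
    unfolding eq by (rule AE_density[OF m])
  also have "\<dots> \<longleftrightarrow> (AE x in M. x \<notin> jump_set I w \<longrightarrow> \<alpha> x \<noteq> 0 \<longrightarrow> P x)"
    by (rule AE_cong) (auto simp: ennreal_less_zero_iff split: split_indicator)
  finally show ?thesis .
qed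

text \<open>
  On \<open>{l > 0}\<close> the absolutely continuous part has density \<open>\<alpha> / l\<close> with respect to Lebesgue measure, and
  \<open>{l = 0}\<close> is a Lebesgue null set that carries the rest. There \<open>1 / l = 0\<close>, so that no case
  distinction is required in the definition of the density.
\<close>

lemma has_ac_density_ac_deriv: "has_ac_density I (Dm I w) (ac_deriv I w)"
proof -
  define A0 where "A0 x = indicator I x *\<^sub>R \<alpha> x" for x
  define L0 where "L0 x = indicator I x *\<^sub>R l x" for x
  have A0m [measurable]: "A0 \<in> borel_measurable borel"
    using borel_measurable_integrable[OF \<alpha>] unfolding measurable_M_iff A0_def[abs_def]
    by (subst (asm) borel_measurable_restrict_space_iff) auto
  have L0m [measurable]: "L0 \<in> borel_measurable borel"
    using borel_measurable_integrable[OF l(1)] unfolding measurable_M_iff L0_def[abs_def]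
    by (subst (asm) borel_measurable_restrict_space_iff) auto
  define f where "f x = (1 / L0 x) *\<^sub>R A0 x" for x
  define S where "S = {x \<in> I. L0 x = 0}"
  have fm: "f \<in> borel_measurable borel" unfolding f_def[abs_def] by measurable
  have Sm: "S \<in> sets borel" unfolding S_def by measurable
  have lf: "l x *\<^sub>R f x = (if x \<in> S then 0 else \<alpha> x)" if "x \<in> I" for x
    using that by (auto simp: f_def S_def L0_def A0_def)
  have "AE x in lebesgue_on I. x \<notin> S"
    unfolding AE_lebesgue_iff by (rule AE_I2) (auto simp: S_def L0_def)
  then have "AE x in lborel. x \<notin> S"
    unfolding AE_lebesgue_on_iff_lborel[OF borel_open[OF open_greaterThanLessThan]]
    by eventually_elim (auto simp: S_def)
  then have S0: "S \<in> null_sets lborel" using Sm by (subst AE_iff_null_sets) auto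
  have "has_ac_density I (Dm I w) f" unfolding has_ac_density_def
  proof (intro conjI bexI ballI impI)
    show "integrable (lebesgue_on I) f" unfolding integrable_lebesgue_iff[OF fm]
    proof (rule Bochner_Integration.integrable_bound[OF \<alpha>])
      have "f \<in> borel_measurable M" by (rule borel_measurable_on_borel_sets[OF sets fm])
      then show "(\<lambda>x. l x *\<^sub>R f x) \<in> borel_measurable M" using l(1) by measurable
      show "AE x in M. norm (l x *\<^sub>R f x) \<le> norm (\<alpha> x)"
        by (rule AE_I2) (use lf in \<open>auto simp: space_M\<close>)
    qed
    show "S \<in> null_sets lborel" by (rule S0)
    fix A assume A: "A \<in> borel_sets I" "A \<inter> S = {}"
    show "Dm I w A = set_lebesgue_integral (lebesgue_on I) A f"
    proof -
      have "indicator A x *\<^sub>R \<alpha> x = indicator A x *\<^sub>R l x *\<^sub>R f x" if "x \<in> space M" for x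
        using lf[of x] A(2) that by (cases "x \<in> A") (auto simp: space_M)
      then show ?thesis
        unfolding Dm[OF A(1)] set_integral_lebesgue[OF fm A(1)] unfolding set_lebesgue_integral_def
        by (rule Bochner_Integration.integral_cong[OF refl])
    qed
  qed
  then show ?thesis unfolding ac_deriv_def ac_density_def by (rule someI[of "has_ac_density I (Dm I w)"])
qed

text \<open>
  The exceptional set \<open>S\<close> of the Lebesgue decomposition contains every jump point: an atom off \<open>S\<close>
  would have \<open>\<alpha> = l f = 0\<close>. Therefore the Cantor part has the density \<open>\<alpha>\<close> on \<open>S\<close> minus the jump set.
\<close>

lemma lebesgue_decomposition:
  obtains f S where "f \<in> borel_measurable borel" "S \<in> sets borel"
    "AE x in lebesgue_on I. ac_deriv I w x = f x"
    "AE x in M. x \<notin> S \<longrightarrow> \<alpha> x = l x *\<^sub>R f x"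
    "AE x in M. x \<in> S \<longrightarrow> l x = 0"
    "\<And>A. A \<in> borel_sets I \<Longrightarrow>
       cantor_part I w A = set_lebesgue_integral M A (\<lambda>x. indicator (S - jump_set I w) x *\<^sub>R \<alpha> x)"
proof -
  obtain S where S: "S \<in> null_sets lborel"
    and SA: "\<And>A. A \<in> borel_sets I \<Longrightarrow> A \<inter> S = {} \<Longrightarrow> Dm I w A = set_lebesgue_integral (lebesgue_on I) A (ac_deriv I w)"
    and ai: "integrable (lebesgue_on I) (ac_deriv I w)"
    using has_ac_density_ac_deriv unfolding has_ac_density_def by blast
  have Sm: "S \<in> sets borel" using S by auto
  obtain f where fm: "f \<in> borel_measurable borel" and f: "AE x in lebesgue_on I. ac_deriv I w x = f x"
    using lebesgue_on_borel_version[OF borel_open[OF open_greaterThanLessThan] borel_measurable_integrable[OF ai]] by blast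
  have fi: "integrable M (\<lambda>x. l x *\<^sub>R f x)"
  proof -
    have "integrable (lebesgue_on I) f"
      by (rule integrable_cong_AE_imp[OF ai borel_measurable_lebesgue_on[OF fm]]) (use f in eventually_elim, simp)
    then show ?thesis by (simp add: integrable_lebesgue_iff[OF fm])
  qed
  have int_eq: "set_lebesgue_integral (lebesgue_on I) A (ac_deriv I w) = set_lebesgue_integral M A (\<lambda>x. l x *\<^sub>R f x)"
    if A: "A \<in> borel_sets I" for A
  proof -
    have im: "(\<lambda>x. indicator A x :: real) \<in> borel_measurable (lebesgue_on I)"
      by (rule borel_measurable_lebesgue_on) (use borel_sets_subset_borel[OF A] in simp)
    have "set_lebesgue_integral (lebesgue_on I) A (ac_deriv I w) = set_lebesgue_integral (lebesgue_on I) A f"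
      unfolding set_lebesgue_integral_def
    proof (rule integral_cong_AE)
      show "(\<lambda>x. indicator A x *\<^sub>R ac_deriv I w x) \<in> borel_measurable (lebesgue_on I)" using im ai by measurable
      show "(\<lambda>x. indicator A x *\<^sub>R f x) \<in> borel_measurable (lebesgue_on I)"
        using im borel_measurable_lebesgue_on[OF fm] by measurable
      show "AE x in lebesgue_on I. indicator A x *\<^sub>R ac_deriv I w x = indicator A x *\<^sub>R f x"
        using f by eventually_elim simp
    qed
    then show ?thesis using set_integral_lebesgue[OF fm A] by simp
  qed
  have off: "AE x in M. indicator (- S) x *\<^sub>R \<alpha> x = indicator (- S) x *\<^sub>R l x *\<^sub>R f x"
  proof (rule density_unique_banach)
    show "integrable M (\<lambda>x. indicator (- S) x *\<^sub>R \<alpha> x)" "integrable M (\<lambda>x. indicator (- S) x *\<^sub>R l x *\<^sub>R f x)"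
      using Sm by (intro integrable_indicator_scaleR \<alpha> fi; simp)+
    fix A assume "A \<in> sets M"
    then have "A \<inter> (- S \<inter> I) \<in> sets M" "A \<subseteq> I"
      using borel_Int_sets[of "- S"] Sm sets.sets_into_space[of A M] by (auto simp: space_M)
    moreover from this(2) have "A \<inter> (- S \<inter> I) = A - S" by blast
    ultimately have AS: "A - S \<in> borel_sets I" using sets by simp
    then have "set_lebesgue_integral M (A - S) \<alpha> = set_lebesgue_integral M (A - S) (\<lambda>x. l x *\<^sub>R f x)"
      using SA[OF AS] Dm[OF AS] int_eq[OF AS] by auto
    moreover have e: "indicator A x *\<^sub>R indicator (- S) x *\<^sub>R g = indicator (A - S) x *\<^sub>R g" for x and g :: 'a
      by (auto split: split_indicator)
    ultimately show "(LINT x:A|M. indicator (- S) x *\<^sub>R \<alpha> x) = (LINT x:A|M. indicator (- S) x *\<^sub>R l x *\<^sub>R f x)"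
      unfolding set_lebesgue_integral_def e by simp
  qed
  have off': "AE x in M. x \<notin> S \<longrightarrow> \<alpha> x = l x *\<^sub>R f x" using off by eventually_elim auto
  have on: "AE x in M. x \<in> S \<longrightarrow> l x = 0" by (rule density_zero_on_null_set[OF S])
  let ?J = "jump_set I w"
  have JS: "x \<in> S" if "x \<in> ?J" for x
  proof (rule ccontr)
    assume "x \<notin> S"
    have x: "x \<in> I" "measure M {x} \<noteq> 0" "\<alpha> x \<noteq> 0" using that by (auto simp: jump_set_eq)
    have "\<alpha> x = l x *\<^sub>R f x" using AE_atom[OF off' x(1,2)] \<open>x \<notin> S\<close> by simp
    moreover have "l x = 0" using atom_density_zero[OF x(1)] x(2) by simp
    ultimately show False using x(3) by simp
  qed
  show thesis
  proof (rule that[OF fm Sm f off' on])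
    fix A assume A: "A \<in> borel_sets I"
    let ?i = "\<lambda>g :: real \<Rightarrow> 'a. set_lebesgue_integral M A g"
    have AM: "A \<in> sets M" using A sets by simp
    note im = integrable_mult_indicator[OF AM]
    have iJ: "integrable M (\<lambda>x. indicator ?J x *\<^sub>R \<alpha> x)" by (rule integrable_indicator_scaleR[OF jump_set_borel \<alpha>])
    have "cantor_part I w A = ?i \<alpha> - ?i (\<lambda>x. l x *\<^sub>R f x) - ?i (\<lambda>x. indicator ?J x *\<^sub>R \<alpha> x)"
      unfolding cantor_part_def int_eq[OF A] Dm[OF A] jump_part_eq[OF A] ..
    also have "\<dots> = (LINT x|M. indicator A x *\<^sub>R \<alpha> x - indicator A x *\<^sub>R l x *\<^sub>R f x - indicator A x *\<^sub>R indicator ?J x *\<^sub>R \<alpha> x)"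
      unfolding set_lebesgue_integral_def
      using im[OF \<alpha>] im[OF fi] im[OF iJ] by simp
    also have "\<dots> = (LINT x|M. indicator A x *\<^sub>R indicator (S - ?J) x *\<^sub>R \<alpha> x)"
    proof (rule integral_cong_AE)
      show "(\<lambda>x. indicator A x *\<^sub>R \<alpha> x - indicator A x *\<^sub>R l x *\<^sub>R f x - indicator A x *\<^sub>R indicator ?J x *\<^sub>R \<alpha> x) \<in> borel_measurable M"
        using im[OF \<alpha>] im[OF fi] im[OF iJ] by (intro borel_measurable_diff) auto
      show "(\<lambda>x. indicator A x *\<^sub>R indicator (S - ?J) x *\<^sub>R \<alpha> x) \<in> borel_measurable M"
        using im[OF integrable_indicator_scaleR[OF _ \<alpha>], of "S - ?J"] Sm jump_set_borel by auto
      show "AE x in M. indicator A x *\<^sub>R \<alpha> x - indicator A x *\<^sub>R l x *\<^sub>R f x - indicator A x *\<^sub>R indicator ?J x *\<^sub>R \<alpha> x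
          = indicator A x *\<^sub>R indicator (S - ?J) x *\<^sub>R \<alpha> x"
        using off' on
      proof eventually_elim
        case (elim x)
        then show ?case using JS[of x] by (cases "x \<in> S"; cases "x \<in> ?J") (auto simp: scaleR_diff_right)
      qed
    qed
    finally show "cantor_part I w A = ?i (\<lambda>x. indicator (S - ?J) x *\<^sub>R \<alpha> x)"
      unfolding set_lebesgue_integral_def .
  qed
qed

end

section \<open>Geodesics on the sphere\<close>

text \<open>
  The initial velocity of the unit speed geodesic from \<open>p\<close> to \<open>q\<close>. Thus \<open>T\<^sup>- = geodesic_dir p q\<close> and
  \<open>T\<^sup>+ = - geodesic_dir q p\<close> at a jump from \<open>p\<close> to \<open>q\<close>.
\<close>

definition geodesic_dir :: "'a::euclidean_space \<Rightarrow> 'a \<Rightarrow> 'a" where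
  "geodesic_dir p q = (1 / sqrt (1 - (p \<bullet> q)\<^sup>2)) *\<^sub>R (q - (p \<bullet> q) *\<^sub>R p)"

lemma unit_inner_le: "norm (p::'a::euclidean_space) = 1 \<Longrightarrow> norm q = 1 \<Longrightarrow> \<bar>p \<bullet> q\<bar> \<le> 1"
  using Cauchy_Schwarz_ineq2[of p q] by simp

lemma unit_inner_less_1: "norm (p::'a::euclidean_space) = 1 \<Longrightarrow> norm q = 1 \<Longrightarrow> p \<noteq> q \<Longrightarrow> p \<bullet> q < 1"
proof -
  assume a: "norm p = 1" "norm q = 1" "p \<noteq> q"
  have "0 < (norm (p - q))\<^sup>2" using a by simp
  also have "\<dots> = 2 - 2 * (p \<bullet> q)"
    using a by (simp add: power2_norm_eq_inner inner_diff inner_commute norm_eq_1)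
  finally show ?thesis by simp
qed

lemma inner_self_unit: "norm (p::'a::euclidean_space) = 1 \<Longrightarrow> p \<bullet> p = 1"
  by (simp add: norm_eq_1)

lemma geodesic_dir_tangent: "norm p = 1 \<Longrightarrow> p \<bullet> geodesic_dir p q = 0"
  by (simp add: geodesic_dir_def inner_diff_right inner_self_unit)

lemma norm_geodesic_dir:
  assumes "norm p = 1" "norm q = 1" "\<bar>p \<bullet> q\<bar> < 1"
  shows "norm (geodesic_dir p q) = 1"
proof -
  have s: "0 < 1 - (p \<bullet> q)\<^sup>2" using assms(3) by (simp add: abs_square_less_1)
  have "(norm (q - (p \<bullet> q) *\<^sub>R p))\<^sup>2 = 1 - (p \<bullet> q)\<^sup>2"
    unfolding power2_norm_eq_inner using assms
    by (simp add: inner_diff inner_commute inner_self_unit power2_eq_square)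
  then have "norm (q - (p \<bullet> q) *\<^sub>R p) = sqrt (1 - (p \<bullet> q)\<^sup>2)" by (metis norm_ge_zero real_sqrt_abs abs_of_nonneg)
  then show ?thesis using s by (simp add: geodesic_dir_def)
qed

lemma great_circle_geodesic_dir:
  assumes "norm p = 1" "norm q = 1" "\<bar>p \<bullet> q\<bar> < 1"
  shows "q = cos (arccos (p \<bullet> q)) *\<^sub>R p + sin (arccos (p \<bullet> q)) *\<^sub>R geodesic_dir p q"
proof -
  have s: "0 < 1 - (p \<bullet> q)\<^sup>2" using assms(3) by (simp add: abs_square_less_1)
  have "sin (arccos (p \<bullet> q)) = sqrt (1 - (p \<bullet> q)\<^sup>2)" using assms(3) by (intro sin_arccos) auto
  then show ?thesis using s assms(3) by (simp add: geodesic_dir_def cos_arccos)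
qed

lemma curve_length_great_circle:
  fixes p e :: "'a::euclidean_space"
  assumes "norm p = 1" "norm e = 1" "p \<bullet> e = 0" "0 \<le> \<theta>"
  shows "geodesic_dist p (cos \<theta> *\<^sub>R p + sin \<theta> *\<^sub>R e) \<le> ennreal \<theta>"
proof -
  define \<gamma> where "\<gamma> t = cos (t * \<theta>) *\<^sub>R p + sin (t * \<theta>) *\<^sub>R e" for t
  define D where "D t = (- sin (t * \<theta>) * \<theta>) *\<^sub>R p + (cos (t * \<theta>) * \<theta>) *\<^sub>R e" for t
  have D: "(\<gamma> has_vector_derivative D t) (at t within S)" for t S
    unfolding \<gamma>_def D_def has_vector_derivative_def
    by (auto intro!: derivative_eq_intros simp: algebra_simps fun_eq_iff)
  have vp: "valid_path \<gamma>"
  proof -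
    have "\<gamma> C1_differentiable_on {0..1}" unfolding C1_differentiable_on_def
      by (rule exI[of _ D]) (use D in \<open>auto simp: D_def intro!: continuous_intros\<close>)
    then show ?thesis by (simp add: valid_path_def C1_differentiable_imp_piecewise)
  qed
  have nrm: "norm (x *\<^sub>R p + y *\<^sub>R e) = sqrt (x\<^sup>2 + y\<^sup>2)" for x y
    using assms by (simp add: norm_eq_sqrt_inner inner_add inner_commute inner_self_unit power2_eq_square)
  have im: "path_image \<gamma> \<subseteq> sphere 0 1" unfolding path_image_def \<gamma>_def by (auto simp: nrm)
  have nD: "norm (D t) = \<theta>" for t
  proof -
    have "(- sin (t * \<theta>) * \<theta>)\<^sup>2 + (cos (t * \<theta>) * \<theta>)\<^sup>2 = ((sin (t * \<theta>))\<^sup>2 + (cos (t * \<theta>))\<^sup>2) * \<theta>\<^sup>2"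
      by (simp only: power_mult_distrib power2_minus distrib_right)
    also have "\<dots> = \<theta>\<^sup>2" by (simp only: sin_cos_squared_add mult_1_left)
    finally show ?thesis unfolding D_def nrm using assms(4) by simp
  qed
  have "vector_derivative \<gamma> (at t within {0..1}) = D t" if "t \<in> {0..1}" for t
    using that by (intro vector_derivative_within_cbox[of 0 1, simplified] D) auto
  then have "curve_length \<gamma> = (\<integral>\<^sup>+(t::real). ennreal \<theta> * indicator {0..1} t \<partial>lebesgue)"
    unfolding curve_length_def by (intro nn_integral_cong) (auto simp: nD split: split_indicator)
  also have "\<dots> = ennreal \<theta>" by (subst nn_integral_cmult_indicator) auto
  finally have len: "curve_length \<gamma> = ennreal \<theta>" .
  have "geodesic_dist p (cos \<theta> *\<^sub>R p + sin \<theta> *\<^sub>R e) \<le> curve_length \<gamma>"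
    unfolding geodesic_dist_def by (rule INF_lower) (use vp im in \<open>auto simp: pathstart_def pathfinish_def \<gamma>_def\<close>)
  with len show ?thesis by simp
qed

text \<open>
  The angle between \<open>p\<close> and \<open>\<gamma> t\<close> grows at most at the speed of \<open>\<gamma>\<close>. As \<open>arccos\<close> is not differentiable
  at \<open>1\<close> and \<open>- 1\<close>, the estimate is made for \<open>arccos (r * (p \<bullet> \<gamma> t))\<close> with \<open>r < 1\<close>, and then \<open>r\<close> tends
  to \<open>1\<close>.
\<close>

lemma arccos_le_curve_length:
  fixes p q :: "'a::euclidean_space"
  assumes p: "norm p = 1" and \<gamma>: "valid_path \<gamma>" "path_image \<gamma> \<subseteq> sphere 0 1" "pathstart \<gamma> = p" "pathfinish \<gamma> = q"
  shows "ennreal (arccos (p \<bullet> q)) \<le> curve_length \<gamma>"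
proof (cases "curve_length \<gamma> = top")
  case False
  obtain S D where cont: "continuous_on {0..1} \<gamma>" and S: "finite S"
    and D: "\<And>x. x \<in> {0..1} - S \<Longrightarrow> (\<gamma> has_vector_derivative D x) (at x)" "continuous_on ({0..1} - S) D"
    using \<gamma>(1) unfolding valid_path_def piecewise_C1_differentiable_on_def C1_differentiable_on_def by blast
  have unit: "norm (\<gamma> t) = 1" if "t \<in> {0..1}" for t
  proof -
    have "\<gamma> t \<in> sphere 0 1" using \<gamma>(2) that unfolding path_image_def by blast
    then show ?thesis by simp
  qed
  define n where "n t = indicator ({0..1} - S) t *\<^sub>R norm (D t)" for t
  have SB: "{0..1} - S \<in> sets borel" using borel_closed[OF finite_imp_closed[OF S]] by (intro sets.Diff) auto
  have nm: "n \<in> borel_measurable borel" unfolding n_def[abs_def]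
    by (intro borel_measurable_continuous_on_indicator SB continuous_on_norm D)
  have len: "curve_length \<gamma> = (\<integral>\<^sup>+t. ennreal (n t) \<partial>lborel)"
  proof -
    have "curve_length \<gamma> = (\<integral>\<^sup>+t. ennreal (n t) \<partial>lebesgue)" unfolding curve_length_def
    proof (rule nn_integral_cong_AE)
      have "AE t in lebesgue. t \<notin> S" by (rule AE_not_in) (use S in \<open>simp add: negligible_finite flip: negligible_iff_null_sets\<close>)
      then show "AE t in lebesgue. ennreal (norm (vector_derivative \<gamma> (at t within {0..1}))) * indicator {0..1} t = ennreal (n t)"
      proof eventually_elim
        case (elim t)
        have "vector_derivative \<gamma> (at t within {0..1}) = D t" if "t \<in> {0..1}"
          using that elim by (intro vector_derivative_at_within_ivl D) auto
        then show ?case using elim by (auto simp: n_def split: split_indicator)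
      qed
    qed
    then show ?thesis using nm by (simp add: nn_integral_completion)
  qed
  have ni: "integrable lborel n"
    by (rule integrableI_nonneg) (use nm len False in \<open>auto simp: n_def less_top\<close>)
  define L where "L = (LINT t|lborel. n t)"
  have lenL: "curve_length \<gamma> = ennreal L" unfolding len L_def
    by (rule nn_integral_eq_integral[OF ni]) (simp add: n_def)
  have nint: "n integrable_on {0..1}" "integral {0..1} n = L"
  proof -
    have "set_integrable lborel {0..1} n" unfolding set_integrable_def by (intro integrable_mult_indicator ni) simp
    note E = set_borel_integral_eq_integral[OF this]
    show "n integrable_on {0..1}" by (rule E(1))
    have "indicator {0..1} t *\<^sub>R n t = n t" for t by (auto simp: n_def split: split_indicator)
    then show "integral {0..1} n = L" using E(2) by (simp only: L_def set_lebesgue_integral_def)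
  qed
  define h where "h t = p \<bullet> \<gamma> t" for t
  have hb: "\<bar>h t\<bar> \<le> 1" if "t \<in> {0..1}" for t unfolding h_def using unit_inner_le[OF p unit[OF that]] .
  have tang: "\<gamma> t \<bullet> D t = 0" if "t \<in> {0<..<1} - S" for t
  proof -
    have "((\<lambda>s. \<gamma> s \<bullet> \<gamma> s) has_real_derivative (\<gamma> t \<bullet> D t + D t \<bullet> \<gamma> t)) (at t)"
      using D(1)[of t] that unfolding has_vector_derivative_def has_field_derivative_def
      by (auto intro!: derivative_eq_intros simp: fun_eq_iff algebra_simps inner_commute)
    moreover have "((\<lambda>s. \<gamma> s \<bullet> \<gamma> s) has_real_derivative 0) (at t)"
    proof (rule has_field_derivative_transform_within_open[of "\<lambda>_. 1" _ _ "{0<..<1}"])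
      show "1 = \<gamma> s \<bullet> \<gamma> s" if "s \<in> {0<..<1}" for s
        using inner_self_unit[OF unit[of s]] that by simp
    qed (use that in auto)
    ultimately show ?thesis using DERIV_unique by (fastforce simp: inner_commute)
  qed
  have bound: "\<bar>p \<bullet> D t\<bar> \<le> norm (D t) * sqrt (1 - (h t)\<^sup>2)" if "t \<in> {0<..<1} - S" for t
  proof -
    have "p \<bullet> D t = (p - h t *\<^sub>R \<gamma> t) \<bullet> D t" using tang[OF that] by (simp add: inner_diff_left)
    then have "\<bar>p \<bullet> D t\<bar> \<le> norm (p - h t *\<^sub>R \<gamma> t) * norm (D t)" using Cauchy_Schwarz_ineq2 by metis
    moreover have "(norm (p - h t *\<^sub>R \<gamma> t))\<^sup>2 = 1 - (h t)\<^sup>2"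
      unfolding power2_norm_eq_inner using p unit[of t] that
      by (simp add: inner_diff inner_commute inner_self_unit power2_eq_square h_def)
    then have "norm (p - h t *\<^sub>R \<gamma> t) = sqrt (1 - (h t)\<^sup>2)" by (metis norm_ge_zero real_sqrt_abs abs_of_nonneg)
    ultimately show ?thesis by (simp add: mult.commute)
  qed
  have main: "arccos (r * (p \<bullet> q)) - arccos r \<le> L" if r: "0 < r" "r < 1" for r
  proof -
    define g where "g t = arccos (r * h t)" for t
    have rh: "\<bar>r * h t\<bar> < 1" if "t \<in> {0..1}" for t
    proof -
      have "\<bar>r * h t\<bar> \<le> r * 1" using hb[OF that] r by (simp add: abs_mult)
      then show ?thesis using r by simp
    qed
    define g' where "g' t = (if t \<in> {0<..<1} - S then - (r * (p \<bullet> D t)) / sqrt (1 - (r * h t)\<^sup>2) else 0)" for t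
    have "(g' has_integral (g 1 - g 0)) {0..1}"
    proof (rule fundamental_theorem_of_calculus_interior_strong[OF S])
      fix t assume t: "t \<in> {0<..<1} - S"
      have "(h has_real_derivative (p \<bullet> D t)) (at t)"
        using D(1)[of t] t unfolding has_vector_derivative_def has_field_derivative_def h_def
        by (auto intro!: derivative_eq_intros simp: fun_eq_iff algebra_simps)
      then have "((\<lambda>t. r * h t) has_real_derivative (r * (p \<bullet> D t))) (at t)" by (rule DERIV_cmult)
      moreover have "(arccos has_real_derivative inverse (- sqrt (1 - (r * h t)\<^sup>2))) (at (r * h t))"
        by (rule DERIV_arccos) (use rh[of t] t in auto)
      ultimately have "(g has_real_derivative inverse (- sqrt (1 - (r * h t)\<^sup>2)) * (r * (p \<bullet> D t))) (at t)"
        unfolding g_def[abs_def] by (rule DERIV_chain2[rotated])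
      then show "(g has_vector_derivative g' t) (at t)"
        unfolding has_real_derivative_iff_has_vector_derivative[symmetric] using t by (simp add: g'_def divide_inverse ac_simps)
    next
      have "continuous_on {0..1} (\<lambda>t. r * h t)" unfolding h_def by (intro continuous_intros cont)
      then show "continuous_on {0..1} g" unfolding g_def[abs_def]
        by (rule continuous_on_arccos) (use rh in \<open>force simp: abs_less_iff\<close>)
    qed simp
    note g'int = this
    have g'n: "norm (g' t) \<le> n t" for t
    proof (cases "t \<in> {0<..<1} - S")
      case True
      then have t01: "t \<in> {0..1}" by auto
      have pos: "0 < 1 - (r * h t)\<^sup>2" using rh[OF t01] by (simp add: abs_square_less_1)
      have "r * sqrt (1 - (h t)\<^sup>2) \<le> sqrt (1 - (r * h t)\<^sup>2)"
      proof -
        have "r\<^sup>2 \<le> 1" using r by (simp add: power_le_one)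
        then have "r\<^sup>2 * (1 - (h t)\<^sup>2) \<le> 1 - (r * h t)\<^sup>2" by (simp add: power_mult_distrib algebra_simps)
        then have "sqrt (r\<^sup>2 * (1 - (h t)\<^sup>2)) \<le> sqrt (1 - (r * h t)\<^sup>2)" by simp
        then show ?thesis using r by (simp add: real_sqrt_mult)
      qed
      then have "norm (D t) * (r * sqrt (1 - (h t)\<^sup>2)) \<le> norm (D t) * sqrt (1 - (r * h t)\<^sup>2)"
        by (rule mult_left_mono) simp
      moreover have "r * \<bar>p \<bullet> D t\<bar> \<le> r * (norm (D t) * sqrt (1 - (h t)\<^sup>2))"
        using bound[OF True] r by (intro mult_left_mono) auto
      ultimately have "r * \<bar>p \<bullet> D t\<bar> \<le> norm (D t) * sqrt (1 - (r * h t)\<^sup>2)" by (simp add: mult.left_commute)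
      then show ?thesis using True pos r by (simp add: g'_def n_def abs_mult divide_le_eq)
    next
      case False
      then have "g' t = 0" unfolding g'_def by (rule if_not_P)
      then show ?thesis by (simp add: n_def)
    qed
    have "norm (integral {0..1} g') \<le> integral {0..1} n"
      by (rule integral_norm_bound_integral[OF has_integral_integrable[OF g'int] nint(1) g'n])
    then have "g 1 - g 0 \<le> L" using g'int nint(2) by (simp add: integral_unique)
    moreover have "\<gamma> 0 = p" "\<gamma> 1 = q" using \<gamma>(3,4) by (simp_all add: pathstart_def pathfinish_def)
    ultimately show ?thesis using p by (simp add: g_def h_def inner_self_unit)
  qed
  have "arccos (p \<bullet> q) - arccos 1 \<le> L"
  proof (rule LIMSEQ_le_const2)
    define R where "R k = 1 - 1 / (real k + 2)" for k :: nat
    have R: "0 < R k" "R k < 1" for k by (simp_all add: R_def field_simps)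
    have Rlim: "R \<longlonglongrightarrow> 1" unfolding R_def[abs_def] by real_asymp
    have q1: "\<bar>p \<bullet> q\<bar> \<le> 1" using hb[of 1] \<gamma>(4) by (simp add: h_def pathfinish_def)
    have ac: "(\<lambda>k. arccos (X k)) \<longlonglongrightarrow> arccos x" if "X \<longlonglongrightarrow> x" "x \<in> {-1..1}" "\<And>k. X k \<in> {-1..1}" for X x
      by (rule continuous_on_tendsto_compose[OF continuous_on_arccos' that(1,2)]) (use that(3) in auto)
    have "(\<lambda>k. R k * (p \<bullet> q)) \<longlonglongrightarrow> 1 * (p \<bullet> q)" by (intro tendsto_mult Rlim tendsto_const)
    moreover have "R k * (p \<bullet> q) \<in> {-1..1}" for k
    proof -
      have "\<bar>R k * (p \<bullet> q)\<bar> \<le> 1 * 1" unfolding abs_mult using R[of k] q1 by (intro mult_mono) auto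
      then show ?thesis by (simp add: abs_le_iff)
    qed
    ultimately show "(\<lambda>k. arccos (R k * (p \<bullet> q)) - arccos (R k)) \<longlonglongrightarrow> arccos (p \<bullet> q) - arccos 1"
      using q1 R by (intro tendsto_diff ac Rlim) (auto simp: abs_le_iff less_imp_le intro: order_trans[of _ 0])
    show "\<exists>N. \<forall>n\<ge>N. arccos (R n * (p \<bullet> q)) - arccos (R n) \<le> L" using main R by blast
  qed
  then have "arccos (p \<bullet> q) \<le> L" by simp
  then show ?thesis unfolding lenL by (rule ennreal_leI)
qed simp

lemma geodesic_dist_eq:
  fixes p q :: "'a::euclidean_space"
  assumes "norm p = 1" "norm q = 1" "\<bar>p \<bullet> q\<bar> < 1"
  shows "geodesic_dist p q = ennreal (arccos (p \<bullet> q))"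
proof (rule antisym)
  have "0 \<le> arccos (p \<bullet> q)" using assms(3) by (intro arccos_lbound) auto
  from curve_length_great_circle[OF assms(1) norm_geodesic_dir[OF assms] geodesic_dir_tangent[OF assms(1)] this]
  show "geodesic_dist p q \<le> ennreal (arccos (p \<bullet> q))"
    using great_circle_geodesic_dir[OF assms] by simp
  show "ennreal (arccos (p \<bullet> q)) \<le> geodesic_dist p q" unfolding geodesic_dist_def
    by (rule INF_greatest) (use arccos_le_curve_length[OF assms(1)] in auto)
qed

lemma geodesic_dist_self:
  fixes p :: "'a::euclidean_space"
  assumes "norm p = 1"
  shows "geodesic_dist p p = 0"
proof -
  let ?g = "\<lambda>t::real. p"
  have "vector_derivative ?g (at t within {0..1}) = 0" if "t \<in> {0..1}" for t
    using that by (intro vector_derivative_at_within_ivl has_vector_derivative_const) auto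
  then have "curve_length ?g = (\<integral>\<^sup>+(t::real). 0 \<partial>lebesgue)" unfolding curve_length_def
    by (intro nn_integral_cong) (auto split: split_indicator)
  then have "curve_length ?g = 0" by simp
  moreover have "valid_path ?g" "path_image ?g \<subseteq> sphere 0 1" "pathstart ?g = p" "pathfinish ?g = p"
    using assms by (auto simp: valid_path_def path_image_def pathstart_def pathfinish_def C1_differentiable_imp_piecewise)
  ultimately have "geodesic_dist p p \<le> 0" unfolding geodesic_dist_def by (intro INF_lower2[of ?g]) auto
  then show ?thesis by simp
qed

lemma sphere_exp_inj:
  fixes p :: "'a::euclidean_space"
  assumes p: "norm p = 1"
  shows "inj_on (sphere_exp p) {v \<in> tangent p. norm v < pi}"
proof (rule inj_onI)
  fix v w assume v: "v \<in> {v \<in> tangent p. norm v < pi}" and w: "w \<in> {v \<in> tangent p. norm v < pi}"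
    and eq: "sphere_exp p v = sphere_exp p w"
  have "p \<bullet> sphere_exp p v = cos (norm v)" "p \<bullet> sphere_exp p w = cos (norm w)"
    using v w p by (auto simp: sphere_exp_def tangent_def inner_add_right inner_self_unit)
  with eq have "cos (norm v) = cos (norm w)" by simp
  then have n: "norm v = norm w" using v w by - (rule cos_inj_pi, auto)
  show "v = w"
  proof (cases "v = 0")
    case True then show ?thesis using n by simp
  next
    case False
    have "0 < sin (norm v)" using False v by (intro sin_gt_zero) auto
    moreover have "(sin (norm v) / norm v) *\<^sub>R v = (sin (norm v) / norm v) *\<^sub>R w"
      using eq n by (simp add: sphere_exp_def)
    ultimately show ?thesis using False by simp
  qed
qed

lemma sphere_log_eq:
  fixes p q :: "'a::euclidean_space"
  assumes "norm p = 1" "norm q = 1" "\<bar>p \<bullet> q\<bar> < 1"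
  shows "sphere_log p q = arccos (p \<bullet> q) *\<^sub>R geodesic_dir p q"
proof -
  let ?\<theta> = "arccos (p \<bullet> q)" and ?v = "arccos (p \<bullet> q) *\<^sub>R geodesic_dir p q"
  have \<theta>: "0 < ?\<theta>" "?\<theta> < pi" using arccos_lt_bounded[of "p \<bullet> q"] assms(3) by auto
  have n: "norm ?v = ?\<theta>" using norm_geodesic_dir[OF assms] \<theta> by simp
  have q: "sphere_exp p ?v = q" unfolding sphere_exp_def n
    using great_circle_geodesic_dir[OF assms] \<theta> by simp
  have "?v \<in> {v \<in> tangent p. norm v < pi}"
    using n \<theta> geodesic_dir_tangent[OF assms(1)] by (simp add: tangent_def)
  from inv_into_f_f[OF sphere_exp_inj[OF assms(1)] this] show ?thesis
    unfolding q sphere_log_def .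
qed

lemma unit_jump:
  fixes p q :: "'a::euclidean_space"
  assumes p: "norm p = 1" and q: "norm q = 1" and pq: "p \<noteq> q" "0 \<le> p \<bullet> q"
  shows "(1 / enn2real (geodesic_dist p q)) *\<^sub>R sphere_log p q = geodesic_dir p q"
    and "(1 / enn2real (geodesic_dist p q)) *\<^sub>R sphere_log q p = geodesic_dir q p"
proof -
  have c: "\<bar>p \<bullet> q\<bar> < 1" "\<bar>q \<bullet> p\<bar> < 1" using unit_inner_less_1[OF p q pq(1)] pq(2) by (auto simp: inner_commute)
  have \<theta>: "0 < arccos (p \<bullet> q)" using arccos_lt_bounded[of "p \<bullet> q"] c by auto
  show "(1 / enn2real (geodesic_dist p q)) *\<^sub>R sphere_log p q = geodesic_dir p q"
    "(1 / enn2real (geodesic_dist p q)) *\<^sub>R sphere_log q p = geodesic_dir q p"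
    unfolding geodesic_dist_eq[OF p q c(1)] sphere_log_eq[OF p q c(1)] sphere_log_eq[OF q p c(2)] inner_commute[of q p]
    using \<theta> by auto
qed

lemma geodesic_dist_less_pi:
  fixes p q :: "'a::euclidean_space"
  assumes p: "norm p = 1" and q: "norm q = 1" and pq: "0 \<le> p \<bullet> q"
  shows "geodesic_dist p q < ennreal pi"
proof (cases "p = q")
  case True then show ?thesis using geodesic_dist_self[OF p] by simp
next
  case False
  have c: "\<bar>p \<bullet> q\<bar> < 1" using unit_inner_less_1[OF p q False] pq by auto
  then show ?thesis unfolding geodesic_dist_eq[OF p q c]
    using arccos_lt_bounded[of "p \<bullet> q"] by (auto intro!: ennreal_lessI)
qed

lemma norm_add_sub_unit:
  fixes p q :: "'a::euclidean_space"
  assumes p: "norm p = 1" and q: "norm q = 1"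
  shows "norm (p + q) = sqrt (2 * (1 + p \<bullet> q))" "norm (q - p) = sqrt (2 * (1 - p \<bullet> q))"
  using assms by (simp_all add: norm_eq_sqrt_inner inner_add inner_diff inner_commute inner_self_unit)

text \<open>
  With the angle \<open>\<theta>\<close> between \<open>p\<close> and \<open>q\<close> both sides equal \<open>- tan (\<theta>/2) (p + q)\<close>.
\<close>

lemma geodesic_dir_jump:
  fixes p q :: "'a::euclidean_space"
  assumes p: "norm p = 1" and q: "norm q = 1" and c: "\<bar>p \<bullet> q\<bar> < 1"
  shows "- geodesic_dir q p - geodesic_dir p q = - ((norm (q - p) / norm (p + q)) *\<^sub>R (p + q))"
proof -
  define k where "k = p \<bullet> q"
  have k: "0 < 1 - k" "0 < 1 + k" using c by (auto simp: k_def)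
  have s: "sqrt (1 - k\<^sup>2) = sqrt (1 - k) * sqrt (1 + k)"
    unfolding real_sqrt_mult[symmetric] by (simp add: power2_eq_square algebra_simps)
  have r: "norm (q - p) / norm (p + q) = (1 - k) / sqrt (1 - k\<^sup>2)"
  proof -
    have "norm (q - p) / norm (p + q) = sqrt (1 - k) / sqrt (1 + k)"
      unfolding norm_add_sub_unit[OF p q] k_def by (simp only: real_sqrt_mult) simp
    also have "\<dots> = (sqrt (1 - k) * sqrt (1 - k)) / (sqrt (1 - k) * sqrt (1 + k))"
      by (rule nonzero_mult_divide_mult_cancel_left[symmetric]) (use k in simp)
    finally show ?thesis using k(1) by (simp only: s real_sqrt_mult_self abs_of_pos)
  qed
  have "- geodesic_dir q p - geodesic_dir p q = - ((1 / sqrt (1 - k\<^sup>2)) *\<^sub>R ((1 - k) *\<^sub>R (p + q)))"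
    unfolding geodesic_dir_def inner_commute[of q p] k_def[symmetric] by (simp add: algebra_simps)
  then show ?thesis unfolding r by simp
qed

lemma eq_if_inner_eq_1:
  fixes z e :: "'a::euclidean_space"
  assumes "norm z \<le> 1" "norm e = 1" "z \<bullet> e = 1"
  shows "z = e"
proof -
  have "(norm (z - e))\<^sup>2 = (norm z)\<^sup>2 - 1"
    using assms(2,3) by (simp add: power2_norm_eq_inner inner_diff inner_commute inner_self_unit)
  also have "\<dots> \<le> 0" using assms(1) by (simp add: power_le_one)
  finally show ?thesis by simp
qed

text \<open>
  The inner product of the jump relation with \<open>q\<close> determines \<open>zl \<bullet> q\<close>, hence \<open>zl \<bullet> geodesic_dir p q = 1\<close>.
  In the unit ball only \<open>geodesic_dir p q\<close> itself has this property.
\<close>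

lemma geodesic_dir_jump_unique:
  fixes p q :: "'a::euclidean_space"
  assumes p: "norm p = 1" and q: "norm q = 1" and c: "\<bar>p \<bullet> q\<bar> < 1"
    and z: "zl \<bullet> p = 0" "zr \<bullet> q = 0" "norm zl \<le> 1"
    and j: "zr - zl = - ((norm (q - p) / norm (p + q)) *\<^sub>R (p + q))"
  shows "zl = geodesic_dir p q" "zr = - geodesic_dir q p"
proof -
  have "zl \<bullet> q = (zl - zr) \<bullet> q" using z(2) by (simp add: inner_diff_left)
  also have "zl - zr = geodesic_dir q p + geodesic_dir p q" using j geodesic_dir_jump[OF p q c] by (simp add: algebra_simps)
  also have "(geodesic_dir q p + geodesic_dir p q) \<bullet> q = geodesic_dir p q \<bullet> q"
    using geodesic_dir_tangent[OF q, of p] unfolding inner_add_left by (simp add: inner_commute[of "geodesic_dir q p"])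
  finally have "(zl - geodesic_dir p q) \<bullet> q = 0" by (simp add: inner_diff_left)
  moreover have "(zl - geodesic_dir p q) \<bullet> p = 0" using z(1) geodesic_dir_tangent[OF p, of q]
    by (simp add: inner_diff_right inner_commute[of _ p])
  ultimately have "(zl - geodesic_dir p q) \<bullet> geodesic_dir p q = 0"
    by (simp add: geodesic_dir_def[of p q] inner_diff_right inner_scaleR_right)
  then have "zl \<bullet> geodesic_dir p q = 1" using norm_geodesic_dir[OF p q c] by (simp add: inner_diff_left inner_self_unit)
  from eq_if_inner_eq_1[OF z(3) norm_geodesic_dir[OF p q c] this] show zl: "zl = geodesic_dir p q" .
  show "zr = - geodesic_dir q p" using j geodesic_dir_jump[OF p q c] unfolding zl
    by (simp add: algebra_simps eq_neg_iff_add_eq_0)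
qed

section \<open>Inner products of square integrable functions\<close>

lemma square_norm_add_le: "(norm (x + y :: 'a::real_normed_vector))\<^sup>2 \<le> 2 * ((norm x)\<^sup>2 + (norm y)\<^sup>2)"
proof -
  have "(norm (x + y))\<^sup>2 \<le> (norm x + norm y)\<^sup>2" by (rule power_mono[OF norm_triangle_ineq]) simp
  also have "\<dots> \<le> 2 * ((norm x)\<^sup>2 + (norm y)\<^sup>2)"
    using zero_le_power2[of "norm x - norm y"] by (simp add: power2_eq_square algebra_simps)
  finally show ?thesis .
qed

lemma integrable_inner_of_square:
  fixes f g :: "'x \<Rightarrow> 'a::euclidean_space"
  assumes [measurable]: "f \<in> borel_measurable M" "g \<in> borel_measurable M"
    and "integrable M (\<lambda>x. (norm (f x))\<^sup>2)" "integrable M (\<lambda>x. (norm (g x))\<^sup>2)"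
  shows "integrable M (\<lambda>x. f x \<bullet> g x)"
proof (rule Bochner_Integration.integrable_bound[OF Bochner_Integration.integrable_add[OF assms(3,4)]])
  show "AE x in M. norm (f x \<bullet> g x) \<le> norm ((norm (f x))\<^sup>2 + (norm (g x))\<^sup>2)"
  proof (rule AE_I2)
    fix x
    have "\<bar>f x \<bullet> g x\<bar> \<le> norm (f x) * norm (g x)" by (rule Cauchy_Schwarz_ineq2)
    also have "\<dots> \<le> (norm (f x))\<^sup>2 + (norm (g x))\<^sup>2"
      using sum_squares_bound[of "norm (f x)" "norm (g x)"] zero_le_power2[of "norm (f x)"] zero_le_power2[of "norm (g x)"]
        mult_nonneg_nonneg[OF norm_ge_zero[of "f x"] norm_ge_zero[of "g x"]] by linarith
    finally show "norm (f x \<bullet> g x) \<le> norm ((norm (f x))\<^sup>2 + (norm (g x))\<^sup>2)" by simp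
  qed
qed measurable

lemma integrable_square_add:
  fixes f g :: "'x \<Rightarrow> 'a::euclidean_space"
  assumes [measurable]: "f \<in> borel_measurable M" "g \<in> borel_measurable M"
    and "integrable M (\<lambda>x. (norm (f x))\<^sup>2)" "integrable M (\<lambda>x. (norm (g x))\<^sup>2)"
  shows "integrable M (\<lambda>x. (norm (f x + g x))\<^sup>2)"
  by (rule Bochner_Integration.integrable_bound[OF integrable_mult_right[OF Bochner_Integration.integrable_add[OF assms(3,4)], of 2]])
     (use square_norm_add_le in auto)

lemma quadratic_discriminant:
  fixes A B C :: real
  assumes "\<And>s. 0 \<le> A - 2 * s * B + s\<^sup>2 * C" "0 \<le> A" "0 \<le> C"
  shows "\<bar>B\<bar> \<le> sqrt A * sqrt C"
proof (cases "C = 0")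
  case True
  have "B = 0"
  proof (rule ccontr)
    assume "B \<noteq> 0"
    then show False using assms(1)[of "(A + 1) / (2 * B)"] True by simp
  qed
  then show ?thesis using True by simp
next
  case False
  then have "0 < C" using assms(3) by simp
  have "0 \<le> A - 2 * (B / C) * B + (B / C)\<^sup>2 * C" by (rule assms(1))
  then have "B\<^sup>2 \<le> A * C" using \<open>0 < C\<close> by (simp add: power2_eq_square field_simps)
  then have "sqrt (B\<^sup>2) \<le> sqrt (A * C)" by (rule real_sqrt_le_mono)
  then show ?thesis by (simp add: real_sqrt_mult)
qed

text \<open>
  Used twice: for functions of \<open>x\<close> in \<open>L\<^sup>2(I)\<close>, and for functions of time.
\<close>

lemma integral_Cauchy_Schwarz:
  fixes f g :: "'x \<Rightarrow> 'a::euclidean_space"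
  assumes m: "f \<in> borel_measurable M" "g \<in> borel_measurable M"
    and i: "integrable M (\<lambda>x. (norm (f x))\<^sup>2)" "integrable M (\<lambda>x. (norm (g x))\<^sup>2)"
  shows "\<bar>LINT x|M. f x \<bullet> g x\<bar> \<le> sqrt (LINT x|M. (norm (f x))\<^sup>2) * sqrt (LINT x|M. (norm (g x))\<^sup>2)"
proof (rule quadratic_discriminant)
  fix s :: real
  note fg = integrable_inner_of_square[OF m i]
  have eq: "(norm (f x - s *\<^sub>R g x))\<^sup>2 = (norm (f x))\<^sup>2 - 2 * s * (f x \<bullet> g x) + s\<^sup>2 * (norm (g x))\<^sup>2" for x
    unfolding power2_norm_eq_inner by (simp add: inner_diff inner_commute power2_eq_square algebra_simps)
  have "0 \<le> (LINT x|M. (norm (f x - s *\<^sub>R g x))\<^sup>2)" by simp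
  also have "\<dots> = (LINT x|M. (norm (f x))\<^sup>2) - 2 * s * (LINT x|M. f x \<bullet> g x) + s\<^sup>2 * (LINT x|M. (norm (g x))\<^sup>2)"
    unfolding eq using fg i by simp
  finally show "0 \<le> (LINT x|M. (norm (f x))\<^sup>2) - 2 * s * (LINT x|M. f x \<bullet> g x) + s\<^sup>2 * (LINT x|M. (norm (g x))\<^sup>2)" .
qed simp_all

lemma L2_inner: "L2 I f \<Longrightarrow> L2 I g \<Longrightarrow> integrable (lebesgue_on I) (\<lambda>x. f x \<bullet> g x)"
  unfolding L2_def by (intro integrable_inner_of_square) auto

lemma L2_Cauchy_Schwarz:
  "L2 I f \<Longrightarrow> L2 I g \<Longrightarrow> \<bar>LINT x|lebesgue_on I. f x \<bullet> g x\<bar> \<le> L2_norm I f * L2_norm I g"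
  unfolding L2_def L2_norm_def by (intro integral_Cauchy_Schwarz) auto

lemma L2_scaled:
  assumes f: "L2 I f" and [measurable]: "\<psi> \<in> borel_measurable (lebesgue_on I)" and b: "\<And>x. \<bar>\<psi> x\<bar> \<le> 1"
  shows "L2 I (\<lambda>x. \<psi> x *\<^sub>R f x)" "L2_norm I (\<lambda>x. \<psi> x *\<^sub>R f x) \<le> L2_norm I f"
proof -
  have [measurable]: "f \<in> borel_measurable (lebesgue_on I)" using f by (simp add: L2_def)
  have le: "(norm (\<psi> x *\<^sub>R f x))\<^sup>2 \<le> (norm (f x))\<^sup>2" for x
    by (rule power_mono) (use b in \<open>auto simp: mult_left_le_one_le\<close>)
  have fi: "integrable (lebesgue_on I) (\<lambda>x. (norm (f x))\<^sup>2)" using f by (simp add: L2_def)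
  have i: "integrable (lebesgue_on I) (\<lambda>x. (norm (\<psi> x *\<^sub>R f x))\<^sup>2)"
    by (rule Bochner_Integration.integrable_bound[OF fi]) (use le in auto)
  then show "L2 I (\<lambda>x. \<psi> x *\<^sub>R f x)" unfolding L2_def by simp
  show "L2_norm I (\<lambda>x. \<psi> x *\<^sub>R f x) \<le> L2_norm I f" unfolding L2_norm_def
    by (intro real_sqrt_le_mono integral_mono i fi le)
qed

lemma L2_add: "L2 I f \<Longrightarrow> L2 I g \<Longrightarrow> L2 I (\<lambda>x. f x + g x)"
  unfolding L2_def by (auto intro: integrable_square_add)

lemma L2_minus: "L2 I f \<Longrightarrow> L2 I (\<lambda>x. - f x)"
  unfolding L2_def by auto

lemma L2_diff: "L2 I f \<Longrightarrow> L2 I g \<Longrightarrow> L2 I (\<lambda>x. f x - g x)"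
  using L2_add[OF _ L2_minus, of I f g] by simp

lemma L2_norm_nonneg: "0 \<le> L2_norm I f" by (simp add: L2_norm_def)

lemma L2_norm_square: "(L2_norm I f)\<^sup>2 = (LINT x|lebesgue_on I. f x \<bullet> f x)"
  by (simp add: L2_norm_def dot_square_norm)

lemma L2_norm_triangle:
  assumes "L2 I f" "L2 I g"
  shows "L2_norm I (\<lambda>x. f x + g x) \<le> L2_norm I f + L2_norm I g"
proof (rule power2_le_imp_le)
  have "(LINT x|lebesgue_on I. (f x + g x) \<bullet> (f x + g x))
      = (LINT x|lebesgue_on I. f x \<bullet> f x + 2 * (f x \<bullet> g x) + g x \<bullet> g x)"
    by (simp add: inner_add inner_commute algebra_simps)
  also have "\<dots> = (L2_norm I f)\<^sup>2 + 2 * (LINT x|lebesgue_on I. f x \<bullet> g x) + (L2_norm I g)\<^sup>2"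
    unfolding L2_norm_square using L2_inner[OF assms(1,1)] L2_inner[OF assms] L2_inner[OF assms(2,2)] by simp
  also have "\<dots> \<le> (L2_norm I f)\<^sup>2 + 2 * (L2_norm I f * L2_norm I g) + (L2_norm I g)\<^sup>2"
    using L2_Cauchy_Schwarz[OF assms] by simp
  also have "\<dots> = (L2_norm I f + L2_norm I g)\<^sup>2" by (simp add: power2_eq_square algebra_simps)
  finally show "(L2_norm I (\<lambda>x. f x + g x))\<^sup>2 \<le> (L2_norm I f + L2_norm I g)\<^sup>2" unfolding L2_norm_square .
qed (simp add: L2_norm_nonneg)

lemma tendsto_L2_inner:
  assumes L2: "\<And>k::nat. L2 I (f k)" "L2 I g" "L2 I h" and lim: "(\<lambda>k. L2_norm I (\<lambda>x. f k x - g x)) \<longlonglongrightarrow> 0"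
  shows "(\<lambda>k. LINT x|lebesgue_on I. h x \<bullet> f k x) \<longlonglongrightarrow> (LINT x|lebesgue_on I. h x \<bullet> g x)"
proof -
  have "(\<lambda>k. (LINT x|lebesgue_on I. h x \<bullet> f k x) - (LINT x|lebesgue_on I. h x \<bullet> g x)) \<longlonglongrightarrow> 0"
  proof (rule tendsto_rabs_zero_cancel, rule tendsto_sandwich[OF _ _ tendsto_const])
    show "eventually (\<lambda>k. \<bar>(LINT x|lebesgue_on I. h x \<bullet> f k x) - (LINT x|lebesgue_on I. h x \<bullet> g x)\<bar>
        \<le> L2_norm I h * L2_norm I (\<lambda>x. f k x - g x)) sequentially"
    proof (rule always_eventually, rule allI)
      fix k
      have "(LINT x|lebesgue_on I. h x \<bullet> f k x) - (LINT x|lebesgue_on I. h x \<bullet> g x)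
          = (LINT x|lebesgue_on I. h x \<bullet> (f k x - g x))"
        using L2_inner[OF L2(3) L2(1)[of k]] L2_inner[OF L2(3) L2(2)] by (simp add: inner_diff_right)
      then show "\<bar>(LINT x|lebesgue_on I. h x \<bullet> f k x) - (LINT x|lebesgue_on I. h x \<bullet> g x)\<bar>
          \<le> L2_norm I h * L2_norm I (\<lambda>x. f k x - g x)"
        using L2_Cauchy_Schwarz[OF L2(3) L2_diff[OF L2(1)[of k] L2(2)]] by simp
    qed
    show "(\<lambda>k. L2_norm I h * L2_norm I (\<lambda>x. f k x - g x)) \<longlonglongrightarrow> 0"
      using tendsto_mult_right_zero[OF lim] by simp
  qed simp
  then show ?thesis by (simp add: LIM_zero_iff)
qed

section \<open>Orthogonality of a unit vector field and its time derivative\<close>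

lemma borel_measurable_lebesgue_on_AE:
  fixes f g :: "real \<Rightarrow> 'a::euclidean_space"
  assumes J: "J \<in> sets borel" and f: "f \<in> borel_measurable (lebesgue_on J)" and eq: "AE x in lebesgue_on J. f x = g x"
  shows "g \<in> borel_measurable (lebesgue_on J)"
proof -
  have "(\<lambda>x. indicator J x *\<^sub>R f x) \<in> borel_measurable lebesgue"
    using f J by (subst (asm) borel_measurable_restrict_space_iff) auto
  moreover have "AE x in lebesgue. indicator J x *\<^sub>R f x = indicator J x *\<^sub>R g x"
    using eq J by (subst (asm) AE_restrict_space_iff) (auto elim: eventually_mono)
  ultimately have "(\<lambda>x. indicator J x *\<^sub>R g x) \<in> borel_measurable lebesgue" by (rule borel_measurable_AE)
  then show ?thesis using J by (subst borel_measurable_restrict_space_iff) auto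
qed

lemma borel_measurable_lebesgue_on_limit:
  fixes f :: "nat \<Rightarrow> real \<Rightarrow> real"
  assumes J: "J \<in> sets borel" and f: "\<And>k. f k \<in> borel_measurable (lebesgue_on J)"
    and lim: "AE x in lebesgue_on J. (\<lambda>k. f k x) \<longlonglongrightarrow> g x"
  shows "g \<in> borel_measurable (lebesgue_on J)"
proof (rule borel_measurable_lebesgue_on_AE[OF J])
  show "(\<lambda>x. lim (\<lambda>k. f k x)) \<in> borel_measurable (lebesgue_on J)" using f by (rule borel_measurable_lim_metric)
  show "AE x in lebesgue_on J. lim (\<lambda>k. f k x) = g x" using lim by eventually_elim (rule limI)
qed

lemma integrable_lebesgue_on_borel_version:
  fixes f :: "real \<Rightarrow> 'a::euclidean_space"
  assumes f: "integrable (lebesgue_on {a<..<b}) f"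
  obtains f' where "f' \<in> borel_measurable borel" "AE x in lebesgue_on {a<..<b}. f x = f' x"
    "integrable (restrict_space lborel {a<..<b}) f'"
    "\<And>A. A \<in> sets borel \<Longrightarrow> set_lebesgue_integral (lebesgue_on {a<..<b}) A f
        = set_lebesgue_integral (restrict_space lborel {a<..<b}) A f'"
proof -
  let ?I = "{a<..<b}"
  have I: "?I \<in> sets borel" by simp
  obtain f' where f': "f' \<in> borel_measurable borel" "AE x in lebesgue_on ?I. f x = f' x"
    by (rule lebesgue_on_borel_version[OF I borel_measurable_integrable[OF f]])
  have "integrable (lebesgue_on ?I) f'"
    by (rule integrable_cong_AE_imp[OF f borel_measurable_lebesgue_on[OF f'(1)]]) (use f'(2) in eventually_elim, simp)
  then have "integrable lborel (\<lambda>x. indicator ?I x *\<^sub>R f' x)" by (simp add: integrable_lebesgue_on_borel[OF I f'(1)])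
  then have i: "integrable (restrict_space lborel ?I) f'" by (subst integrable_restrict_space) simp_all
  have "set_lebesgue_integral (lebesgue_on ?I) A f = set_lebesgue_integral (restrict_space lborel ?I) A f'"
    if A: "A \<in> sets borel" for A
  proof -
    have Am: "(\<lambda>x. indicator A x :: real) \<in> borel_measurable (lebesgue_on ?I)"
      by (rule borel_measurable_lebesgue_on) (use A in simp)
    have f'm: "(\<lambda>x. indicator A x *\<^sub>R f' x) \<in> borel_measurable borel" using A f'(1) by measurable
    have "set_lebesgue_integral (lebesgue_on ?I) A f = (LINT x|lebesgue_on ?I. indicator A x *\<^sub>R f' x)"
      unfolding set_lebesgue_integral_def
    proof (rule integral_cong_AE)
      show "(\<lambda>x. indicator A x *\<^sub>R f x) \<in> borel_measurable (lebesgue_on ?I)" using Am f by measurable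
      show "(\<lambda>x. indicator A x *\<^sub>R f' x) \<in> borel_measurable (lebesgue_on ?I)" by (rule borel_measurable_lebesgue_on[OF f'm])
      show "AE x in lebesgue_on ?I. indicator A x *\<^sub>R f x = indicator A x *\<^sub>R f' x" using f'(2) by eventually_elim simp
    qed
    also have "\<dots> = (LINT x|lborel. indicator ?I x *\<^sub>R indicator A x *\<^sub>R f' x)" by (rule integral_lebesgue_on_borel[OF I f'm])
    also have "\<dots> = set_lebesgue_integral (restrict_space lborel ?I) A f'"
      unfolding set_lebesgue_integral_def by (subst integral_restrict_space) simp_all
    finally show ?thesis .
  qed
  then show thesis by (rule that[OF f' i])
qed

lemma interval_measure_lborel:
  assumes "a < b"
  shows "interval_measure a b (restrict_space lborel {a<..<b}) (\<lambda>_. 1)"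
proof (rule interval_measure.intro)
  show fin: "finite_measure (restrict_space lborel {a<..<b})"
    by (rule finite_measureI) (use assms in \<open>simp add: emeasure_restrict_space space_restrict_space\<close>)
  show "integrable (restrict_space lborel {a<..<b}) (\<lambda>_. 1::real)" using fin by (simp add: finite_measure.integrable_const)
qed (use assms in \<open>simp_all add: sets_restrict_space density_1\<close>)

lemma primitive_of_weak_derivative:
  fixes U V :: "real \<Rightarrow> real"
  assumes ab: "a < b" and U: "integrable (lebesgue_on {a<..<b}) U" and V: "integrable (lebesgue_on {a<..<b}) V"
    and weak: "\<And>\<phi>. \<phi> \<in> C1_c {a<..<b} \<Longrightarrow>
      (LINT t|lebesgue_on {a<..<b}. deriv \<phi> t * U t) = - (LINT t|lebesgue_on {a<..<b}. \<phi> t * V t)"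
  shows "\<exists>c. AE t in lebesgue_on {a<..<b}. U t = c + set_lebesgue_integral (lebesgue_on {a<..<b}) {a<..t} V"
proof -
  let ?I = "{a<..<b}" and ?R = "restrict_space lborel {a<..<b}"
  interpret R: interval_measure a b ?R "\<lambda>_. 1" by (rule interval_measure_lborel[OF ab])
  obtain V' where V': "V' \<in> borel_measurable borel" "AE t in lebesgue_on ?I. V t = V' t" "integrable ?R V'"
    "\<And>A. A \<in> sets borel \<Longrightarrow> set_lebesgue_integral (lebesgue_on ?I) A V = set_lebesgue_integral ?R A V'"
    using integrable_lebesgue_on_borel_version[OF V] by blast
  let ?P = "\<lambda>t. set_lebesgue_integral ?R {a<..t} V'"
  have Pm: "?P \<in> borel_measurable borel" by (rule borel_measurable_primitive(1)[OF R.sigma_finite_M R.sets V'(3)])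
  interpret L: finite_measure "lebesgue_on ?I" by (rule finite_measure_lebesgue_on_Ioo)
  have Pi: "integrable (lebesgue_on ?I) ?P"
    by (rule L.integrable_const_bound[of _ "LINT x|?R. norm (V' x)"])
       (use norm_primitive_le[OF V'(3)] borel_measurable_lebesgue_on[OF Pm] in auto)
  have "\<exists>c. AE t in lebesgue_on ?I. U t - ?P t = c"
  proof (rule du_bois_reymond[OF ab])
    show "integrable (lebesgue_on ?I) (\<lambda>t. U t - ?P t)" using U Pi by simp
    fix \<phi> assume \<phi>: "\<phi> \<in> C1_c ?I"
    note D\<phi> = C1_c_deriv[OF \<phi> ab]
    obtain B where B: "\<And>x. \<bar>deriv \<phi> x\<bar> \<le> B" using D\<phi>(3) by blast
    have dm: "deriv \<phi> \<in> borel_measurable (lebesgue_on ?I)"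
      by (intro borel_measurable_lebesgue_on borel_measurable_continuous_onI D\<phi>(2))
    have \<phi>m: "\<phi> \<in> borel_measurable borel"
      by (rule borel_measurable_continuous_onI, rule DERIV_continuous_on, rule D\<phi>(1))
    have iU: "integrable (lebesgue_on ?I) (\<lambda>t. deriv \<phi> t * U t)"
    proof (rule Bochner_Integration.integrable_bound[OF integrable_mult_right[OF U, of B]])
      show "AE x in lebesgue_on ?I. norm (deriv \<phi> x * U x) \<le> norm (B * U x)"
      proof (rule AE_I2)
        fix x
        have "\<bar>deriv \<phi> x\<bar> * \<bar>U x\<bar> \<le> \<bar>B\<bar> * \<bar>U x\<bar>"
          by (rule mult_right_mono[OF order_trans[OF B abs_ge_self]]) simp
        then show "norm (deriv \<phi> x * U x) \<le> norm (B * U x)" by (simp add: abs_mult)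
      qed
    qed (use dm U in measurable)
    note T = integral_test_deriv_primitive[OF ab R.sigma_finite_M R.sets V'(3) \<phi>, of 0]
    have "(LINT t|lebesgue_on ?I. \<phi> t * V t) = (LINT t|lebesgue_on ?I. \<phi> t * V' t)"
    proof (rule integral_cong_AE)
      show "(\<lambda>t. \<phi> t * V t) \<in> borel_measurable (lebesgue_on ?I)"
        using borel_measurable_lebesgue_on[OF \<phi>m] V by measurable
      show "(\<lambda>t. \<phi> t * V' t) \<in> borel_measurable (lebesgue_on ?I)"
        using borel_measurable_lebesgue_on[OF \<phi>m] borel_measurable_lebesgue_on[OF V'(1)] by measurable
      show "AE t in lebesgue_on ?I. \<phi> t * V t = \<phi> t * V' t" using V'(2) by eventually_elim simp
    qed
    also have "\<dots> = (LINT t|?R. \<phi> t *\<^sub>R V' t)"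
      using \<phi>m V'(1) by (subst integral_lebesgue_on_borel) (simp_all add: integral_restrict_space)
    finally show "(LINT t|lebesgue_on ?I. deriv \<phi> t *\<^sub>R (U t - ?P t)) = 0"
      using weak[OF \<phi>] T iU by (simp add: right_diff_distrib)
  qed
  then obtain c where "AE t in lebesgue_on ?I. U t - ?P t = c" ..
  then have "AE t in lebesgue_on ?I. U t = c + set_lebesgue_integral (lebesgue_on ?I) {a<..t} V"
    by eventually_elim (simp add: V'(4) algebra_simps)
  then show ?thesis ..
qed

text \<open>
  The primitive is right-continuous and vanishes at \<open>a\<close>. If it takes one value \<open>k\<close> on a dense set, it
  is constant, and so \<open>k = 0\<close>.
\<close>

lemma AE_zero_of_dense_primitive:
  fixes f :: "real \<Rightarrow> 'a::euclidean_space"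
  assumes ab: "a < b" and f: "integrable (lebesgue_on {a<..<b}) f"
    and dense: "\<And>p q. a \<le> p \<Longrightarrow> p < q \<Longrightarrow> q \<le> b \<Longrightarrow>
      \<exists>t. p < t \<and> t < q \<and> set_lebesgue_integral (lebesgue_on {a<..<b}) {a<..t} f = k"
  shows "AE t in lebesgue_on {a<..<b}. f t = 0"
proof -
  let ?I = "{a<..<b}" and ?R = "restrict_space lborel {a<..<b}"
  interpret R: interval_measure a b ?R "\<lambda>_. 1" by (rule interval_measure_lborel[OF ab])
  obtain f' where f': "f' \<in> borel_measurable borel" "AE t in lebesgue_on ?I. f t = f' t" "integrable ?R f'"
    "\<And>A. A \<in> sets borel \<Longrightarrow> set_lebesgue_integral (lebesgue_on ?I) A f = set_lebesgue_integral ?R A f'"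
    using integrable_lebesgue_on_borel_version[OF f] by blast
  define K where "K t = set_lebesgue_integral ?R {a<..t} f'" for t
  have Kk: "K x = k" if x: "a \<le> x" "x < b" for x
  proof (rule ccontr)
    assume ne: "K x \<noteq> k"
    have "(K \<longlongrightarrow> K x) (at x within (?I \<inter> {x<..}))"
      unfolding K_def[abs_def] by (rule R.primitive_tendsto(2)[OF f'(3)])
    then have "eventually (\<lambda>y. K y \<noteq> k) (at x within (?I \<inter> {x<..}))" using ne by (rule tendsto_imp_eventually_ne)
    then obtain d where d: "d > 0" "\<And>y. y \<in> ?I \<inter> {x<..} \<Longrightarrow> y \<noteq> x \<Longrightarrow> dist y x < d \<Longrightarrow> K y \<noteq> k"
      unfolding eventually_at by auto
    obtain t where "x < t" "t < min b (x + d)" "K t = k"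
      using dense[of x "min b (x + d)"] x d(1) f'(4) by (auto simp: K_def)
    then show False using d(2)[of t] x by (auto simp: dist_real_def)
  qed
  have "K a = 0" by (simp add: K_def set_lebesgue_integral_def)
  then have "K x = 0" if "a < x" "x < b" for x using Kk[of a] Kk[of x] that ab by simp
  then have "AE t in ?R. f' t = 0"
    by (intro AE_eq_zero_if_atMost_integrals[OF R.sigma_finite_M R.sets f'(3)]) (simp add: K_def)
  then have "AE t in lebesgue_on ?I. f' t = 0"
    by (subst (asm) AE_restrict_space_iff) (simp_all add: AE_lebesgue_on_iff_lborel)
  with f'(2) show ?thesis by eventually_elim simp
qed

lemma strongly_measurable_inner:
  assumes J: "J \<in> sets borel" and f: "strongly_measurable_L2 J I f" and h: "L2 I h"
  shows "(\<lambda>t. LINT x|lebesgue_on I. h x \<bullet> f t x) \<in> borel_measurable (lebesgue_on J)"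
proof -
  obtain s where s: "\<And>k::nat. simple_function (lebesgue_on J) (s k)" "\<And>k t. t \<in> J \<Longrightarrow> L2 I (s k t)"
    and lim: "AE t in lebesgue_on J. (\<lambda>k. L2_norm I (\<lambda>x. s k t x - f t x)) \<longlonglongrightarrow> 0"
    and fL: "AE t in lebesgue_on J. L2 I (f t)"
    using f unfolding strongly_measurable_L2_def by blast
  show ?thesis
  proof (rule borel_measurable_lebesgue_on_limit[OF J])
    show "(\<lambda>t. LINT x|lebesgue_on I. h x \<bullet> s k t x) \<in> borel_measurable (lebesgue_on J)" for k
    proof -
      have "simple_function (lebesgue_on J) ((\<lambda>g. LINT x|lebesgue_on I. h x \<bullet> g x) \<circ> s k)"
        by (rule simple_function_compose[OF s(1)])
      from borel_measurable_simple_function[OF this] show ?thesis by (simp add: comp_def)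
    qed
    have "AE t in lebesgue_on J. t \<in> J" by (rule AE_I2) (simp add: space_restrict_space)
    with lim fL show "AE t in lebesgue_on J. (\<lambda>k. LINT x|lebesgue_on I. h x \<bullet> s k t x) \<longlonglongrightarrow> (LINT x|lebesgue_on I. h x \<bullet> f t x)"
    proof eventually_elim
      case (elim t)
      show ?case by (rule tendsto_L2_inner[OF s(2) elim(2) h elim(1)]) (rule elim(3))
    qed
  qed
qed

text \<open>
  A simple function has finitely many values, so that the pairing is a finite combination of
  pairings with fixed elements of \<open>L\<^sup>2\<close>.
\<close>

lemma simple_function_inner_measurable:
  assumes J: "J \<in> sets borel" and f: "strongly_measurable_L2 J I f"
    and s: "simple_function (lebesgue_on J) s" "\<And>t. t \<in> J \<Longrightarrow> L2 I (s t)"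
  shows "(\<lambda>t. LINT x|lebesgue_on I. s t x \<bullet> f t x) \<in> borel_measurable (lebesgue_on J)"
proof -
  have sp: "space (lebesgue_on J) = J" by (simp add: space_restrict_space)
  define R where "R = s ` J"
  have R: "finite R" using s(1) by (simp add: R_def simple_function_def sp)
  have "(\<lambda>t. \<Sum>y\<in>R. indicator (s -` {y} \<inter> J) t * (LINT x|lebesgue_on I. y x \<bullet> f t x)) \<in> borel_measurable (lebesgue_on J)"
  proof (rule borel_measurable_sum)
    fix y assume "y \<in> R"
    then have y: "L2 I y" using s(2) by (auto simp: R_def)
    have "s -` {y} \<inter> J \<in> sets (lebesgue_on J)" using simple_functionD(2)[OF s(1), of "{y}"] by (simp add: sp)
    then have "(\<lambda>t. indicator (s -` {y} \<inter> J) t :: real) \<in> borel_measurable (lebesgue_on J)" by simp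
    then show "(\<lambda>t. indicator (s -` {y} \<inter> J) t * (LINT x|lebesgue_on I. y x \<bullet> f t x)) \<in> borel_measurable (lebesgue_on J)"
      using strongly_measurable_inner[OF J f y] by measurable
  qed
  note m = this
  have "(\<Sum>y\<in>R. indicator (s -` {y} \<inter> J) t * (LINT x|lebesgue_on I. y x \<bullet> f t x))
      = (LINT x|lebesgue_on I. s t x \<bullet> f t x)" if "t \<in> space (lebesgue_on J)" for t
  proof -
    have t: "t \<in> J" using that sp by simp
    have "(\<Sum>y\<in>R. indicator (s -` {y} \<inter> J) t * (LINT x|lebesgue_on I. y x \<bullet> f t x))
        = (\<Sum>y\<in>R. if y = s t then LINT x|lebesgue_on I. s t x \<bullet> f t x else 0)"
      using t by (intro sum.cong refl) auto
    also have "\<dots> = (LINT x|lebesgue_on I. s t x \<bullet> f t x)" using R t by (simp add: R_def)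
    finally show ?thesis .
  qed
  from measurable_cong[THEN iffD1, OF this m] show ?thesis .
qed

context
  fixes I :: "real set" and \<tau> :: real and u v :: "real \<Rightarrow> real \<Rightarrow> 'a::euclidean_space" and \<psi> :: "real \<Rightarrow> real"
  assumes \<tau>: "0 < \<tau>"
    and u: "strongly_measurable_L2 {0<..<\<tau>} I u" and v: "strongly_measurable_L2 {0<..<\<tau>} I v"
    and u2: "integrable (lebesgue_on {0<..<\<tau>}) (\<lambda>t. (L2_norm I (u t))\<^sup>2)"
    and v2: "integrable (lebesgue_on {0<..<\<tau>}) (\<lambda>t. (L2_norm I (v t))\<^sup>2)"
    and weak: "\<And>\<phi> \<eta>. \<phi> \<in> C1_c {0<..<\<tau>} \<Longrightarrow> L2 I \<eta> \<Longrightarrow>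
      (LINT t|lebesgue_on {0<..<\<tau>}. deriv \<phi> t * (LINT x|lebesgue_on I. u t x \<bullet> \<eta> x))
      = - (LINT t|lebesgue_on {0<..<\<tau>}. \<phi> t * (LINT x|lebesgue_on I. v t x \<bullet> \<eta> x))"
    and unit: "AE t in lebesgue_on {0<..<\<tau>}. AE x in lebesgue_on I. norm (u t x) = 1"
    and \<psi>: "\<psi> \<in> borel_measurable (lebesgue_on I)" "\<And>x. \<bar>\<psi> x\<bar> \<le> 1"
begin

private abbreviation "J \<equiv> {0<..<\<tau>}"
private abbreviation "L \<equiv> lebesgue_on J"
private abbreviation "ip f g \<equiv> LINT x|lebesgue_on I. f x \<bullet> g x"
private abbreviation "n f \<equiv> L2_norm I f"
private abbreviation "S s t \<equiv> {s<..t}"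

private lemma J: "J \<in> sets borel" by simp

private lemma finL: "finite_measure L"
  by (rule finite_measure_lebesgue_on_Ioo)

private lemma vL: "AE t in L. L2 I (v t)" using v by (simp add: strongly_measurable_L2_def)
private lemma uL: "AE t in L. L2 I (u t)" using u by (simp add: strongly_measurable_L2_def)

private lemma norm_integrable:
  assumes f: "strongly_measurable_L2 J I f" and f2: "integrable L (\<lambda>t. (n (f t))\<^sup>2)"
  shows "integrable L (\<lambda>t. n (f t))"
proof -
  interpret finite_measure L by (rule finL)
  have m: "(\<lambda>t. n (f t)) \<in> borel_measurable L"
  proof -
    have "(\<lambda>t. sqrt ((n (f t))\<^sup>2)) \<in> borel_measurable L" using f2 by measurable
    then show ?thesis by (simp add: L2_norm_nonneg)
  qed
  have "integrable L (\<lambda>t. 1 + (n (f t))\<^sup>2)" using f2 by simp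
  then show ?thesis
  proof (rule Bochner_Integration.integrable_bound[OF _ m])
    show "AE t in L. norm (n (f t)) \<le> norm (1 + (n (f t))\<^sup>2)"
      using le_one_plus_square by (intro AE_I2) (simp add: L2_norm_nonneg)
  qed
qed

private lemma inner_integrable:
  assumes f: "strongly_measurable_L2 J I f" and f2: "integrable L (\<lambda>t. (n (f t))\<^sup>2)" and h: "L2 I h"
  shows "integrable L (\<lambda>t. ip h (f t))"
proof (rule Bochner_Integration.integrable_bound[OF integrable_mult_right[OF norm_integrable[OF f f2], of "n h"]])
  show "(\<lambda>t. ip h (f t)) \<in> borel_measurable L" by (rule strongly_measurable_inner[OF J f h])
  have "AE t in L. L2 I (f t)" using f by (simp add: strongly_measurable_L2_def)
  then show "AE t in L. norm (ip h (f t)) \<le> norm (n h * n (f t))"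
  proof eventually_elim
    case (elim t)
    from L2_Cauchy_Schwarz[OF h elim] show ?case by (simp add: L2_norm_nonneg)
  qed
qed

private lemma set_int: "integrable L f \<Longrightarrow> set_integrable L (S s t) f" for f :: "real \<Rightarrow> real"
proof -
  assume f: "integrable L f"
  have "S s t \<inter> J \<in> sets L" by (subst sets_restrict_space_iff) simp_all
  from integrable_mult_indicator[OF this f]
  have "integrable L (\<lambda>x. indicator (S s t \<inter> J) x *\<^sub>R f x)" .
  then show ?thesis unfolding set_integrable_def
    by (rule Bochner_Integration.integrable_cong[THEN iffD1, OF refl, rotated])
       (auto simp: space_restrict_space split: split_indicator)
qed

private lemma set_int_split:
  fixes f :: "real \<Rightarrow> real"
  assumes "integrable L f" "r \<le> s" "s \<le> t"
  shows "set_lebesgue_integral L (S r t) f = set_lebesgue_integral L (S r s) f + set_lebesgue_integral L (S s t) f"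
proof -
  have "set_lebesgue_integral L (S r s \<union> S s t) f = set_lebesgue_integral L (S r s) f + set_lebesgue_integral L (S s t) f"
    by (rule set_integral_Un[OF _ set_int[OF assms(1)] set_int[OF assms(1)]]) auto
  moreover have "S r s \<union> S s t = S r t" using assms by auto
  ultimately show ?thesis by simp
qed

text \<open>
  For a fixed test element \<open>h\<close> the pairing \<open>ip h (u t)\<close> is a scalar function with weak derivative
  \<open>ip h (v t)\<close>. The exceptional null set depends on \<open>h\<close>.
\<close>

private lemma increments:
  assumes h: "L2 I h"
  shows "\<exists>c. AE t in L. ip h (u t) = c + set_lebesgue_integral L (S 0 t) (\<lambda>r. ip h (v r))"
proof (rule primitive_of_weak_derivative[OF \<tau> inner_integrable[OF u u2 h] inner_integrable[OF v v2 h]])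
  fix \<phi> assume "\<phi> \<in> C1_c J"
  from weak[OF this h]
  show "(LINT t|L. deriv \<phi> t * ip h (u t)) = - (LINT t|L. \<phi> t * ip h (v t))" by (simp add: inner_commute)
qed

private definition "good t \<longleftrightarrow> 0 < t \<and> t < \<tau> \<and> L2 I (u t) \<and> (AE x in lebesgue_on I. norm (u t x) = 1)"

text \<open>
  One null set of times serves all the test elements that are needed, although these are values of
  \<open>u\<close> itself. The ranges of the simple functions that approximate \<open>u\<close> form a countable set \<open>D0\<close> of test
  elements; outside a common null set the values of \<open>u\<close> are \<open>L\<^sup>2\<close>-limits of elements of \<open>D0\<close>, and the
  identity is stable under such limits.
\<close>

private lemma good_increments:
  obtains G where "AE t in L. t \<in> G" "\<And>t. t \<in> G \<Longrightarrow> good t"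
    "\<And>s t r h. s \<in> G \<Longrightarrow> t \<in> G \<Longrightarrow> r \<in> G \<Longrightarrow> s \<le> t \<Longrightarrow> h = u r \<or> h = (\<lambda>x. \<psi> x *\<^sub>R u r x) \<Longrightarrow>
       ip h (u t) - ip h (u s) = set_lebesgue_integral L (S s t) (\<lambda>q. ip h (v q))"
proof -
  obtain a where a: "\<And>k::nat. simple_function L (a k)" "\<And>k t. t \<in> J \<Longrightarrow> L2 I (a k t)"
    and lim: "AE t in L. (\<lambda>k. n (\<lambda>x. a k t x - u t x)) \<longlonglongrightarrow> 0"
    using u unfolding strongly_measurable_L2_def by blast
  define D0 where "D0 = (\<Union>k. a k ` J)"
  define D where "D = D0 \<union> (\<lambda>h x. \<psi> x *\<^sub>R h x) ` D0"
  have "finite (a k ` J)" for k using a(1)[of k] by (simp add: simple_function_def space_restrict_space)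
  then have "countable D0" unfolding D0_def by (intro countable_UN[OF countableI_type] countable_finite)
  then have "countable D" unfolding D_def by (intro countable_Un countable_image)
  have D0L: "L2 I h" if "h \<in> D0" for h using that a(2) by (auto simp: D0_def)
  have DL: "L2 I h" if "h \<in> D" for h using that D0L L2_scaled(1)[OF _ \<psi>] by (auto simp: D_def)
  have "\<forall>h\<in>D. \<exists>c. AE t in L. ip h (u t) = c + set_lebesgue_integral L (S 0 t) (\<lambda>r. ip h (v r))"
  proof
    fix h assume "h \<in> D"
    from increments[OF DL[OF this]] show "\<exists>c. AE t in L. ip h (u t) = c + set_lebesgue_integral L (S 0 t) (\<lambda>r. ip h (v r))" .
  qed
  from bchoice[OF this] obtain c
    where c: "\<forall>h\<in>D. AE t in L. ip h (u t) = c h + set_lebesgue_integral L (S 0 t) (\<lambda>r. ip h (v r))"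
    by (rule exE)
  have cD: "AE t in L. \<forall>h\<in>D. ip h (u t) = c h + set_lebesgue_integral L (S 0 t) (\<lambda>r. ip h (v r))"
    unfolding AE_ball_countable[OF \<open>countable D\<close>] by (rule c)
  define G where "G = {t. good t \<and> (\<lambda>k. n (\<lambda>x. a k t x - u t x)) \<longlonglongrightarrow> 0 \<and>
      (\<forall>h\<in>D. ip h (u t) = c h + set_lebesgue_integral L (S 0 t) (\<lambda>r. ip h (v r)))}"
  show thesis
  proof (rule that[of G])
    have "AE t in L. t \<in> J" by (rule AE_I2) (simp add: space_restrict_space)
    with lim cD uL unit show "AE t in L. t \<in> G" by eventually_elim (simp add: G_def good_def)
    show "\<And>t. t \<in> G \<Longrightarrow> good t" by (simp add: G_def)
    have inc: "ip h (u t) - ip h (u s) = set_lebesgue_integral L (S s t) (\<lambda>q. ip h (v q))"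
      if "s \<in> G" "t \<in> G" "s \<le> t" "h \<in> D" for s t h
    proof -
      have "0 \<le> s" using that(1) by (simp add: G_def good_def)
      from set_int_split[OF inner_integrable[OF v v2 DL[OF that(4)]] this that(3)]
      show ?thesis using that by (simp add: G_def)
    qed
    have ext: "ip h (u t) - ip h (u s) = set_lebesgue_integral L (S s t) (\<lambda>q. ip h (v q))"
      if G: "s \<in> G" "t \<in> G" "s \<le> t" and h: "\<And>k::nat. d k \<in> D" "L2 I h" "(\<lambda>k. n (\<lambda>x. d k x - h x)) \<longlonglongrightarrow> 0" for s t h d
    proof -
      have gt: "L2 I (u s)" "L2 I (u t)" using G by (auto simp: G_def good_def)
      have "(\<lambda>k. ip (d k) (u t) - ip (d k) (u s)) \<longlonglongrightarrow> ip h (u t) - ip h (u s)"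
        using tendsto_L2_inner[OF DL[OF h(1)] h(2) gt(1) h(3)] tendsto_L2_inner[OF DL[OF h(1)] h(2) gt(2) h(3)]
        unfolding inner_commute[of "h _"] inner_commute[of "d _ _"] by (intro tendsto_diff)
      moreover have "(\<lambda>k. set_lebesgue_integral L (S s t) (\<lambda>q. ip (d k) (v q)))
          \<longlonglongrightarrow> set_lebesgue_integral L (S s t) (\<lambda>q. ip h (v q))"
      proof -
        let ?N = "LINT q|L. n (v q)"
        have "(\<lambda>k. set_lebesgue_integral L (S s t) (\<lambda>q. ip (d k) (v q)) - set_lebesgue_integral L (S s t) (\<lambda>q. ip h (v q))) \<longlonglongrightarrow> 0"
        proof (rule tendsto_rabs_zero_cancel, rule tendsto_sandwich[OF _ _ tendsto_const])
          show "(\<lambda>k. n (\<lambda>x. d k x - h x) * ?N) \<longlonglongrightarrow> 0" using tendsto_mult_left_zero[OF h(3)] by simp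
          show "eventually (\<lambda>k. \<bar>set_lebesgue_integral L (S s t) (\<lambda>q. ip (d k) (v q)) - set_lebesgue_integral L (S s t) (\<lambda>q. ip h (v q))\<bar>
              \<le> n (\<lambda>x. d k x - h x) * ?N) sequentially"
          proof (rule always_eventually, rule allI)
            fix k
            let ?e = "\<lambda>x. d k x - h x"
            have e: "L2 I ?e" by (rule L2_diff[OF DL[OF h(1)] h(2)])
            have i: "integrable L (\<lambda>q. ip (d k) (v q))" "integrable L (\<lambda>q. ip h (v q))" "integrable L (\<lambda>q. ip ?e (v q))"
              by (rule inner_integrable[OF v v2], rule DL h e, (rule h(1))?)+
            have "set_lebesgue_integral L (S s t) (\<lambda>q. ip (d k) (v q)) - set_lebesgue_integral L (S s t) (\<lambda>q. ip h (v q))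
                = set_lebesgue_integral L (S s t) (\<lambda>q. ip (d k) (v q) - ip h (v q))"
              by (rule set_integral_diff(2)[symmetric, OF set_int[OF i(1)] set_int[OF i(2)]])
            also have "\<bar>\<dots>\<bar> \<le> (LINT q|L. norm (ip (d k) (v q) - ip h (v q)))"
              using norm_primitive_le[OF Bochner_Integration.integrable_diff[OF i(1,2)]] by simp
            also have "\<dots> \<le> (LINT q|L. n ?e * n (v q))"
            proof (rule integral_mono_AE)
              show "integrable L (\<lambda>q. norm (ip (d k) (v q) - ip h (v q)))" using i by simp
              show "integrable L (\<lambda>q. n ?e * n (v q))" using norm_integrable[OF v v2] by simp
              show "AE q in L. norm (ip (d k) (v q) - ip h (v q)) \<le> n ?e * n (v q)"
                using vL
              proof eventually_elim
                case (elim q)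
                have "ip (d k) (v q) - ip h (v q) = ip ?e (v q)"
                  using L2_inner[OF DL[OF h(1)] elim] L2_inner[OF h(2) elim] by (simp add: inner_diff_left)
                then show ?case using L2_Cauchy_Schwarz[OF e elim] by simp
              qed
            qed
            finally show "\<bar>set_lebesgue_integral L (S s t) (\<lambda>q. ip (d k) (v q)) - set_lebesgue_integral L (S s t) (\<lambda>q. ip h (v q))\<bar>
              \<le> n ?e * ?N" by simp
          qed
        qed simp
        then show ?thesis by (simp add: LIM_zero_iff)
      qed
      ultimately show ?thesis using inc[OF G h(1)] LIMSEQ_unique by auto
    qed
    show "ip h (u t) - ip h (u s) = set_lebesgue_integral L (S s t) (\<lambda>q. ip h (v q))"
      if G: "s \<in> G" "t \<in> G" "r \<in> G" "s \<le> t" and h: "h = u r \<or> h = (\<lambda>x. \<psi> x *\<^sub>R u r x)" for s t r h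
    proof -
      have r: "r \<in> J" "L2 I (u r)" "(\<lambda>k. n (\<lambda>x. a k r x - u r x)) \<longlonglongrightarrow> 0"
        using G(3) by (auto simp: G_def good_def)
      have d0: "a k r \<in> D0" for k unfolding D0_def using r(1) by blast
      from h show ?thesis
      proof
        assume "h = u r"
        then show ?thesis using ext[OF G(1,2,4), of "\<lambda>k. a k r" h] d0 r by (simp add: D_def)
      next
        assume h: "h = (\<lambda>x. \<psi> x *\<^sub>R u r x)"
        have "n (\<lambda>x. \<psi> x *\<^sub>R a k r x - h x) \<le> n (\<lambda>x. a k r x - u r x)" for k
          using L2_scaled(2)[OF L2_diff[OF D0L[OF d0[of k]] r(2)] \<psi>] by (simp add: h scaleR_diff_right)
        then have "(\<lambda>k. n (\<lambda>x. \<psi> x *\<^sub>R a k r x - h x)) \<longlonglongrightarrow> 0"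
          by (intro tendsto_sandwich[OF _ _ tendsto_const r(3)] always_eventually) (auto simp: L2_norm_nonneg)
        then show ?thesis using ext[OF G(1,2,4), of "\<lambda>k x. \<psi> x *\<^sub>R a k r x" h] d0 L2_scaled(1)[OF r(2) \<psi>]
          by (simp add: D_def h)
      qed
    qed
  qed
qed

text \<open>
  A bounded weight \<open>\<psi>\<close> in the space variable is kept in order to localise later. Let \<open>K s t\<close> be the
  integral of \<open>ip (\<psi> u) v\<close> over \<open>{s<..t}\<close> and \<open>N s t\<close> that of the norm of \<open>v\<close>. The increments of \<open>u\<close> are bounded
  by \<open>N\<close>. As \<open>|u t|\<^sup>2 - |u s|\<^sup>2 = 0\<close>, the pairing of \<open>u t - u s\<close> with \<open>\<psi> (u t + u s)\<close> vanishes. It is also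
  the integral of the pairing of \<open>v\<close> with \<open>\<psi> (u t + u s)\<close>, which differs from \<open>2 K s t\<close> by at most
  \<open>2 (N s t)\<^sup>2\<close>. Hence \<open>K\<close> is additive and of second order in \<open>t - s\<close>, and it must be zero.
\<close>

lemma time_orthogonal: "AE t in L. (LINT x|lebesgue_on I. (\<psi> x *\<^sub>R u t x) \<bullet> v t x) = 0"
proof -
  obtain G where GA: "AE t in L. t \<in> G" and good: "\<And>t. t \<in> G \<Longrightarrow> good t"
    and inc: "\<And>s t r h. s \<in> G \<Longrightarrow> t \<in> G \<Longrightarrow> r \<in> G \<Longrightarrow> s \<le> t \<Longrightarrow> h = u r \<or> h = (\<lambda>x. \<psi> x *\<^sub>R u r x) \<Longrightarrow>
       ip h (u t) - ip h (u s) = set_lebesgue_integral L (S s t) (\<lambda>q. ip h (v q))"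
    using good_increments by blast
  have uG: "L2 I (u t)" if "t \<in> G" for t using good[OF that] by (simp add: good_def)
  have intv: "integrable L (\<lambda>q. n (v q))" by (rule norm_integrable[OF v v2])
  define N where "N s t = set_lebesgue_integral L (S s t) (\<lambda>q. n (v q))" for s t
  have N0: "0 \<le> N s t" for s t unfolding N_def set_lebesgue_integral_def by (simp add: L2_norm_nonneg)
  define w where "w t = (\<lambda>x. \<psi> x *\<^sub>R u t x)" for t
  have wL: "L2 I (w t)" if "L2 I (u t)" for t unfolding w_def by (rule L2_scaled(1)[OF that \<psi>])
  \<comment> \<open>Both values of \<open>u\<close> are admissible test elements for the increment, hence so is the increment.\<close>
  have lip: "n (\<lambda>x. u t x - u s x) \<le> N s t" if st: "s \<in> G" "t \<in> G" "s \<le> t" for s t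
  proof -
    let ?d = "\<lambda>x. u t x - u s x"
    have d: "L2 I ?d" by (rule L2_diff[OF uG uG]) (use st in auto)
    have i: "integrable L (\<lambda>q. ip (u t) (v q))" "integrable L (\<lambda>q. ip (u s) (v q))"
      by (rule inner_integrable[OF v v2 uG], rule st)+
    have "(n ?d)\<^sup>2 = ip (u t) (u t) - ip (u t) (u s) - (ip (u s) (u t) - ip (u s) (u s))"
      unfolding L2_norm_square using st L2_inner[OF uG uG]
      by (simp add: inner_diff algebra_simps)
    also have "\<dots> = set_lebesgue_integral L (S s t) (\<lambda>q. ip (u t) (v q)) - set_lebesgue_integral L (S s t) (\<lambda>q. ip (u s) (v q))"
      using inc[OF st(1,2,2,3), of "u t"] inc[OF st(1,2,1,3), of "u s"] by simp
    also have "\<dots> = set_lebesgue_integral L (S s t) (\<lambda>q. ip (u t) (v q) - ip (u s) (v q))"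
      by (rule set_integral_diff(2)[symmetric, OF set_int[OF i(1)] set_int[OF i(2)]])
    also have "\<dots> \<le> set_lebesgue_integral L (S s t) (\<lambda>q. n ?d * n (v q))"
      unfolding set_lebesgue_integral_def
    proof (rule integral_mono_AE)
      show "integrable L (\<lambda>q. indicator (S s t) q *\<^sub>R (ip (u t) (v q) - ip (u s) (v q)))"
        using set_int[OF Bochner_Integration.integrable_diff[OF i]] by (simp add: set_integrable_def)
      show "integrable L (\<lambda>q. indicator (S s t) q *\<^sub>R (n ?d * n (v q)))"
        using set_int[OF integrable_mult_right[OF intv]] by (simp add: set_integrable_def)
      show "AE q in L. indicator (S s t) q *\<^sub>R (ip (u t) (v q) - ip (u s) (v q)) \<le> indicator (S s t) q *\<^sub>R (n ?d * n (v q))"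
        using vL
      proof eventually_elim
        case (elim q)
        have "ip (u t) (v q) - ip (u s) (v q) = ip ?d (v q)"
          using L2_inner[OF uG[OF st(1)] elim] L2_inner[OF uG[OF st(2)] elim] by (simp add: inner_diff_left)
        then show ?case using L2_Cauchy_Schwarz[OF d elim] by (auto split: split_indicator)
      qed
    qed
    also have "\<dots> = n ?d * N s t" unfolding N_def by simp
    finally have "n ?d * n ?d \<le> n ?d * N s t" by (simp add: power2_eq_square)
    then show ?thesis using L2_norm_nonneg[of I ?d] N0[of s t] by (cases "n ?d = 0") (auto simp: mult_le_cancel_left)
  qed
  have Gint: "integrable L (\<lambda>q. ip (w q) (v q))"
  proof (rule Bochner_Integration.integrable_bound[OF Bochner_Integration.integrable_add[OF u2 v2]])
    obtain a where a: "\<And>k::nat. simple_function L (a k)" "\<And>k t. t \<in> J \<Longrightarrow> L2 I (a k t)"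
      and lim: "AE t in L. (\<lambda>k. n (\<lambda>x. a k t x - u t x)) \<longlonglongrightarrow> 0"
      using u unfolding strongly_measurable_L2_def by blast
    show "(\<lambda>q. ip (w q) (v q)) \<in> borel_measurable L"
    proof (rule borel_measurable_lebesgue_on_limit[OF J])
      fix k
      have s: "simple_function L ((\<lambda>h x. \<psi> x *\<^sub>R h x) \<circ> a k)" by (rule simple_function_compose[OF a(1)])
      have "L2 I (((\<lambda>h x. \<psi> x *\<^sub>R h x) \<circ> a k) t)" if "t \<in> J" for t
        using L2_scaled(1)[OF a(2)[OF that] \<psi>] by simp
      from simple_function_inner_measurable[OF J v s this]
      show "(\<lambda>q. LINT x|lebesgue_on I. (\<psi> x *\<^sub>R a k q x) \<bullet> v q x) \<in> borel_measurable L" by simp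
    next
      have "AE t in L. t \<in> J" by (rule AE_I2) (simp add: space_restrict_space)
      with lim vL uL show "AE q in L. (\<lambda>k. LINT x|lebesgue_on I. (\<psi> x *\<^sub>R a k q x) \<bullet> v q x) \<longlonglongrightarrow> ip (w q) (v q)"
      proof eventually_elim
        case (elim q)
        have le: "n (\<lambda>x. \<psi> x *\<^sub>R a k q x - w q x) \<le> n (\<lambda>x. a k q x - u q x)" for k
          using L2_scaled(2)[OF L2_diff[OF a(2)[OF elim(4)] elim(3)] \<psi>] by (simp add: w_def scaleR_diff_right)
        have "(\<lambda>k. n (\<lambda>x. \<psi> x *\<^sub>R a k q x - w q x)) \<longlonglongrightarrow> 0"
          by (intro tendsto_sandwich[OF _ _ tendsto_const elim(1)] always_eventually) (use le in \<open>auto simp: L2_norm_nonneg\<close>)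
        from tendsto_L2_inner[OF L2_scaled(1)[OF a(2)[OF elim(4)] \<psi>] wL[OF elim(3)] elim(2) this]
        show ?case by (simp add: inner_commute)
      qed
    qed
    show "AE q in L. norm (ip (w q) (v q)) \<le> norm ((n (u q))\<^sup>2 + (n (v q))\<^sup>2)"
      using vL uL
    proof eventually_elim
      case (elim q)
      have "\<bar>ip (w q) (v q)\<bar> \<le> n (w q) * n (v q)" by (rule L2_Cauchy_Schwarz[OF wL[OF elim(2)] elim(1)])
      also have "\<dots> \<le> n (u q) * n (v q)"
        unfolding w_def by (rule mult_right_mono[OF L2_scaled(2)[OF elim(2) \<psi>] L2_norm_nonneg])
      also have "\<dots> \<le> (n (u q))\<^sup>2 + (n (v q))\<^sup>2"
        using sum_squares_bound[of "n (u q)" "n (v q)"] mult_nonneg_nonneg[OF L2_norm_nonneg[of I "u q"] L2_norm_nonneg[of I "v q"]]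
          zero_le_power2[of "n (u q)"] zero_le_power2[of "n (v q)"] by linarith
      finally show ?case by simp
    qed
  qed
  define K where "K s t = set_lebesgue_integral L (S s t) (\<lambda>q. ip (w q) (v q))" for s t
  define Q where "Q s t = set_lebesgue_integral L (S s t) (\<lambda>q. (n (v q))\<^sup>2)" for s t
  \<comment> \<open>Cauchy-Schwarz in time makes the second order explicit, with an additive factor \<open>Q\<close>.\<close>
  have NQ: "(N s t)\<^sup>2 \<le> (t - s) * Q s t" if st: "0 < s" "s \<le> t" "t < \<tau>" for s t
  proof -
    let ?i = "\<lambda>q. indicator (S s t) q :: real"
    have im: "?i \<in> borel_measurable L" by (rule borel_measurable_lebesgue_on) simp
    have vm: "(\<lambda>q. ?i q * n (v q)) \<in> borel_measurable L" using im intv by measurable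
    have i1: "integrable L (\<lambda>q. (norm (?i q))\<^sup>2)"
      by (rule finite_measure.integrable_const_bound[OF finL, of _ 1]) (use im in \<open>auto split: split_indicator\<close>)
    have i2: "integrable L (\<lambda>q. (norm (?i q * n (v q)))\<^sup>2)"
      by (rule Bochner_Integration.integrable_bound[OF v2]) (use vm in \<open>auto split: split_indicator\<close>)
    have "\<bar>LINT q|L. ?i q \<bullet> (?i q * n (v q))\<bar> \<le> sqrt (LINT q|L. (norm (?i q))\<^sup>2) * sqrt (LINT q|L. (norm (?i q * n (v q)))\<^sup>2)"
      by (rule integral_Cauchy_Schwarz[OF im vm i1 i2])
    moreover have "(\<lambda>q. ?i q \<bullet> (?i q * n (v q))) = (\<lambda>q. ?i q *\<^sub>R n (v q))" by (auto simp: fun_eq_iff split: split_indicator)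
    moreover have "(\<lambda>q. (norm (?i q * n (v q)))\<^sup>2) = (\<lambda>q. ?i q *\<^sub>R (n (v q))\<^sup>2)" by (auto simp: fun_eq_iff split: split_indicator)
    moreover have "(LINT q|L. (norm (?i q))\<^sup>2) = t - s"
    proof -
      have "(LINT q|L. (norm (?i q))\<^sup>2) = (LINT q|L. ?i q)"
        by (intro Bochner_Integration.integral_cong refl) (auto split: split_indicator)
      also have "\<dots> = (LINT q|lborel. indicator J q *\<^sub>R ?i q)" by (rule integral_lebesgue_on_borel[OF J]) simp
      also have "\<dots> = (LINT q|lborel. ?i q)"
        by (intro Bochner_Integration.integral_cong refl) (use st in \<open>auto split: split_indicator\<close>)
      also have "\<dots> = t - s" using st by simp
      finally show ?thesis .
    qed
    ultimately have le: "\<bar>N s t\<bar> \<le> sqrt (t - s) * sqrt (Q s t)" unfolding N_def Q_def set_lebesgue_integral_def by simp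
    have "0 \<le> Q s t" unfolding Q_def set_lebesgue_integral_def by simp
    then show ?thesis using power_mono[OF le abs_ge_zero, of 2] st by (simp add: power_mult_distrib)
  qed
  have KQ: "\<bar>K s t\<bar> \<le> (t - s) * Q s t" if st: "s \<in> G" "t \<in> G" "s \<le> t" for s t
  proof -
    have L2s: "L2 I (u s)" "L2 I (u t)" by (rule uG, rule st)+
    have i: "integrable L (\<lambda>q. ip (w t) (v q))" "integrable L (\<lambda>q. ip (w s) (v q))"
      by (rule inner_integrable[OF v v2 wL], rule L2s)+
    have "ip (w t) (u t) - ip (w t) (u s) + (ip (w s) (u t) - ip (w s) (u s)) = 0"
    proof -
      have "ip (w t) (u t) - ip (w t) (u s) + (ip (w s) (u t) - ip (w s) (u s))
          = (LINT x|lebesgue_on I. w t x \<bullet> u t x - w t x \<bullet> u s x + (w s x \<bullet> u t x - w s x \<bullet> u s x))"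
        using L2_inner[OF wL[OF L2s(2)] L2s(2)] L2_inner[OF wL[OF L2s(2)] L2s(1)]
          L2_inner[OF wL[OF L2s(1)] L2s(2)] L2_inner[OF wL[OF L2s(1)] L2s(1)] by simp
      also have "\<dots> = 0"
      proof (rule integral_eq_zero_AE)
        have "AE x in lebesgue_on I. norm (u s x) = 1" "AE x in lebesgue_on I. norm (u t x) = 1"
          using good st by (auto simp: good_def)
        then show "AE x in lebesgue_on I. w t x \<bullet> u t x - w t x \<bullet> u s x + (w s x \<bullet> u t x - w s x \<bullet> u s x) = 0"
          by eventually_elim (simp add: w_def inner_self_unit inner_commute)
      qed
      finally show ?thesis .
    qed
    then have "set_lebesgue_integral L (S s t) (\<lambda>q. ip (w t) (v q)) + set_lebesgue_integral L (S s t) (\<lambda>q. ip (w s) (v q)) = 0"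
      using inc[OF st(1,2,2,3), of "w t"] inc[OF st(1,2,1,3), of "w s"] by (simp add: w_def)
    then have "2 * K s t = 2 * K s t - (set_lebesgue_integral L (S s t) (\<lambda>q. ip (w t) (v q)) + set_lebesgue_integral L (S s t) (\<lambda>q. ip (w s) (v q)))"
      by simp
    also have eq: "\<dots> = (LINT q|L. indicator (S s t) q *\<^sub>R (2 * ip (w q) (v q) - (ip (w t) (v q) + ip (w s) (v q))))"
      using set_int[OF Gint, of s t] set_int[OF i(1), of s t] set_int[OF i(2), of s t]
      unfolding K_def set_lebesgue_integral_def set_integrable_def
      by (simp add: algebra_simps)
    finally have eq: "2 * K s t = (LINT q|L. indicator (S s t) q *\<^sub>R (2 * ip (w q) (v q) - (ip (w t) (v q) + ip (w s) (v q))))" .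
    have "\<bar>2 * K s t\<bar> \<le> (LINT q|L. indicator (S s t) q *\<^sub>R (2 * N s t * n (v q)))"
      unfolding eq
    proof (rule order_trans[OF integral_abs_bound], rule integral_mono_AE)
      show "integrable L (\<lambda>q. \<bar>indicator (S s t) q *\<^sub>R (2 * ip (w q) (v q) - (ip (w t) (v q) + ip (w s) (v q)))\<bar>)"
        using set_int[of "\<lambda>q. 2 * ip (w q) (v q) - (ip (w t) (v q) + ip (w s) (v q))" s t] Gint i
        unfolding set_integrable_def by (intro integrable_abs) auto
      show "integrable L (\<lambda>q. indicator (S s t) q *\<^sub>R (2 * N s t * n (v q)))"
        using set_int[OF integrable_mult_right[OF intv]] by (simp add: set_integrable_def)
      show "AE q in L. \<bar>indicator (S s t) q *\<^sub>R (2 * ip (w q) (v q) - (ip (w t) (v q) + ip (w s) (v q)))\<bar>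
          \<le> indicator (S s t) q *\<^sub>R (2 * N s t * n (v q))"
        using vL GA
      proof eventually_elim
        case (elim q)
        show ?case
        proof (cases "q \<in> S s t")
          case True
          have L2q: "L2 I (u q)" by (rule uG[OF elim(2)])
          define e where "e x = \<psi> x *\<^sub>R ((u q x - u s x) + - (u t x - u q x))" for x
          have d1: "L2 I (\<lambda>x. u q x - u s x)" and d2: "L2 I (\<lambda>x. u t x - u q x)"
            by (rule L2_diff[OF L2q L2s(1)], rule L2_diff[OF L2s(2) L2q])
          have sum: "L2 I (\<lambda>x. (u q x - u s x) + - (u t x - u q x))" by (rule L2_add[OF d1 L2_minus[OF d2]])
          have eL: "L2 I e" unfolding e_def by (rule L2_scaled(1)[OF sum \<psi>])
          have mono: "N p r \<le> N s t" if "s \<le> p" "r \<le> t" for p r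
            unfolding N_def set_lebesgue_integral_def
          proof (rule integral_mono)
            show "integrable L (\<lambda>x. indicator (S p r) x *\<^sub>R n (v x))" "integrable L (\<lambda>x. indicator (S s t) x *\<^sub>R n (v x))"
              using set_int[OF intv] by (simp_all add: set_integrable_def)
            show "indicator (S p r) x *\<^sub>R n (v x) \<le> indicator (S s t) x *\<^sub>R n (v x)" for x
              using that by (auto simp: L2_norm_nonneg split: split_indicator)
          qed
          have "n e \<le> n (\<lambda>x. (u q x - u s x) + - (u t x - u q x))" unfolding e_def by (rule L2_scaled(2)[OF sum \<psi>])
          also have "\<dots> \<le> n (\<lambda>x. u q x - u s x) + n (\<lambda>x. - (u t x - u q x))" by (rule L2_norm_triangle[OF d1 L2_minus[OF d2]])
          also have "n (\<lambda>x. - (u t x - u q x)) = n (\<lambda>x. u t x - u q x)" by (simp only: L2_norm_def norm_minus_cancel)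
          also have "n (\<lambda>x. u q x - u s x) + n (\<lambda>x. u t x - u q x) \<le> N s q + N q t"
            using True by (intro add_mono lip st elim(2)) auto
          also have "\<dots> \<le> 2 * N s t" using mono[of s q] mono[of q t] True by simp
          finally have ne: "n e \<le> 2 * N s t" .
          have "2 * ip (w q) (v q) - (ip (w t) (v q) + ip (w s) (v q)) = ip e (v q)"
          proof -
            have "ip e (v q) = (LINT x|lebesgue_on I. 2 * (w q x \<bullet> v q x) - (w t x \<bullet> v q x + w s x \<bullet> v q x))"
              by (intro Bochner_Integration.integral_cong refl) (simp add: e_def w_def inner_add_left inner_diff_left algebra_simps)
            then show ?thesis
              using L2_inner[OF wL[OF L2q] elim(1)] L2_inner[OF wL[OF L2s(1)] elim(1)] L2_inner[OF wL[OF L2s(2)] elim(1)]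
              by simp
          qed
          moreover have "\<bar>ip e (v q)\<bar> \<le> 2 * N s t * n (v q)"
            by (rule order_trans[OF L2_Cauchy_Schwarz[OF eL elim(1)] mult_right_mono[OF ne L2_norm_nonneg]])
          ultimately show ?thesis using True by simp
        qed simp
      qed
    qed
    also have "\<dots> = 2 * (N s t)\<^sup>2"
      unfolding set_lebesgue_integral_def[symmetric] by (simp add: N_def power2_eq_square)
    finally have "\<bar>K s t\<bar> \<le> (N s t)\<^sup>2" by simp
    also have "\<dots> \<le> (t - s) * Q s t" using good[OF st(1)] good[OF st(2)] st by (intro NQ) (auto simp: good_def)
    finally show ?thesis .
  qed
  have Q0: "0 \<le> Q s t" for s t unfolding Q_def set_lebesgue_integral_def by simp
  have dense: "\<exists>r. p < r \<and> r < q \<and> r \<in> G" if "0 \<le> p" "p < q" "q \<le> \<tau>" for p q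
    using AE_lebesgue_on_ex[OF GA that] .
  \<comment> \<open>Cut \<open>{s<..t}\<close> into pieces of length at most \<open>2 \<delta>\<close> with end points in the dense set \<open>G\<close>.\<close>
  have chain: "\<bar>K s t\<bar> \<le> 2 * \<delta> * Q s t" if "0 < \<delta>" "s \<in> G" "t \<in> G" "s \<le> t" "t - s < real m * \<delta>" for \<delta> s t and m :: nat
    using that
  proof (induction m arbitrary: s)
    case (Suc m)
    show ?case
    proof (cases "t - s \<le> 2 * \<delta>")
      case True
      have "\<bar>K s t\<bar> \<le> (t - s) * Q s t" by (rule KQ) (use Suc in auto)
      also have "\<dots> \<le> 2 * \<delta> * Q s t" by (rule mult_right_mono[OF True Q0])
      finally show ?thesis .
    next
      case False
      have s: "0 < s" "t < \<tau>" using good[OF Suc.prems(2)] good[OF Suc.prems(3)] by (auto simp: good_def)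
      obtain r where r: "s + \<delta> < r" "r < s + 2 * \<delta>" "r \<in> G"
        using dense[of "s + \<delta>" "s + 2 * \<delta>"] Suc.prems(1) s False by auto
      have sr: "s \<le> r" "r \<le> t" using r False Suc.prems(1) by auto
      have "\<bar>K r t\<bar> \<le> 2 * \<delta> * Q r t"
        by (rule Suc.IH) (use Suc.prems r sr in \<open>auto simp: algebra_simps\<close>)
      moreover have "\<bar>K s r\<bar> \<le> 2 * \<delta> * Q s r"
        by (rule order_trans[OF KQ[OF Suc.prems(2) r(3) sr(1)] mult_right_mono[OF _ Q0]]) (use r in simp)
      moreover have "K s t = K s r + K r t" unfolding K_def by (rule set_int_split[OF Gint sr])
      moreover have "Q s t = Q s r + Q r t" unfolding Q_def by (rule set_int_split[OF v2 sr])
      ultimately show ?thesis by (simp add: distrib_left)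
    qed
  qed simp
  have K0: "K s t = 0" if st: "s \<in> G" "t \<in> G" "s \<le> t" for s t
  proof -
    have "\<bar>K s t\<bar> \<le> e" if e: "0 < e" for e
    proof -
      define \<delta> where "\<delta> = e / (2 * (Q s t + 1))"
      have \<delta>: "0 < \<delta>" using e Q0[of s t] by (simp add: \<delta>_def)
      obtain m :: nat where "t - s < real m * \<delta>" using reals_Archimedean3[OF \<delta>] by blast
      from chain[OF \<delta> st this] have "\<bar>K s t\<bar> \<le> 2 * \<delta> * Q s t" .
      also have "\<dots> \<le> 2 * \<delta> * (Q s t + 1)" using \<delta> by simp
      also have "\<dots> = e"
      proof -
        have "0 < Q s t + 1" using Q0[of s t] by simp
        then show ?thesis unfolding \<delta>_def by (simp add: field_simps)
      qed
      finally show ?thesis .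
    qed
    then have "\<bar>K s t\<bar> \<le> 0" by (rule field_le_epsilon[of _ 0, simplified]) simp
    then show ?thesis by simp
  qed
  obtain g where g: "g \<in> G" using dense[of 0 \<tau>] \<tau> by auto
  have "AE t in L. ip (w t) (v t) = 0"
  proof (rule AE_zero_of_dense_primitive[OF \<tau> Gint, of "K 0 g"])
    fix p q assume pq: "0 \<le> p" "p < q" "q \<le> \<tau>"
    obtain r where r: "p < r" "r < q" "r \<in> G" using dense[OF pq] by auto
    have pos: "0 \<le> r" "0 \<le> g" using good[OF g] good[OF r(3)] by (auto simp: good_def)
    have "K 0 r = K 0 g"
    proof (cases "g \<le> r")
      case True
      then show ?thesis using set_int_split[OF Gint pos(2) True] K0[OF g r(3) True] by (simp add: K_def)
    next
      case False
      then have "r \<le> g" by simp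
      then show ?thesis using set_int_split[OF Gint pos(1) \<open>r \<le> g\<close>] K0[OF r(3) g \<open>r \<le> g\<close>] by (simp add: K_def)
    qed
    then show "\<exists>t. p < t \<and> t < q \<and> set_lebesgue_integral L {0<..t} (\<lambda>t. ip (w t) (v t)) = K 0 g"
      using r by (auto simp: K_def)
  qed
  then show ?thesis by (simp add: w_def)
qed

end

lemma time_interval_borel: "time_interval T \<in> sets borel"
  unfolding time_interval_def by measurable

text \<open>
  The local spaces in time make statements on each \<open>{0<..<\<tau>}\<close>; rational \<open>\<tau>\<close> exhaust the time interval.
\<close>

lemma AE_time_intervalI:
  assumes "\<And>\<tau>. 0 < \<tau> \<Longrightarrow> ereal \<tau> < T \<Longrightarrow> AE t in lebesgue_on {0<..<\<tau>}. P t"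
  shows "AE t in lebesgue_on (time_interval T). P t"
proof -
  define R where "R = {r :: rat. 0 < (of_rat r :: real) \<and> ereal (of_rat r) < T}"
  have "AE t in lborel. \<forall>r\<in>R. t \<in> {0<..<of_rat r} \<longrightarrow> P t"
    unfolding AE_ball_countable[OF countableI_type]
  proof
    fix r assume "r \<in> R"
    then show "AE t in lborel. t \<in> {0<..<of_rat r} \<longrightarrow> P t"
      using assms[of "of_rat r"] by (simp add: R_def AE_lebesgue_on_iff_lborel)
  qed
  then have "AE t in lborel. t \<in> time_interval T \<longrightarrow> P t"
  proof eventually_elim
    case (elim t)
    show ?case
    proof
      assume t: "t \<in> time_interval T"
      then obtain r :: rat where r: "ereal t < ereal (of_rat r)" "ereal (of_rat r) < T"
        using ereal_dense3[of "ereal t" T] by (auto simp: time_interval_def)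
      have "0 < t" using t by (simp add: time_interval_def)
      also have "t < of_rat r" using r(1) by simp
      finally have "r \<in> R" using r(2) by (simp add: R_def)
      then show "P t" using elim r t by (auto simp: time_interval_def)
    qed
  qed
  then show ?thesis by (simp add: AE_lebesgue_on_iff_lborel[OF time_interval_borel])
qed

lemma Ioo_subset_time_interval: "ereal \<tau> < T \<Longrightarrow> {0<..<\<tau>} \<subseteq> time_interval T"
proof
  fix t assume T: "ereal \<tau> < T" and t: "t \<in> {0<..<\<tau>}"
  from t have "ereal t < ereal \<tau>" by simp
  also note T
  finally show "t \<in> time_interval T" using t by (simp add: time_interval_def)
qed

lemma AE_time_intervalD:
  assumes "AE t in lebesgue_on (time_interval T). P t" "ereal \<tau> < T"
  shows "AE t in lebesgue_on {0<..<\<tau>}. P t"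
proof -
  note sub = Ioo_subset_time_interval[OF assms(2)]
  have "AE t in lborel. t \<in> time_interval T \<longrightarrow> P t"
    using assms(1) by (simp add: AE_lebesgue_on_iff_lborel[OF time_interval_borel])
  then have "AE t in lborel. t \<in> {0<..<\<tau>} \<longrightarrow> P t" by eventually_elim (use sub in blast)
  then show ?thesis by (subst AE_lebesgue_on_iff_lborel) simp_all
qed

lemma integral_lebesgue_on_subset:
  fixes f :: "real \<Rightarrow> real"
  assumes "J \<in> sets borel" "K \<in> sets borel" "J \<subseteq> K" "\<And>t. t \<notin> J \<Longrightarrow> f t = 0"
  shows "(LINT t|lebesgue_on K. f t) = (LINT t|lebesgue_on J. f t)"
proof -
  have "(LINT t|lebesgue_on K. f t) = (LINT t|lebesgue. indicator K t *\<^sub>R f t)"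
    using assms by (intro integral_restrict_space) auto
  also have "\<dots> = (LINT t|lebesgue. indicator J t *\<^sub>R f t)"
    by (intro Bochner_Integration.integral_cong refl) (use assms in \<open>auto split: split_indicator\<close>)
  also have "\<dots> = (LINT t|lebesgue_on J. f t)"
    using assms by (intro integral_restrict_space[symmetric]) auto
  finally show ?thesis .
qed

text \<open>
  \<open>time_orthogonal\<close> is applied to the indicators of \<open>{a<..r}\<close> with rational \<open>r\<close>, so that one null set
  of times is enough.
\<close>

lemma time_derivative_orthogonal:
  fixes u :: "real \<Rightarrow> real \<Rightarrow> 'a::euclidean_space"
  assumes ab: "a < b" and I: "I = {a<..<b}"
    and uv: "has_time_deriv I T u v"
    and unit: "AE t in lebesgue_on (time_interval T). AE x in lebesgue_on I. norm (u t x) = 1"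
  shows "AE t in lebesgue_on (time_interval T). L2 I (v t) \<and> (AE x in lebesgue_on I. u t x \<bullet> v t x = 0)"
proof (rule AE_time_intervalI)
  fix \<tau> :: real assume \<tau>: "0 < \<tau>" "ereal \<tau> < T"
  let ?J = "{0<..<\<tau>}"
  have u: "strongly_measurable_L2 ?J I u" "integrable (lebesgue_on ?J) (\<lambda>t. (L2_norm I (u t))\<^sup>2)"
    and v: "strongly_measurable_L2 ?J I v" "integrable (lebesgue_on ?J) (\<lambda>t. (L2_norm I (v t))\<^sup>2)"
    using uv \<tau> unfolding has_time_deriv_def L2_loc_L2_def by blast+
  note sub = Ioo_subset_time_interval[OF \<tau>(2)]
  have weak: "(LINT t|lebesgue_on ?J. deriv \<phi> t * (LINT x|lebesgue_on I. u t x \<bullet> \<eta> x))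
      = - (LINT t|lebesgue_on ?J. \<phi> t * (LINT x|lebesgue_on I. v t x \<bullet> \<eta> x))"
    if \<phi>: "\<phi> \<in> C1_c ?J" and \<eta>: "L2 I \<eta>" for \<phi> \<eta>
  proof -
    obtain c d where cd: "0 < c" "c < d" "d < \<tau>" "\<And>x. x \<le> c \<Longrightarrow> \<phi> x = 0" "\<And>x. d \<le> x \<Longrightarrow> \<phi> x = 0"
      "\<And>x. (\<phi> has_real_derivative deriv \<phi> x) (at x)" "continuous_on UNIV (deriv \<phi>)"
      "\<And>x. x < c \<Longrightarrow> deriv \<phi> x = 0" "\<And>x. d < x \<Longrightarrow> deriv \<phi> x = 0"
      using C1_c_margin[OF \<phi> \<tau>(1)] by blast
    have z: "\<phi> t = 0" "deriv \<phi> t = 0" if "t \<notin> ?J" for t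
    proof -
      have "t < c \<or> d < t" using that cd by auto
      then show "\<phi> t = 0" "deriv \<phi> t = 0" using cd(4,5,8,9)[of t] by auto
    qed
    have "\<phi> \<in> C1_c (time_interval T)" using \<phi> sub unfolding C1_c_def by blast
    then have "(LINT t|lebesgue_on (time_interval T). deriv \<phi> t * (LINT x|lebesgue_on I. u t x \<bullet> \<eta> x))
        = - (LINT t|lebesgue_on (time_interval T). \<phi> t * (LINT x|lebesgue_on I. v t x \<bullet> \<eta> x))"
      using uv \<eta> unfolding has_time_deriv_def by blast
    moreover have "(LINT t|lebesgue_on (time_interval T). deriv \<phi> t * (LINT x|lebesgue_on I. u t x \<bullet> \<eta> x))
        = (LINT t|lebesgue_on ?J. deriv \<phi> t * (LINT x|lebesgue_on I. u t x \<bullet> \<eta> x))"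
      by (rule integral_lebesgue_on_subset[OF _ time_interval_borel sub]) (use z in auto)
    moreover have "(LINT t|lebesgue_on (time_interval T). \<phi> t * (LINT x|lebesgue_on I. v t x \<bullet> \<eta> x))
        = (LINT t|lebesgue_on ?J. \<phi> t * (LINT x|lebesgue_on I. v t x \<bullet> \<eta> x))"
      by (rule integral_lebesgue_on_subset[OF _ time_interval_borel sub]) (use z in auto)
    ultimately show ?thesis by simp
  qed
  have unit': "AE t in lebesgue_on ?J. AE x in lebesgue_on I. norm (u t x) = 1"
    by (rule AE_time_intervalD[OF unit \<tau>(2)])
  have "AE t in lebesgue_on ?J. \<forall>r::rat. (LINT x|lebesgue_on I. (indicator {a<..of_rat r} x *\<^sub>R u t x) \<bullet> v t x) = 0"
    unfolding AE_all_countable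
  proof
    fix r :: rat
    show "AE t in lebesgue_on ?J. (LINT x|lebesgue_on I. (indicator {a<..of_rat r} x *\<^sub>R u t x) \<bullet> v t x) = 0"
    proof (rule time_orthogonal[OF \<tau>(1) u(1) v(1) u(2) v(2) _ unit'])
      show "(\<lambda>x. indicator {a<..of_rat r} x :: real) \<in> borel_measurable (lebesgue_on I)"
        by (rule borel_measurable_lebesgue_on) simp
      show "\<bar>indicator {a<..of_rat r} x :: real\<bar> \<le> 1" for x by (simp split: split_indicator)
    qed (rule weak)
  qed
  moreover have "AE t in lebesgue_on ?J. L2 I (u t)" "AE t in lebesgue_on ?J. L2 I (v t)"
    using u(1) v(1) unfolding strongly_measurable_L2_def by auto
  ultimately show "AE t in lebesgue_on ?J. L2 I (v t) \<and> (AE x in lebesgue_on I. u t x \<bullet> v t x = 0)"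
  proof eventually_elim
    case (elim t)
    have "AE x in lebesgue_on {a<..<b}. u t x \<bullet> v t x = 0"
    proof (rule AE_zero_of_dense_primitive[OF ab, of _ 0])
      show "integrable (lebesgue_on {a<..<b}) (\<lambda>x. u t x \<bullet> v t x)" using L2_inner[OF elim(2,3)] unfolding I .
      fix p q assume "a \<le> p" "p < q" "q \<le> b"
      then obtain r :: rat where r: "p < of_rat r" "of_rat r < q" using of_rat_dense by blast
      have "set_lebesgue_integral (lebesgue_on {a<..<b}) {a<..of_rat r} (\<lambda>x. u t x \<bullet> v t x) = 0"
        using elim(1)[rule_format, of r] unfolding I set_lebesgue_integral_def by simp
      then show "\<exists>s. p < s \<and> s < q \<and> (LINT x:{a<..s}|lebesgue_on {a<..<b}. u t x \<bullet> v t x) = 0"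
        using r by blast
    qed
    then show ?case using elim(3) unfolding I by blast
  qed
qed

section \<open>The equivalence at a fixed time\<close>

definition strong_conditions ::
    "real set \<Rightarrow> (real \<Rightarrow> 'a::euclidean_space) \<Rightarrow> (real \<Rightarrow> 'a) \<Rightarrow> (real \<Rightarrow> 'a) \<Rightarrow> bool" where
  "strong_conditions I v w z \<longleftrightarrow>
     (AE x in lebesgue_on I. v x = tproj (w x) (ac_deriv I z x)) \<and>
     (\<forall>A\<in>borel_sets I. set_lebesgue_integral (total_variation I (cantor_part I z)) A
        (\<lambda>x. tproj (rep I w x) (polar I (cantor_part I z) x)) = 0) \<and>
     (\<forall>x\<in>I. trL I z x \<in> tangent (trL I w x) \<and> trR I z x \<in> tangent (trR I w x)) \<and>
     norm_le_one I z \<and>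
     (AE x in total_variation I (diffuse_part I w).
        rep I z x = vRN_deriv (total_variation I (Dm I w)) (Dm I w) x) \<and>
     jump_set I z \<subseteq> jump_set I w \<and>
     (\<forall>x\<in>jump_set I w. trL I z x = Tminus I w x \<and> trR I z x = Tplus I w x) \<and>
     zero_on_boundary I z"

definition measure_conditions ::
    "real set \<Rightarrow> (real \<Rightarrow> real ^ 'n) \<Rightarrow> (real \<Rightarrow> real ^ 'n) \<Rightarrow> (real \<Rightarrow> real ^ 'n) \<Rightarrow> bool" where
  "measure_conditions I v w z \<longleftrightarrow>
     norm_le_one I z \<and> zero_on_boundary I z \<and>
     (\<forall>A\<in>borel_sets I. set_lebesgue_integral (lebesgue_on I) A v =
        Dm I z A + set_lebesgue_integral (total_variation I (Dm I w)) A
          (\<lambda>x. (1 / norm (mid I w x)) *\<^sub>R mid I w x)) \<and>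
     has_weak_deriv_L2 I (\<lambda>x. wedge (z x) (w x)) (\<lambda>x. wedge (v x) (w x)) \<and>
     (AE x in lebesgue_on I. z x \<bullet> w x = 0)"

lemma bounded_bilinear_wedge: "bounded_bilinear (wedge :: real ^ 'n \<Rightarrow> real ^ 'n \<Rightarrow> real ^ 'n ^ 'n)"
  unfolding bilinear_conv_bounded_bilinear[symmetric] bilinear_def
  by (intro conjI allI linearI) (auto simp: wedge_def vec_eq_iff algebra_simps)

interpretation wedge: bounded_bilinear "wedge :: real ^ 'n \<Rightarrow> real ^ 'n \<Rightarrow> real ^ 'n ^ 'n"
  by (rule bounded_bilinear_wedge)

lemma wedge_self [simp]: "wedge x x = 0"
  by (simp add: wedge_def vec_eq_iff)

lemma wedge_commute: "wedge x y = - wedge y x"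
  by (simp add: wedge_def vec_eq_iff)

lemma wedge_geodesic_dir: "wedge (- geodesic_dir q p) q = wedge (geodesic_dir p q) p"
  by (simp add: geodesic_dir_def wedge.scaleR_left wedge.minus_left wedge.diff_left wedge_commute[of p q] inner_commute)

lemma tproj_scaleR: "tproj p (c *\<^sub>R v) = c *\<^sub>R tproj p v"
  by (simp add: tproj_def scaleR_diff_right)

lemma norm_tproj_le: "norm p = 1 \<Longrightarrow> norm (tproj p v) \<le> 2 * norm v"
proof -
  assume p: "norm p = 1"
  have "norm (tproj p v) \<le> norm v + norm ((p \<bullet> v) *\<^sub>R p)" unfolding tproj_def by (rule norm_triangle_ineq4)
  also have "norm ((p \<bullet> v) *\<^sub>R p) \<le> norm v" using Cauchy_Schwarz_ineq2[of p v] p by simp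
  finally show ?thesis by simp
qed

text \<open>
  The closure of \<open>pos_sphere\<close>, which is where the one-sided limits lie. Two of its points have a
  nonnegative inner product, so they are never antipodal.
\<close>

definition closed_orthant_sphere :: "(real ^ 'n) set" where
  "closed_orthant_sphere = {y. norm y = 1 \<and> (\<forall>k. 0 \<le> y $ k)}"

lemma closed_closed_orthant_sphere: "closed closed_orthant_sphere"
  unfolding closed_orthant_sphere_def
  by (intro closed_Collect_conj closed_Collect_all closed_Collect_eq closed_Collect_le continuous_intros)

lemma closed_orthant_sphereD:
  "p \<in> closed_orthant_sphere \<Longrightarrow> norm p = 1"
  "p \<in> closed_orthant_sphere \<Longrightarrow> q \<in> closed_orthant_sphere \<Longrightarrow> 0 \<le> p \<bullet> q"
  by (auto simp: closed_orthant_sphere_def inner_vec_def intro!: sum_nonneg)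

text \<open>
  The data at a fixed time. \<open>v'\<close> is a Borel version of the time derivative \<open>v\<close>.
\<close>

locale sphere_pair =
  W: bv_density a b M l w \<alpha> + Z: bv_density a b M l z \<beta>
  for a b :: real and M l and w :: "real \<Rightarrow> real ^ 'n" and \<alpha>
    and z :: "real \<Rightarrow> real ^ 'n" and \<beta> +
  fixes v v' :: "real \<Rightarrow> real ^ 'n"
  assumes sphere: "AE x in lebesgue_on {a<..<b}. w x \<in> pos_sphere"
    and v: "L2 {a<..<b} v" and v': "v' \<in> borel_measurable borel" "AE x in lebesgue_on {a<..<b}. v x = v' x"
begin

abbreviation "p \<equiv> W.left_trace"
abbreviation "q \<equiv> W.right_trace"
abbreviation "zl \<equiv> Z.left_trace"
abbreviation "zr \<equiv> Z.right_trace"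
abbreviation "JW \<equiv> jump_set W.I w"
abbreviation "JZ \<equiv> jump_set W.I z"

lemma traces_orthant: "x \<in> W.I \<Longrightarrow> p x \<in> closed_orthant_sphere" "x \<in> W.I \<Longrightarrow> q x \<in> closed_orthant_sphere"
proof -
  have "AE x in lebesgue_on W.I. w x \<in> closed_orthant_sphere"
    using sphere by eventually_elim (auto simp: pos_sphere_def closed_orthant_sphere_def less_imp_le)
  from W.traces_in_closed[OF this closed_closed_orthant_sphere]
  show "x \<in> W.I \<Longrightarrow> p x \<in> closed_orthant_sphere" "x \<in> W.I \<Longrightarrow> q x \<in> closed_orthant_sphere" by auto
qed

lemma unit: "x \<in> W.I \<Longrightarrow> norm (p x) = 1" "x \<in> W.I \<Longrightarrow> norm (q x) = 1"
  using traces_orthant closed_orthant_sphereD(1) by blast+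

lemma inner_nonneg: "x \<in> W.I \<Longrightarrow> 0 \<le> p x \<bullet> q x"
  using traces_orthant closed_orthant_sphereD(2) by blast

lemma JW_iff: "x \<in> W.I \<Longrightarrow> x \<in> JW \<longleftrightarrow> p x \<noteq> q x"
  by (simp add: jump_set_def W.trL_eq W.trR_eq)

lemma JZ_iff: "x \<in> W.I \<Longrightarrow> x \<in> JZ \<longleftrightarrow> zl x \<noteq> zr x"
  by (simp add: jump_set_def Z.trL_eq Z.trR_eq)

lemma inner_less_1: "x \<in> JW \<Longrightarrow> \<bar>p x \<bullet> q x\<bar> < 1"
proof -
  assume x: "x \<in> JW"
  then have I: "x \<in> W.I" using W.jump_set_sub by blast
  have "p x \<noteq> q x" using x JW_iff[OF I] by simp
  from unit_inner_less_1[OF unit[OF I] this] show ?thesis using inner_nonneg[OF I] by simp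
qed

text \<open>
  This is \<open>w\<^sup>* / |w\<^sup>*|\<close>, expressed by the one-sided limits.
\<close>

definition "mid_dir x = (1 / norm (p x + q x)) *\<^sub>R (p x + q x)"

lemma mid_direction: "x \<in> W.I \<Longrightarrow> (1 / norm (mid W.I w x)) *\<^sub>R mid W.I w x = mid_dir x"
  by (simp add: mid_def W.trL_eq W.trR_eq mid_dir_def add.commute)

lemma mid_dir_off: "x \<in> W.I \<Longrightarrow> x \<notin> JW \<Longrightarrow> mid_dir x = q x"
proof -
  assume x: "x \<in> W.I" "x \<notin> JW"
  then have "p x = q x" using JW_iff by blast
  moreover have "norm (q x + q x) = 2" using unit(2)[OF x(1)] by (simp flip: scaleR_2)
  ultimately show ?thesis by (simp add: mid_dir_def flip: scaleR_2)
qed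

lemma mid_dir_measurable: "mid_dir \<in> borel_measurable M"
proof -
  have "mid_dir \<in> borel_measurable borel" unfolding mid_dir_def[abs_def] using W.right_trace_measurable W.left_trace_measurable by measurable
  then show ?thesis by (rule borel_measurable_on_borel_sets[OF W.sets])
qed

lemma v'_measurable: "v' \<in> borel_measurable M" by (rule borel_measurable_on_borel_sets[OF W.sets v'(1)])

lemma q_measurable: "q \<in> borel_measurable M" by (rule borel_measurable_on_borel_sets[OF W.sets W.right_trace_measurable])

lemma JW_atom: "x \<in> JW \<Longrightarrow> measure M {x} \<noteq> 0" "x \<in> JW \<Longrightarrow> l x = 0"
proof -
  show "x \<in> JW \<Longrightarrow> measure M {x} \<noteq> 0" by (auto simp: W.jump_set_eq)
  then show "x \<in> JW \<Longrightarrow> l x = 0" using W.atom_density_zero W.jump_set_sub by (metis mult_eq_0_iff subsetD)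
qed

lemma JZ_density_zero: "x \<in> JZ \<Longrightarrow> l x = 0"
proof -
  assume x: "x \<in> JZ"
  then have "measure M {x} \<noteq> 0" "x \<in> W.I" by (auto simp: Z.jump_set_eq)
  then show ?thesis using W.atom_density_zero by fastforce
qed

text \<open>
  \<open>rep\<close> differs from the right limit on a countable set. Off the jump set of \<open>z\<close> the density \<open>\<beta>\<close>
  vanishes at every atom, so the difference is invisible to the diffuse part of the derivative of \<open>z\<close>.
\<close>

lemma rep_w_eq: "AE x in M. x \<notin> JZ \<longrightarrow> rep W.I w x \<noteq> q x \<longrightarrow> \<beta> x = 0"
proof -
  have "AE x in M. x \<in> {x \<in> W.I. rep W.I w x \<noteq> q x} \<longrightarrow> x \<notin> JZ \<longrightarrow> \<beta> x = 0"
    by (rule W.AE_countable[OF W.countable_rep_neq]) (auto simp: Z.jump_set_eq)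
  moreover have "AE x in M. x \<in> W.I" by (rule AE_I2) (simp add: W.space_M)
  ultimately show ?thesis by eventually_elim auto
qed

lemma rep_z_eq: "AE x in M. x \<notin> JW \<longrightarrow> rep W.I z x \<noteq> zr x \<longrightarrow> \<alpha> x = 0"
proof -
  have "AE x in M. x \<in> {x \<in> W.I. rep W.I z x \<noteq> zr x} \<longrightarrow> x \<notin> JW \<longrightarrow> \<alpha> x = 0"
    by (rule W.AE_countable[OF Z.countable_rep_neq]) (auto simp: W.jump_set_eq)
  moreover have "AE x in M. x \<in> W.I" by (rule AE_I2) (simp add: W.space_M)
  ultimately show ?thesis by eventually_elim auto
qed

lemma rep_w_measurable: "rep W.I w \<in> borel_measurable M"
proof (rule measurable_discrete_difference[OF q_measurable W.countable_rep_neq])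
  show "\<And>x. x \<in> {x \<in> W.I. rep W.I w x \<noteq> q x} \<Longrightarrow> {x} \<in> sets M" using W.singleton_sets by blast
  show "\<And>x. x \<in> space M \<Longrightarrow> x \<notin> {x \<in> W.I. rep W.I w x \<noteq> q x} \<Longrightarrow> q x = rep W.I w x"
    by (auto simp: W.space_M)
qed simp

lemma diffuse_condition_iff:
  "(AE x in total_variation W.I (diffuse_part W.I w).
      rep W.I z x = vRN_deriv (total_variation W.I (Dm W.I w)) (Dm W.I w) x) \<longleftrightarrow>
   (AE x in M. x \<notin> JW \<longrightarrow> norm (\<alpha> x) *\<^sub>R zr x = \<alpha> x)" (is "?L \<longleftrightarrow> ?R")
proof -
  have "?L \<longleftrightarrow> (AE x in M. x \<notin> JW \<longrightarrow> \<alpha> x \<noteq> 0 \<longrightarrow> rep W.I z x = polar W.I (Dm W.I w) x)"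
    unfolding W.AE_diffuse_iff polar_def ..
  also have "\<dots> \<longleftrightarrow> ?R"
  proof
    assume "AE x in M. x \<notin> JW \<longrightarrow> \<alpha> x \<noteq> 0 \<longrightarrow> rep W.I z x = polar W.I (Dm W.I w) x"
    with rep_z_eq W.polar_Dm(2) show ?R by eventually_elim (metis norm_zero scaleR_zero_left)
  next
    assume ?R
    with rep_z_eq W.polar_Dm(2) show "AE x in M. x \<notin> JW \<longrightarrow> \<alpha> x \<noteq> 0 \<longrightarrow> rep W.I z x = polar W.I (Dm W.I w) x"
    proof eventually_elim
      case (elim x)
      show ?case
      proof (intro impI)
        assume x: "x \<notin> JW" "\<alpha> x \<noteq> 0"
        have "norm (\<alpha> x) *\<^sub>R zr x = norm (\<alpha> x) *\<^sub>R polar W.I (Dm W.I w) x" using elim x by simp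
        then show "rep W.I z x = polar W.I (Dm W.I w) x" using elim(1) x by simp
      qed
    qed
  qed
  finally show ?thesis .
qed

text \<open>
  The absolutely continuous part gives the equation where \<open>l > 0\<close>, the Cantor part gives it on the
  Lebesgue null set \<open>S\<close>, where \<open>l = 0\<close> and the equation says \<open>\<pi>\<^sub>q \<beta> = 0\<close>.
\<close>

lemma evolution_condition_iff:
  "((AE x in lebesgue_on W.I. v x = tproj (w x) (ac_deriv W.I z x)) \<and>
    (\<forall>A\<in>borel_sets W.I. set_lebesgue_integral (total_variation W.I (cantor_part W.I z)) A
        (\<lambda>x. tproj (rep W.I w x) (polar W.I (cantor_part W.I z) x)) = 0)) \<longleftrightarrow>
   (AE x in M. x \<notin> JZ \<longrightarrow> l x *\<^sub>R v' x = tproj (q x) (\<beta> x))" (is "?ac \<and> ?c \<longleftrightarrow> ?R")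
proof -
  obtain f S where f: "f \<in> borel_measurable borel" and S: "S \<in> sets borel"
    and fa: "AE x in lebesgue_on W.I. ac_deriv W.I z x = f x"
    and off: "AE x in M. x \<notin> S \<longrightarrow> \<beta> x = l x *\<^sub>R f x"
    and on: "AE x in M. x \<in> S \<longrightarrow> l x = 0"
    and cantor: "\<And>A. A \<in> borel_sets W.I \<Longrightarrow>
       cantor_part W.I z A = set_lebesgue_integral M A (\<lambda>x. indicator (S - JZ) x *\<^sub>R \<beta> x)"
    using Z.lebesgue_decomposition by blast
  define g where "g x = indicator (S - JZ) x *\<^sub>R \<beta> x" for x
  have g: "integrable M g" unfolding g_def[abs_def]
    by (rule W.integrable_indicator_scaleR[OF _ Z.\<alpha>]) (use S Z.jump_set_borel in auto)
  have cg: "\<And>A. A \<in> borel_sets W.I \<Longrightarrow> cantor_part W.I z A = set_lebesgue_integral M A g"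
    unfolding g_def[abs_def] by (rule cantor)
  have gm: "g \<in> borel_measurable M" using g by simp
  have TV: "total_variation W.I (cantor_part W.I z) = density M (\<lambda>x. ennreal (norm (g x)))"
    by (rule total_variation_density[OF W.fin W.sets g cg])
  define r where "r = polar W.I (cantor_part W.I z)"
  have rm: "r \<in> borel_measurable M" and rg: "AE x in M. norm (g x) *\<^sub>R r x = g x"
    unfolding r_def using polar_density[OF W.fin W.sets g cg] by auto
  have tm: "(\<lambda>x. tproj (q x) (g x)) \<in> borel_measurable M"
    unfolding tproj_def using q_measurable gm by measurable
  have ti: "integrable M (\<lambda>x. tproj (q x) (g x))"
  proof (rule Bochner_Integration.integrable_bound[OF integrable_scaleR_right[OF g, of 2] tm])
    show "AE x in M. norm (tproj (q x) (g x)) \<le> norm (2 *\<^sub>R g x)"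
      by (rule AE_I2) (use norm_tproj_le[OF unit(2)] in \<open>auto simp: W.space_M\<close>)
  qed
  have int_eq: "set_lebesgue_integral (total_variation W.I (cantor_part W.I z)) A (\<lambda>x. tproj (rep W.I w x) (r x))
      = set_lebesgue_integral M A (\<lambda>x. tproj (q x) (g x))" if A: "A \<in> borel_sets W.I" for A
  proof -
    have AM: "A \<in> sets M" using A W.sets by simp
    have hm: "(\<lambda>x. indicator A x *\<^sub>R tproj (rep W.I w x) (r x)) \<in> borel_measurable M"
      unfolding tproj_def using AM rep_w_measurable rm by measurable
    have "set_lebesgue_integral (total_variation W.I (cantor_part W.I z)) A (\<lambda>x. tproj (rep W.I w x) (r x))
        = (LINT x|M. norm (g x) *\<^sub>R indicator A x *\<^sub>R tproj (rep W.I w x) (r x))"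
      unfolding TV set_lebesgue_integral_def using gm by (subst integral_density[OF hm]) auto
    also have "\<dots> = (LINT x|M. indicator A x *\<^sub>R tproj (q x) (g x))"
    proof (rule integral_cong_AE)
      show "(\<lambda>x. norm (g x) *\<^sub>R indicator A x *\<^sub>R tproj (rep W.I w x) (r x)) \<in> borel_measurable M"
        using gm hm by measurable
      show "(\<lambda>x. indicator A x *\<^sub>R tproj (q x) (g x)) \<in> borel_measurable M" using AM tm by measurable
      show "AE x in M. norm (g x) *\<^sub>R indicator A x *\<^sub>R tproj (rep W.I w x) (r x) = indicator A x *\<^sub>R tproj (q x) (g x)"
        using rg rep_w_eq
      proof eventually_elim
        case (elim x)
        have "norm (g x) *\<^sub>R indicator A x *\<^sub>R tproj (rep W.I w x) (r x) = indicator A x *\<^sub>R tproj (rep W.I w x) (norm (g x) *\<^sub>R r x)"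
          by (simp add: tproj_scaleR)
        also have "\<dots> = indicator A x *\<^sub>R tproj (q x) (g x)"
        proof (cases "g x = 0")
          case True then show ?thesis by (simp add: tproj_def)
        next
          case False
          then have "x \<notin> JZ" "\<beta> x \<noteq> 0" by (auto simp: g_def)
          then show ?thesis using elim by simp
        qed
        finally show ?case .
      qed
    qed
    finally show ?thesis unfolding set_lebesgue_integral_def .
  qed
  have c_iff: "?c \<longleftrightarrow> (AE x in M. tproj (q x) (g x) = 0)"
  proof
    assume c: ?c
    show "AE x in M. tproj (q x) (g x) = 0"
    proof (rule W.density_zero[OF ti])
      fix A assume "A \<in> sets M"
      then have A: "A \<in> borel_sets W.I" using W.sets by simp
      show "(LINT x:A|M. tproj (q x) (g x)) = 0" using c A int_eq[OF A] unfolding r_def by simp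
    qed
  next
    assume z: "AE x in M. tproj (q x) (g x) = 0"
    show ?c
    proof
      fix A assume A: "A \<in> borel_sets W.I"
      have "(LINT x:A|M. tproj (q x) (g x)) = 0" unfolding set_lebesgue_integral_def
        by (rule integral_eq_zero_AE) (use z in eventually_elim, simp)
      then show "set_lebesgue_integral (total_variation W.I (cantor_part W.I z)) A
        (\<lambda>x. tproj (rep W.I w x) (polar W.I (cantor_part W.I z) x)) = 0"
        using int_eq[OF A] unfolding r_def by simp
    qed
  qed
  have "?ac \<longleftrightarrow> (AE x in lebesgue_on W.I. v' x = tproj (q x) (f x))"
  proof
    assume ?ac
    with fa v'(2) W.eq_right_trace show "AE x in lebesgue_on W.I. v' x = tproj (q x) (f x)" by eventually_elim simp
  next
    assume "AE x in lebesgue_on W.I. v' x = tproj (q x) (f x)"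
    with fa v'(2) W.eq_right_trace show ?ac by eventually_elim simp
  qed
  then have ac_iff: "?ac \<longleftrightarrow> (AE x in M. 0 < l x \<longrightarrow> v' x = tproj (q x) (f x))" by (simp add: W.AE_lebesgue_iff)
  show ?thesis unfolding ac_iff c_iff
  proof
    assume "(AE x in M. 0 < l x \<longrightarrow> v' x = tproj (q x) (f x)) \<and> (AE x in M. tproj (q x) (g x) = 0)"
    then have "AE x in M. 0 < l x \<longrightarrow> v' x = tproj (q x) (f x)" "AE x in M. tproj (q x) (g x) = 0" by auto
    with off on show ?R
    proof eventually_elim
      case (elim x)
      show ?case
      proof
        assume "x \<notin> JZ"
        show "l x *\<^sub>R v' x = tproj (q x) (\<beta> x)"
        proof (cases "x \<in> S")
          case True
          then have "g x = \<beta> x" using \<open>x \<notin> JZ\<close> by (simp add: g_def)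
          then show ?thesis using elim True by simp
        next
          case False
          then have b: "\<beta> x = l x *\<^sub>R f x" using elim by simp
          show ?thesis
          proof (cases "l x = 0")
            case True then show ?thesis unfolding b by (simp add: tproj_def)
          next
            case False
            then have "0 < l x" using W.l(2)[of x] by simp
            then show ?thesis using elim unfolding b by (simp add: tproj_scaleR)
          qed
        qed
      qed
    qed
  next
    assume R: ?R
    from off on R have 1: "AE x in M. 0 < l x \<longrightarrow> v' x = tproj (q x) (f x)"
    proof eventually_elim
      case (elim x)
      show ?case
      proof
        assume lx: "0 < l x"
        then have "x \<notin> S" "x \<notin> JZ" using elim JZ_density_zero by auto
        then have "l x *\<^sub>R v' x = l x *\<^sub>R tproj (q x) (f x)" using elim by (simp add: tproj_scaleR)
        then show "v' x = tproj (q x) (f x)" using lx by simp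
      qed
    qed
    from on R have 2: "AE x in M. tproj (q x) (g x) = 0"
    proof eventually_elim
      case (elim x)
      show ?case
      proof (cases "x \<in> S - JZ")
        case True
        then show ?thesis using elim by (simp add: g_def)
      next
        case False
        then show ?thesis by (simp add: g_def tproj_def)
      qed
    qed
    from 1 2 show "(AE x in M. 0 < l x \<longrightarrow> v' x = tproj (q x) (f x)) \<and> (AE x in M. tproj (q x) (g x) = 0)" ..
  qed
qed

lemma v_integrable: "integrable (lebesgue_on W.I) v"
proof -
  interpret L: finite_measure "lebesgue_on W.I" by (rule finite_measure_lebesgue_on_Ioo)
  have "integrable (lebesgue_on W.I) (\<lambda>x. 1 + (norm (v x))\<^sup>2)" using v by (simp add: L2_def)
  then show ?thesis
  proof (rule Bochner_Integration.integrable_bound)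
    show "v \<in> borel_measurable (lebesgue_on W.I)" using v by (simp add: L2_def)
    show "AE x in lebesgue_on W.I. norm (v x) \<le> norm (1 + (norm (v x))\<^sup>2)"
      using le_one_plus_square by (intro AE_I2) simp
  qed
qed

lemma lv'_integrable: "integrable M (\<lambda>x. l x *\<^sub>R v' x)"
proof -
  have "integrable (lebesgue_on W.I) v'"
    by (rule integrable_cong_AE_imp[OF v_integrable borel_measurable_lebesgue_on[OF v'(1)]])
       (use v'(2) in eventually_elim, simp)
  then show ?thesis by (simp add: W.integrable_lebesgue_iff[OF v'(1)])
qed

lemma measure_equation_iff:
  "(\<forall>A\<in>borel_sets W.I. set_lebesgue_integral (lebesgue_on W.I) A v =
      Dm W.I z A + set_lebesgue_integral (total_variation W.I (Dm W.I w)) A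
        (\<lambda>x. (1 / norm (mid W.I w x)) *\<^sub>R mid W.I w x)) \<longleftrightarrow>
   (AE x in M. l x *\<^sub>R v' x = \<beta> x + norm (\<alpha> x) *\<^sub>R mid_dir x)" (is "?L \<longleftrightarrow> ?R")
proof -
  have mi: "integrable M (\<lambda>x. norm (\<alpha> x) *\<^sub>R mid_dir x)"
  proof (rule Bochner_Integration.integrable_bound[OF W.\<alpha>])
    show "(\<lambda>x. norm (\<alpha> x) *\<^sub>R mid_dir x) \<in> borel_measurable M" using W.\<alpha> mid_dir_measurable by measurable
    have "norm (mid_dir x) \<le> 1" for x by (cases "p x + q x = 0") (simp_all add: mid_dir_def)
    then show "AE x in M. norm (norm (\<alpha> x) *\<^sub>R mid_dir x) \<le> norm (\<alpha> x)"
      by (intro AE_I2) (simp add: mult_left_le)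
  qed
  have ri: "integrable M (\<lambda>x. \<beta> x + norm (\<alpha> x) *\<^sub>R mid_dir x)" using mi Z.\<alpha> by simp
  have lhs: "set_lebesgue_integral (lebesgue_on W.I) A v = set_lebesgue_integral M A (\<lambda>x. l x *\<^sub>R v' x)"
    if A: "A \<in> borel_sets W.I" for A
  proof -
    have im: "(\<lambda>x. indicator A x :: real) \<in> borel_measurable (lebesgue_on W.I)"
      by (rule borel_measurable_lebesgue_on) (use W.borel_sets_subset_borel[OF A] in simp)
    have "set_lebesgue_integral (lebesgue_on W.I) A v = set_lebesgue_integral (lebesgue_on W.I) A v'"
      unfolding set_lebesgue_integral_def
    proof (rule integral_cong_AE)
      show "(\<lambda>x. indicator A x *\<^sub>R v x) \<in> borel_measurable (lebesgue_on W.I)" using im v_integrable by measurable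
      show "(\<lambda>x. indicator A x *\<^sub>R v' x) \<in> borel_measurable (lebesgue_on W.I)"
        using im borel_measurable_lebesgue_on[OF v'(1)] by measurable
      show "AE x in lebesgue_on W.I. indicator A x *\<^sub>R v x = indicator A x *\<^sub>R v' x" using v'(2) by eventually_elim simp
    qed
    then show ?thesis using W.set_integral_lebesgue[OF v'(1) A] by simp
  qed
  have rhs: "Dm W.I z A + set_lebesgue_integral (total_variation W.I (Dm W.I w)) A
        (\<lambda>x. (1 / norm (mid W.I w x)) *\<^sub>R mid W.I w x) = set_lebesgue_integral M A (\<lambda>x. \<beta> x + norm (\<alpha> x) *\<^sub>R mid_dir x)"
    if A: "A \<in> borel_sets W.I" for A
  proof -
    have AM: "A \<in> sets M" using A W.sets by simp
    have \<alpha>m: "\<alpha> \<in> borel_measurable M" using W.\<alpha> by simp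
    have hm: "(\<lambda>x. indicator A x *\<^sub>R mid_dir x) \<in> borel_measurable M" using AM mid_dir_measurable by measurable
    have "set_lebesgue_integral (total_variation W.I (Dm W.I w)) A (\<lambda>x. (1 / norm (mid W.I w x)) *\<^sub>R mid W.I w x)
        = set_lebesgue_integral (total_variation W.I (Dm W.I w)) A mid_dir"
      unfolding set_lebesgue_integral_def
      by (intro Bochner_Integration.integral_cong refl) (simp only: space_total_variation mid_direction)
    also have "\<dots> = (LINT x|M. norm (\<alpha> x) *\<^sub>R indicator A x *\<^sub>R mid_dir x)"
      unfolding W.total_variation_Dm set_lebesgue_integral_def using \<alpha>m by (subst integral_density[OF hm]) auto
    also have "\<dots> = set_lebesgue_integral M A (\<lambda>x. norm (\<alpha> x) *\<^sub>R mid_dir x)"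
      unfolding set_lebesgue_integral_def by (simp add: mult.commute)
    finally show ?thesis unfolding Z.Dm[OF A]
      using integrable_mult_indicator[OF AM Z.\<alpha>] integrable_mult_indicator[OF AM mi]
      by (subst set_integral_add(2)) (auto simp: set_integrable_def)
  qed
  show ?thesis
  proof
    assume L: ?L
    show ?R
    proof (rule W.density_unique_banach[OF lv'_integrable ri])
      fix A assume "A \<in> sets M"
      then have A: "A \<in> borel_sets W.I" using W.sets by simp
      show "(LINT x:A|M. l x *\<^sub>R v' x) = (LINT x:A|M. \<beta> x + norm (\<alpha> x) *\<^sub>R mid_dir x)"
        using L A lhs[OF A] rhs[OF A] by simp
    qed
  next
    assume R: ?R
    show ?L
    proof
      fix A assume A: "A \<in> borel_sets W.I"
      have AM: "A \<in> sets M" using A W.sets by simp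
      have "(LINT x:A|M. l x *\<^sub>R v' x) = (LINT x:A|M. \<beta> x + norm (\<alpha> x) *\<^sub>R mid_dir x)"
        unfolding set_lebesgue_integral_def
      proof (rule integral_cong_AE)
        show "(\<lambda>x. indicator A x *\<^sub>R l x *\<^sub>R v' x) \<in> borel_measurable M" using integrable_mult_indicator[OF AM lv'_integrable] by simp
        show "(\<lambda>x. indicator A x *\<^sub>R (\<beta> x + norm (\<alpha> x) *\<^sub>R mid_dir x)) \<in> borel_measurable M" using integrable_mult_indicator[OF AM ri] by simp
        show "AE x in M. indicator A x *\<^sub>R l x *\<^sub>R v' x = indicator A x *\<^sub>R (\<beta> x + norm (\<alpha> x) *\<^sub>R mid_dir x)"
          using R by eventually_elim simp
      qed
      then show "set_lebesgue_integral (lebesgue_on W.I) A v =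
      Dm W.I z A + set_lebesgue_integral (total_variation W.I (Dm W.I w)) A
        (\<lambda>x. (1 / norm (mid W.I w x)) *\<^sub>R mid W.I w x)" using lhs[OF A] rhs[OF A] by simp
    qed
  qed
qed

lemma tangent_condition_iff:
  "(\<forall>x\<in>W.I. trL W.I z x \<in> tangent (trL W.I w x) \<and> trR W.I z x \<in> tangent (trR W.I w x)) \<longleftrightarrow>
   (AE x in lebesgue_on W.I. z x \<bullet> w x = 0)" (is "?L \<longleftrightarrow> ?R")
proof
  assume L: ?L
  have "AE x in lebesgue_on W.I. x \<in> W.I" by (rule AE_I2) (simp add: space_restrict_space)
  with W.eq_right_trace Z.eq_right_trace show ?R
  proof eventually_elim
    case (elim x)
    have "q x \<bullet> zr x = 0" using L elim(3) unfolding tangent_def by (metis W.trR_eq Z.trR_eq mem_Collect_eq)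
    then show ?case using elim by (simp add: inner_commute)
  qed
next
  assume R: ?R
  from R W.eq_right_trace Z.eq_right_trace have "AE x in lebesgue_on W.I. zr x \<bullet> q x \<in> {0}" by eventually_elim simp
  from AE_limit_left[OF this _ _ _ tendsto_inner[OF Z.right_trace_tendsto(1) W.right_trace_tendsto(1)]]
    AE_limit_right[OF this _ _ _ tendsto_inner[OF Z.right_trace_tendsto(2) W.right_trace_tendsto(2)]]
  have "zl x \<bullet> p x = 0" "zr x \<bullet> q x = 0" if "x \<in> W.I" for x using that by auto
  then show ?L by (simp add: W.trL_eq W.trR_eq Z.trL_eq Z.trR_eq tangent_def inner_commute)
qed

text \<open>
  The last claim is the product rule: all increments of \<open>zr \<bullet> q\<close> vanish, hence so does the density of
  its derivative.
\<close>

lemma orthogonal_traces: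
  assumes R: "AE x in lebesgue_on W.I. z x \<bullet> w x = 0"
  shows "x \<in> W.I \<Longrightarrow> zl x \<bullet> p x = 0" "x \<in> W.I \<Longrightarrow> zr x \<bullet> q x = 0"
    and "AE x in M. zl x \<bullet> \<alpha> x + \<beta> x \<bullet> q x = 0"
proof -
  from R W.eq_right_trace Z.eq_right_trace have ae: "AE x in lebesgue_on W.I. zr x \<bullet> q x \<in> {0}" by eventually_elim simp
  note lims = AE_limit_left[OF ae _ _ _ tendsto_inner[OF Z.right_trace_tendsto(1) W.right_trace_tendsto(1)]]
    AE_limit_right[OF ae _ _ _ tendsto_inner[OF Z.right_trace_tendsto(2) W.right_trace_tendsto(2)]]
  show 1: "x \<in> W.I \<Longrightarrow> zl x \<bullet> p x = 0" "x \<in> W.I \<Longrightarrow> zr x \<bullet> q x = 0" for x using lims[of x] by auto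
  have "zr a \<bullet> q a = 0" using lims(2)[of a] W.ab by simp
  moreover have "zr a = Z.base_value" "q a = W.base_value" by (simp_all add: Z.right_trace_def W.right_trace_def set_lebesgue_integral_def)
  ultimately have c: "Z.base_value \<bullet> W.base_value = 0" by simp
  note P = primitive_product[where cz = Z.base_value and cw = W.base_value, OF bounded_bilinear_inner W.sigma_finite_M W.sets Z.\<alpha> W.\<alpha>,
      folded Z.right_trace_def W.right_trace_def Z.left_trace_def W.left_trace_def]
  show "AE x in M. zl x \<bullet> \<alpha> x + \<beta> x \<bullet> q x = 0"
  proof (rule AE_eq_zero_if_atMost_integrals[OF W.sigma_finite_M W.sets P(1)])
    fix x assume "a < x" "x < b"
    then show "(LINT t:{a<..x}|M. zl t \<bullet> \<alpha> t + \<beta> t \<bullet> q t) = 0" using P(2)[of x] c 1(2)[of x] by simp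
  qed
qed

end

context sphere_pair
begin

lemma AE_in_I: "AE x in M. x \<in> W.I" by (rule AE_I2) (simp add: W.space_M)

lemma Tminus_eq: "x \<in> JW \<Longrightarrow> Tminus W.I w x = geodesic_dir (p x) (q x)"
  and Tplus_eq: "x \<in> JW \<Longrightarrow> Tplus W.I w x = - geodesic_dir (q x) (p x)"
proof -
  assume x: "x \<in> JW"
  then have I: "x \<in> W.I" using W.jump_set_sub by blast
  have "p x \<noteq> q x" using x JW_iff[OF I] by simp
  note U = unit_jump[OF unit[OF I] this inner_nonneg[OF I]]
  show "Tminus W.I w x = geodesic_dir (p x) (q x)" "Tplus W.I w x = - geodesic_dir (q x) (p x)"
    unfolding Tminus_def Tplus_def W.trL_eq[OF I] W.trR_eq[OF I] U by simp_all
qed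

lemma jump_scaled: "x \<in> W.I \<Longrightarrow> measure M {x} *\<^sub>R (norm (\<alpha> x) *\<^sub>R mid_dir x) = (norm (q x - p x) / norm (p x + q x)) *\<^sub>R (p x + q x)"
  unfolding W.jump by (simp add: mid_dir_def)

text \<open>
  Off the jumps \<open>z \<cdot> \<alpha> = |\<alpha>|\<close>, and the product rule turns this into \<open>q \<cdot> \<beta> = - |\<alpha>|\<close>. At a jump \<open>l = 0\<close> and
  the claim is \<open>geodesic_dir_jump\<close>, divided by the mass of the atom.
\<close>

lemma measure_equation_of_strong:
  assumes ev: "AE x in M. x \<notin> JZ \<longrightarrow> l x *\<^sub>R v' x = tproj (q x) (\<beta> x)"
    and orth: "AE x in lebesgue_on W.I. z x \<bullet> w x = 0"
    and diff: "AE x in M. x \<notin> JW \<longrightarrow> norm (\<alpha> x) *\<^sub>R zr x = \<alpha> x"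
    and sub: "JZ \<subseteq> JW"
    and jumps: "\<And>x. x \<in> JW \<Longrightarrow> zl x = geodesic_dir (p x) (q x) \<and> zr x = - geodesic_dir (q x) (p x)"
  shows "AE x in M. l x *\<^sub>R v' x = \<beta> x + norm (\<alpha> x) *\<^sub>R mid_dir x"
  using ev orthogonal_traces(3)[OF orth] diff AE_in_I
proof eventually_elim
  case (elim x)
  show ?case
  proof (cases "x \<in> JW")
    case True
    have "measure M {x} *\<^sub>R \<beta> x = - geodesic_dir (q x) (p x) - geodesic_dir (p x) (q x)"
      using Z.jump[OF elim(4)] jumps[OF True] by simp
    also have "\<dots> = - (measure M {x} *\<^sub>R (norm (\<alpha> x) *\<^sub>R mid_dir x))"
      unfolding jump_scaled[OF elim(4)] by (rule geodesic_dir_jump[OF unit[OF elim(4)] inner_less_1[OF True]])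
    finally have "measure M {x} *\<^sub>R (\<beta> x + norm (\<alpha> x) *\<^sub>R mid_dir x) = 0" by (simp add: scaleR_add_right)
    then show ?thesis using JW_atom[OF True] by simp
  next
    case False
    then have "x \<notin> JZ" using sub by blast
    then have zz: "zl x = zr x" and ev: "l x *\<^sub>R v' x = \<beta> x - (q x \<bullet> \<beta> x) *\<^sub>R q x"
      using JZ_iff[OF elim(4)] elim(1) by (auto simp: tproj_def)
    have d: "norm (\<alpha> x) *\<^sub>R zr x = \<alpha> x" using elim(3) False by simp
    have "zr x \<bullet> \<alpha> x = norm (\<alpha> x)"
    proof (cases "\<alpha> x = 0")
      case False
      have "norm (\<alpha> x) * (zr x \<bullet> \<alpha> x) = \<alpha> x \<bullet> \<alpha> x" using arg_cong[OF d, of "\<lambda>y. y \<bullet> \<alpha> x"] by simp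
      also have "\<dots> = norm (\<alpha> x) * norm (\<alpha> x)" by (simp add: dot_square_norm power2_eq_square)
      finally show ?thesis using False by simp
    qed simp
    then have "q x \<bullet> \<beta> x = - norm (\<alpha> x)" using elim(2) zz by (simp add: inner_commute)
    then show ?thesis using ev mid_dir_off[OF elim(4) False] by simp
  qed
qed

text \<open>
  The left-hand side is the density of the derivative of \<open>z \<and> w\<close>. Off the jumps \<open>z\<close> is parallel to
  \<open>\<alpha>\<close>, and \<open>\<beta>\<close> is \<open>l v\<close> up to a multiple of \<open>q\<close>. At a jump both \<open>T\<^sup>- \<and> p\<close> and \<open>T\<^sup>+ \<and> q\<close> are the bivector of
  the plane of the geodesic, so \<open>z \<and> w\<close> does not jump.
\<close>

lemma wedge_equation_of_strong:
  assumes eq: "AE x in M. l x *\<^sub>R v' x = \<beta> x + norm (\<alpha> x) *\<^sub>R mid_dir x"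
    and diff: "AE x in M. x \<notin> JW \<longrightarrow> norm (\<alpha> x) *\<^sub>R zr x = \<alpha> x"
    and sub: "JZ \<subseteq> JW"
    and jumps: "\<And>x. x \<in> JW \<Longrightarrow> zl x = geodesic_dir (p x) (q x) \<and> zr x = - geodesic_dir (q x) (p x)"
  shows "AE x in M. wedge (zl x) (\<alpha> x) + wedge (\<beta> x) (q x) = l x *\<^sub>R wedge (v' x) (q x)"
  using eq diff AE_in_I
proof eventually_elim
  case (elim x)
  show ?case
  proof (cases "x \<in> JW")
    case True
    have "measure M {x} *\<^sub>R (wedge (zl x) (\<alpha> x) + wedge (\<beta> x) (q x))
        = wedge (zl x) (measure M {x} *\<^sub>R \<alpha> x) + wedge (measure M {x} *\<^sub>R \<beta> x) (q x)"
      by (simp add: wedge.scaleR_left wedge.scaleR_right scaleR_add_right)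
    also have "\<dots> = wedge (zl x) (q x - p x) + wedge (zr x - zl x) (q x)"
      unfolding W.jump[OF elim(3), symmetric] Z.jump[OF elim(3), symmetric] ..
    also have "\<dots> = wedge (zr x) (q x) - wedge (zl x) (p x)"
      by (simp add: wedge.diff_left wedge.diff_right)
    also have "\<dots> = 0" using jumps[OF True] wedge_geodesic_dir[of "q x" "p x"] by simp
    finally show ?thesis using JW_atom[OF True] by simp
  next
    case False
    then have "x \<notin> JZ" using sub by blast
    then have zz: "zl x = zr x" using JZ_iff[OF elim(3)] by simp
    have d: "norm (\<alpha> x) *\<^sub>R zr x = \<alpha> x" using elim(2) False by simp
    have "wedge (zl x) (\<alpha> x) = 0" unfolding zz by (subst d[symmetric]) (simp add: wedge.scaleR_right)
    moreover have "l x *\<^sub>R wedge (v' x) (q x) = wedge (l x *\<^sub>R v' x) (q x)" by (simp add: wedge.scaleR_left)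
    moreover have "\<dots> = wedge (\<beta> x) (q x)"
      unfolding elim(1) mid_dir_off[OF elim(3) False] by (simp add: wedge.add_left wedge.scaleR_left)
    ultimately show ?thesis by simp
  qed
qed

text \<open>
  At an atom \<open>l = 0\<close>, and the measure equation prescribes the jump of \<open>z\<close>; if \<open>p = q\<close> this jump is zero,
  otherwise \<open>geodesic_dir_jump_unique\<close> determines both one-sided values. Elsewhere the inner product
  with \<open>q\<close> gives \<open>q \<cdot> \<beta> = - |\<alpha>|\<close>, that is \<open>z \<cdot> \<alpha> = |\<alpha>|\<close>, and \<open>|z| \<le> 1\<close> does the rest.
\<close>

lemma strong_of_measure_equation:
  assumes eq: "AE x in M. l x *\<^sub>R v' x = \<beta> x + norm (\<alpha> x) *\<^sub>R mid_dir x"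
    and orth: "AE x in lebesgue_on W.I. z x \<bullet> w x = 0"
    and vw: "AE x in lebesgue_on W.I. w x \<bullet> v x = 0"
    and le: "\<And>x. x \<in> W.I \<Longrightarrow> norm (zl x) \<le> 1 \<and> norm (zr x) \<le> 1"
  shows "JZ \<subseteq> JW" "\<And>x. x \<in> JW \<Longrightarrow> zl x = geodesic_dir (p x) (q x) \<and> zr x = - geodesic_dir (q x) (p x)"
    and "AE x in M. x \<notin> JW \<longrightarrow> norm (\<alpha> x) *\<^sub>R zr x = \<alpha> x"
    and "AE x in M. x \<notin> JZ \<longrightarrow> l x *\<^sub>R v' x = tproj (q x) (\<beta> x)"
proof -
  have atom: "zr x - zl x = - ((norm (q x - p x) / norm (p x + q x)) *\<^sub>R (p x + q x))"
    if x: "x \<in> W.I" "measure M {x} \<noteq> 0" for x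
  proof -
    have "l x = 0" using W.atom_density_zero[OF x(1)] x(2) by simp
    then have "\<beta> x = - (norm (\<alpha> x) *\<^sub>R mid_dir x)" using W.AE_atom[OF eq x] by (simp add: eq_neg_iff_add_eq_0)
    then have "zr x - zl x = - (measure M {x} *\<^sub>R (norm (\<alpha> x) *\<^sub>R mid_dir x))" using Z.jump[OF x(1)] by simp
    then show ?thesis unfolding jump_scaled[OF x(1)] .
  qed
  show sub: "JZ \<subseteq> JW"
  proof
    fix x assume x: "x \<in> JZ"
    then have I: "x \<in> W.I" and m: "measure M {x} \<noteq> 0" by (auto simp: Z.jump_set_eq)
    show "x \<in> JW"
    proof (rule ccontr)
      assume "x \<notin> JW"
      then have "p x = q x" using JW_iff[OF I] by simp
      then have "zr x = zl x" using atom[OF I m] by simp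
      then show False using x JZ_iff[OF I] by simp
    qed
  qed
  show jumps: "zl x = geodesic_dir (p x) (q x) \<and> zr x = - geodesic_dir (q x) (p x)" if x: "x \<in> JW" for x
  proof -
    have I: "x \<in> W.I" using x W.jump_set_sub by blast
    have z: "norm (zl x) \<le> 1" using le[OF I] by (rule conjunct1)
    show ?thesis
      by (rule conjI; rule geodesic_dir_jump_unique[OF unit[OF I] inner_less_1[OF x]
          orthogonal_traces(1)[OF orth I] orthogonal_traces(2)[OF orth I] z atom[OF I JW_atom(1)[OF x]]])
  qed
  from vw v'(2) W.eq_right_trace have "AE x in lebesgue_on W.I. q x \<bullet> v' x = 0" by eventually_elim simp
  then have qv: "AE x in M. 0 < l x \<longrightarrow> q x \<bullet> v' x = 0" by (simp add: W.AE_lebesgue_iff)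
  have core: "AE x in M. x \<notin> JW \<longrightarrow> zl x = zr x \<and> q x \<bullet> \<beta> x = - norm (\<alpha> x) \<and> l x *\<^sub>R v' x = \<beta> x + norm (\<alpha> x) *\<^sub>R q x"
    using eq qv AE_in_I
  proof eventually_elim
    case (elim x)
    show ?case
    proof
      assume x: "x \<notin> JW"
      then have zz: "zl x = zr x" using sub JZ_iff[OF elim(3)] by blast
      have e: "l x *\<^sub>R v' x = \<beta> x + norm (\<alpha> x) *\<^sub>R q x" using elim(1) mid_dir_off[OF elim(3) x] by simp
      have "q x \<bullet> (l x *\<^sub>R v' x) = 0" using elim(2) W.l(2)[of x] by (cases "l x = 0") auto
      then have "q x \<bullet> \<beta> x + norm (\<alpha> x) = 0"
        unfolding e using inner_self_unit[OF unit(2)[OF elim(3)]] by (simp add: inner_add_right)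
      then show "zl x = zr x \<and> q x \<bullet> \<beta> x = - norm (\<alpha> x) \<and> l x *\<^sub>R v' x = \<beta> x + norm (\<alpha> x) *\<^sub>R q x"
        using zz e by simp
    qed
  qed
  show "AE x in M. x \<notin> JW \<longrightarrow> norm (\<alpha> x) *\<^sub>R zr x = \<alpha> x"
    using core orthogonal_traces(3)[OF orth] AE_in_I
  proof eventually_elim
    case (elim x)
    show ?case
    proof
      assume "x \<notin> JW"
      then have c: "zl x = zr x" "q x \<bullet> \<beta> x = - norm (\<alpha> x)" using elim(1) by auto
      show "norm (\<alpha> x) *\<^sub>R zr x = \<alpha> x"
      proof (cases "\<alpha> x = 0")
        case False
        have "zr x \<bullet> \<alpha> x = norm (\<alpha> x)" using elim(2) c by (simp add: inner_commute)
        then have 1: "zr x \<bullet> ((1 / norm (\<alpha> x)) *\<^sub>R \<alpha> x) = 1" using False by simp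
        have 2: "norm ((1 / norm (\<alpha> x)) *\<^sub>R \<alpha> x) = 1" using False by simp
        have "zr x = (1 / norm (\<alpha> x)) *\<^sub>R \<alpha> x"
          by (rule eq_if_inner_eq_1[OF conjunct2[OF le[OF elim(3)]] 2 1])
        then show ?thesis using False by simp
      qed simp
    qed
  qed
  show "AE x in M. x \<notin> JZ \<longrightarrow> l x *\<^sub>R v' x = tproj (q x) (\<beta> x)"
    using core AE_in_I
  proof eventually_elim
    case (elim x)
    show ?case
    proof
      assume x: "x \<notin> JZ"
      have "x \<notin> JW"
      proof
        assume J: "x \<in> JW"
        have "zl x = zr x" using x JZ_iff[OF elim(2)] by simp
        then have "geodesic_dir (p x) (q x) + geodesic_dir (q x) (p x) = 0" using jumps[OF J] by simp
        then have e: "geodesic_dir (p x) (q x) = - geodesic_dir (q x) (p x)" by (simp add: eq_neg_iff_add_eq_0)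
        have "geodesic_dir (p x) (q x) \<bullet> q x = 0"
          unfolding e using geodesic_dir_tangent[OF unit(2)[OF elim(2)], of "p x"] by (simp add: inner_commute)
        moreover have "geodesic_dir (p x) (q x) \<bullet> p x = 0"
          using geodesic_dir_tangent[OF unit(1)[OF elim(2)], of "q x"] by (simp add: inner_commute)
        ultimately have "geodesic_dir (p x) (q x) \<bullet> ((1 / sqrt (1 - (p x \<bullet> q x)\<^sup>2)) *\<^sub>R (q x - (p x \<bullet> q x) *\<^sub>R p x)) = 0"
          by (simp add: inner_diff_right)
        then have "geodesic_dir (p x) (q x) \<bullet> geodesic_dir (p x) (q x) = 0" unfolding geodesic_dir_def[symmetric] .
        then show False using norm_geodesic_dir[OF unit[OF elim(2)] inner_less_1[OF J]] by (simp add: inner_self_unit)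
      qed
      then show "l x *\<^sub>R v' x = tproj (q x) (\<beta> x)" using elim(1) by (simp add: tproj_def)
    qed
  qed
qed

lemma wedge_weak_derivative:
  assumes eq: "AE x in M. wedge (zl x) (\<alpha> x) + wedge (\<beta> x) (q x) = l x *\<^sub>R wedge (v' x) (q x)"
    and le: "\<And>x. x \<in> W.I \<Longrightarrow> norm (zr x) \<le> 1"
  shows "has_weak_deriv_L2 W.I (\<lambda>x. wedge (z x) (w x)) (\<lambda>x. wedge (v x) (w x))"
proof -
  let ?L = "lebesgue_on W.I"
  obtain K where K: "0 < K" "\<And>x y. norm (wedge x y :: real ^ 'n ^ 'n) \<le> norm x * norm y * K"
    using wedge.pos_bounded by blast
  have wm: "(\<lambda>x. wedge (f x) (g x) :: real ^ 'n ^ 'n) \<in> borel_measurable N"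
    if "f \<in> borel_measurable N" "g \<in> borel_measurable N" for f g and N :: "real measure"
    by (rule borel_measurable_continuous_Pair[OF that])
       (rule wedge.continuous_on[OF continuous_on_fst[OF continuous_on_id] continuous_on_snd[OF continuous_on_id]])
  have zi: "integrable ?L z" and wi: "integrable ?L w" using Z.bv W.bv by (auto simp: BV_def)
  have vm: "v \<in> borel_measurable ?L" and v2: "integrable ?L (\<lambda>x. (norm (v x))\<^sup>2)" using v by (auto simp: L2_def)
  have inI: "AE x in ?L. x \<in> W.I" by (rule AE_I2) (simp add: space_restrict_space)
  have nw: "AE x in ?L. norm (w x) = 1" using W.eq_right_trace inI by eventually_elim (simp add: unit)
  have i1: "integrable ?L (\<lambda>x. wedge (z x) (w x))"
  proof (rule Bochner_Integration.integrable_bound[OF integrable_mult_left[OF integrable_norm[OF zi], of K]])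
    show "(\<lambda>x. wedge (z x) (w x)) \<in> borel_measurable ?L" using zi wi by (intro wm) auto
    show "AE x in ?L. norm (wedge (z x) (w x)) \<le> norm (norm (z x) * K)"
      using nw
    proof eventually_elim
      case (elim x)
      show ?case using K(2)[of "z x" "w x"] elim K(1) by simp
    qed
  qed
  have i2: "L2 W.I (\<lambda>x. wedge (v x) (w x))" unfolding L2_def
  proof
    show m: "(\<lambda>x. wedge (v x) (w x)) \<in> borel_measurable ?L" using vm wi by (intro wm) auto
    show "integrable ?L (\<lambda>x. (norm (wedge (v x) (w x)))\<^sup>2)"
    proof (rule Bochner_Integration.integrable_bound[OF integrable_mult_left[OF v2, of "K\<^sup>2"]])
      show "(\<lambda>x. (norm (wedge (v x) (w x)))\<^sup>2) \<in> borel_measurable ?L" using m by measurable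
      show "AE x in ?L. norm ((norm (wedge (v x) (w x)))\<^sup>2) \<le> norm ((norm (v x))\<^sup>2 * K\<^sup>2)"
        using nw
      proof eventually_elim
        case (elim x)
        have "(norm (wedge (v x) (w x)))\<^sup>2 \<le> (norm (v x) * K)\<^sup>2"
          using K(2)[of "v x" "w x"] elim by (intro power_mono) auto
        then show ?case by (simp add: power_mult_distrib)
      qed
    qed
  qed
  note P = primitive_product[where cz = Z.base_value and cw = W.base_value, OF bounded_bilinear_wedge W.sigma_finite_M W.sets Z.\<alpha> W.\<alpha>,
      folded Z.right_trace_def W.right_trace_def Z.left_trace_def W.left_trace_def]
  have weak: "(LINT x|?L. deriv \<phi> x *\<^sub>R wedge (z x) (w x)) = - (LINT x|?L. \<phi> x *\<^sub>R wedge (v x) (w x))"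
    if \<phi>: "\<phi> \<in> C1_c W.I" for \<phi>
  proof -
    note D\<phi> = C1_c_deriv[OF \<phi> W.ab]
    have dm: "deriv \<phi> \<in> borel_measurable ?L"
      by (intro borel_measurable_lebesgue_on borel_measurable_continuous_onI D\<phi>(2))
    have \<phi>m: "\<phi> \<in> borel_measurable borel"
      by (rule borel_measurable_continuous_onI, rule DERIV_continuous_on, rule D\<phi>(1))
    have qm: "q \<in> borel_measurable borel" and zm: "zr \<in> borel_measurable borel"
      by (rule W.right_trace_measurable, rule Z.right_trace_measurable)
    have "(LINT x|?L. deriv \<phi> x *\<^sub>R wedge (z x) (w x)) = (LINT x|?L. deriv \<phi> x *\<^sub>R wedge (zr x) (q x))"
    proof (rule integral_cong_AE)
      show "(\<lambda>x. deriv \<phi> x *\<^sub>R wedge (z x) (w x)) \<in> borel_measurable ?L" using dm i1 by measurable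
      show "(\<lambda>x. deriv \<phi> x *\<^sub>R wedge (zr x) (q x)) \<in> borel_measurable ?L"
        by (intro borel_measurable_scaleR dm wm borel_measurable_lebesgue_on qm zm)
      show "AE x in ?L. deriv \<phi> x *\<^sub>R wedge (z x) (w x) = deriv \<phi> x *\<^sub>R wedge (zr x) (q x)"
        using W.eq_right_trace Z.eq_right_trace by eventually_elim simp
    qed
    also have "\<dots> = - (LINT x|M. \<phi> x *\<^sub>R (wedge (zl x) (\<alpha> x) + wedge (\<beta> x) (q x)))"
      using integral_test_deriv_primitive(2)[OF W.ab W.sigma_finite_M W.sets P(1) \<phi>, of "wedge Z.base_value W.base_value"] unfolding P(2) .
    also have "(LINT x|M. \<phi> x *\<^sub>R (wedge (zl x) (\<alpha> x) + wedge (\<beta> x) (q x))) = (LINT x|M. l x *\<^sub>R (\<phi> x *\<^sub>R wedge (v' x) (q x)))"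
    proof (rule integral_cong_AE)
      have \<phi>M: "\<phi> \<in> borel_measurable M" by (rule borel_measurable_on_borel_sets[OF W.sets \<phi>m])
      show "(\<lambda>x. \<phi> x *\<^sub>R (wedge (zl x) (\<alpha> x) + wedge (\<beta> x) (q x))) \<in> borel_measurable M"
        by (rule borel_measurable_scaleR[OF \<phi>M borel_measurable_integrable[OF P(1)]])
      show "(\<lambda>x. l x *\<^sub>R (\<phi> x *\<^sub>R wedge (v' x) (q x))) \<in> borel_measurable M"
        by (intro borel_measurable_scaleR \<phi>M wm v'_measurable q_measurable) (use W.l in simp)
      show "AE x in M. \<phi> x *\<^sub>R (wedge (zl x) (\<alpha> x) + wedge (\<beta> x) (q x)) = l x *\<^sub>R (\<phi> x *\<^sub>R wedge (v' x) (q x))"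
        using eq by eventually_elim (simp add: scaleR_left_commute)
    qed
    also have "\<dots> = (LINT x|?L. \<phi> x *\<^sub>R wedge (v' x) (q x))"
      by (rule integral_lebesgue_on_density(1)[OF _ W.sets borel_measurable_integrable[OF W.l(1)] W.l(2) W.leb, symmetric])
         (auto intro!: borel_measurable_scaleR \<phi>m wm v'(1) qm)
    also have "\<dots> = (LINT x|?L. \<phi> x *\<^sub>R wedge (v x) (w x))"
    proof (rule integral_cong_AE)
      show "(\<lambda>x. \<phi> x *\<^sub>R wedge (v' x) (q x)) \<in> borel_measurable ?L"
        by (intro borel_measurable_scaleR wm borel_measurable_lebesgue_on \<phi>m v'(1) qm)
      show "(\<lambda>x. \<phi> x *\<^sub>R wedge (v x) (w x)) \<in> borel_measurable ?L"
        using i2 borel_measurable_lebesgue_on[OF \<phi>m] unfolding L2_def by (intro borel_measurable_scaleR) auto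
      show "AE x in ?L. \<phi> x *\<^sub>R wedge (v' x) (q x) = \<phi> x *\<^sub>R wedge (v x) (w x)"
        using W.eq_right_trace v'(2) by eventually_elim simp
    qed
    finally show ?thesis .
  qed
  show ?thesis unfolding has_weak_deriv_L2_def using i1 i2 weak by blast
qed

lemma strong_iff_measure_equation:
  assumes vw: "AE x in lebesgue_on W.I. w x \<bullet> v x = 0"
  shows "strong_conditions W.I v w z \<longleftrightarrow> measure_conditions W.I v w z"
proof -
  let ?E = "AE x in M. x \<notin> JZ \<longrightarrow> l x *\<^sub>R v' x = tproj (q x) (\<beta> x)"
  let ?O = "AE x in lebesgue_on W.I. z x \<bullet> w x = 0"
  let ?N = "norm_le_one W.I z"
  let ?F = "AE x in M. x \<notin> JW \<longrightarrow> norm (\<alpha> x) *\<^sub>R zr x = \<alpha> x"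
  let ?J = "\<forall>x\<in>JW. zl x = geodesic_dir (p x) (q x) \<and> zr x = - geodesic_dir (q x) (p x)"
  let ?Q = "AE x in M. l x *\<^sub>R v' x = \<beta> x + norm (\<alpha> x) *\<^sub>R mid_dir x"
  have J_iff: "(\<forall>x\<in>JW. trL W.I z x = Tminus W.I w x \<and> trR W.I z x = Tplus W.I w x) \<longleftrightarrow> ?J"
  proof (rule ball_cong[OF refl])
    fix x assume x: "x \<in> JW"
    then have I: "x \<in> W.I" using W.jump_set_sub by blast
    show "(trL W.I z x = Tminus W.I w x \<and> trR W.I z x = Tplus W.I w x) \<longleftrightarrow>
      (zl x = geodesic_dir (p x) (q x) \<and> zr x = - geodesic_dir (q x) (p x))"
      by (simp add: Tminus_eq[OF x] Tplus_eq[OF x] Z.trL_eq[OF I] Z.trR_eq[OF I])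
  qed
  have N_D: "norm (zl x) \<le> 1 \<and> norm (zr x) \<le> 1" if "?N" "x \<in> W.I" for x
    using that by (simp add: norm_le_one_def Z.trL_eq Z.trR_eq)
  have fwd: "?Q \<and> has_weak_deriv_L2 W.I (\<lambda>x. wedge (z x) (w x)) (\<lambda>x. wedge (v x) (w x))"
    if H: ?E ?O ?N ?F "JZ \<subseteq> JW" ?J
  proof -
    have J: "\<And>x. x \<in> JW \<Longrightarrow> zl x = geodesic_dir (p x) (q x) \<and> zr x = - geodesic_dir (q x) (p x)" using H(6) by blast
    have Q: ?Q by (rule measure_equation_of_strong[OF H(1,2,4,5) J])
    from wedge_weak_derivative[OF wedge_equation_of_strong[OF Q H(4,5) J]] N_D[OF H(3)] Q
    show ?thesis by blast
  qed
  have bwd: "?E \<and> ?F \<and> JZ \<subseteq> JW \<and> ?J" if H: ?Q ?O ?N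
    using strong_of_measure_equation[OF H(1,2) vw N_D[OF H(3)]] by blast
  show ?thesis
    unfolding strong_conditions_def measure_conditions_def
      measure_equation_iff diffuse_condition_iff tangent_condition_iff J_iff
      conj_assoc[symmetric] evolution_condition_iff
    using fwd bwd by blast
qed

end

lemma slice_equivalence:
  fixes w z v :: "real \<Rightarrow> real ^ 'n"
  assumes ab: "a < b" and I: "I = {a<..<b}" and w: "BV I w" and z: "BV I z"
    and sphere: "AE x in lebesgue_on I. w x \<in> pos_sphere"
    and v: "L2 I v" and vw: "AE x in lebesgue_on I. w x \<bullet> v x = 0"
  shows "\<forall>x\<in>I. geodesic_dist (trL I w x) (trR I w x) < ennreal pi"
    and "strong_conditions I v w z \<longleftrightarrow> measure_conditions I v w z"
proof -
  have Iborel: "I \<in> sets borel" and Ifin: "emeasure lborel I < \<infinity>" using ab by (simp_all add: I)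
  have "has_deriv_measure I f (Dm I f)" if "BV I f" for f :: "real \<Rightarrow> real ^ 'n"
    using that unfolding BV_def Dm_def by (metis someI_ex)
  then have vm: "vector_measure I (Dm I w)" "vector_measure I (Dm I z)"
    using w z unfolding has_deriv_measure_def by blast+
  obtain M \<alpha> \<beta> and l :: "real \<Rightarrow> real" where M: "finite_measure M" "sets M = borel_sets I"
    "integrable M \<alpha>" "\<And>A. A \<in> borel_sets I \<Longrightarrow> Dm I w A = set_lebesgue_integral M A \<alpha>"
    "integrable M \<beta>" "\<And>A. A \<in> borel_sets I \<Longrightarrow> Dm I z A = set_lebesgue_integral M A \<beta>"
    "integrable M l" "\<And>x. 0 \<le> l x"
    "\<And>A. A \<in> borel_sets I \<Longrightarrow> measure lborel A = set_lebesgue_integral M A l"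
    using common_density[OF vm Iborel Ifin] by blast
  have leb: "restrict_space lborel I = density M (\<lambda>x. ennreal (l x))"
    by (rule lebesgue_eq_density[OF Iborel M(2,7,8,9) Ifin])
  obtain v' where v': "v' \<in> borel_measurable borel" "AE x in lebesgue_on I. v x = v' x"
    using lebesgue_on_borel_version[OF Iborel conjunct1[OF v[unfolded L2_def]]] by blast
  interpret sphere_pair a b M l w \<alpha> z \<beta> v v'
    by (intro sphere_pair.intro bv_density.intro interval_measure.intro bv_density_axioms.intro sphere_pair_axioms.intro)
      (fact ab M(1,3,5,7,8) M(2)[unfolded I] M(4)[unfolded I] M(6)[unfolded I] leb[unfolded I]
        w[unfolded I] z[unfolded I] sphere[unfolded I] v[unfolded I] v'(1) v'(2)[unfolded I])+
  show "\<forall>x\<in>I. geodesic_dist (trL I w x) (trR I w x) < ennreal pi"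
    unfolding I using geodesic_dist_less_pi[OF unit inner_nonneg] by (simp add: W.trL_eq W.trR_eq)
  show "strong_conditions I v w z \<longleftrightarrow> measure_conditions I v w z"
    using strong_iff_measure_equation[OF vw[unfolded I]] unfolding I .
qed

section \<open>Solutions of the evolution problem\<close>

theorem theorem8p2:
  fixes a b :: real and I :: "real set" and T :: ereal
    and u :: "real \<Rightarrow> real \<Rightarrow> real ^ 'n"
  assumes "a < b" and "I = {a<..<b}"
    and "0 < T"
    and "H1_loc_L2 I T u" and "Linf_loc_BV I T u"
    and "takes_values_in I T u pos_sphere"
  shows "strong_solution I T u \<longleftrightarrow> solution_B I T u"
proof -
  let ?L = "lebesgue_on (time_interval T)"
  let ?v = "time_deriv I T u"
  have deriv: "has_time_deriv I T u ?v"
    using assms(4) unfolding H1_loc_L2_def time_deriv_def by (rule someI_ex)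
  have sphere: "AE t in ?L. AE x in lebesgue_on I. u t x \<in> pos_sphere"
    using assms(6) by (simp add: takes_values_in_def)
  have "AE t in ?L. AE x in lebesgue_on I. norm (u t x) = 1"
    using sphere by eventually_elim (auto simp: pos_sphere_def elim: eventually_mono)
  from time_derivative_orthogonal[OF assms(1,2) deriv this]
  have v: "AE t in ?L. L2 I (?v t) \<and> (AE x in lebesgue_on I. u t x \<bullet> ?v t x = 0)" .
  have u: "AE t in ?L. BV I (u t)"
    by (rule AE_time_intervalI) (use assms(5) in \<open>simp add: Linf_loc_BV_def wstar_measurable_BV_def\<close>)
  have geodesic: "AE t in ?L. \<forall>x\<in>I. geodesic_dist (trL I (u t) x) (trR I (u t) x) < ennreal pi"
    using v u sphere
  proof eventually_elim
    case (elim t)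
    from slice_equivalence(1)[OF assms(1,2) elim(2,2,3)] elim(1) show ?case by blast
  qed
  have "(AE t in ?L. strong_conditions I (?v t) (u t) (z t)) \<longleftrightarrow> (AE t in ?L. measure_conditions I (?v t) (u t) (z t))"
    if "L2_wstar_loc_BV I T z" for z
  proof -
    have "AE t in ?L. BV I (z t)"
      by (rule AE_time_intervalI) (use that in \<open>simp add: L2_wstar_loc_BV_def wstar_measurable_BV_def\<close>)
    with v u sphere
    have "AE t in ?L. strong_conditions I (?v t) (u t) (z t) \<longleftrightarrow> measure_conditions I (?v t) (u t) (z t)"
    proof eventually_elim
      case (elim t)
      from slice_equivalence(2)[OF assms(1,2) elim(2,4,3) conjunct1[OF elim(1)] conjunct2[OF elim(1)]] show ?case .
    qed
    then show ?thesis by (rule eventually_subst)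
  qed
  then show ?thesis
    unfolding strong_solution_def solution_B_def strong_conditions_def measure_conditions_def
    using geodesic by blast
qed

end
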